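(* Let $1\le n\le m$ be integers, $\theta>0$, $L>0$, $\sigma\ge 0$, $\hat G>0$, $f_*\in\mathbb R$, and let $f(X)=\mathbb E_{\xi\sim\mathcal D}[f(X;\xi)]$, $X\in\mathbb R^{m\times n}$, satisfy: (i) $f(X)\ge f_*$ for all $X$; (ii) for all $X$, $\mathbb E_\xi[\nabla f(X;\xi)]=\nabla f(X)$ and $\mathbb E_\xi[\|\nabla f(X;\xi)-\nabla f(X)\|_F^2]\le\sigma^2$; (iii) $\|\nabla f(X;\xi)-\nabla f(Y;\xi)\|_F\le L\|X-Y\|_F$ for all $X,Y$ and all $\xi$; (iv) almost surely, $\|\nabla f(X;\xi)\|_F\le\hat G$ for all $X$. Let $(X_t)_{t\ge1}$ be generated by OptMuon-I (defined in the context) with learning rate $\theta$ and initial point $X_1$. Then for every integer $T\ge1$, with $C_z:=\sqrt{2C_v}+\sqrt{2C_c}\,\varpi^{1/4}$, $C_{A,1}:=4C_z^2$ and $C_{A,2}:=2C_z$ (where $\varpi,C_c,C_v$ are the explicit constants, independent of $T$ and $\sigma$, defined in the context), $$\mathbb E\Big[\frac1T\sum_{t=1}^T\|\nabla f(X_t)\|_F\Big]\le C_{A,1}\frac{\ln^{3/2}(e+T)}{T^{1/2}}+C_{A,2}\frac{\sigma^{1/3}\ln(e+T)}{T^{1/3}}.$$ Consequently, if $R$ is uniformly distributed on $\{1,\dots,T\}$ and independent of the algorithmic randomness, and $X_{\rm out}:=X_R$, then the same bound holds for $\mathbb E[\|\nabla f(X_{\rm out})\|_F]$.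
   Context: Notation: $\|\cdot\|_F$, $\|\cdot\|_2$, $\|\cdot\|_*$ are the Frobenius, spectral and nuclear norms; $\langle A,B\rangle=\mathrm{tr}(A^\top B)$. The objective $f$ and the sample functions $f(\cdot;\xi)$ are differentiable. Orthogonalization: for $M\in\mathbb R^{m\times n}$ with thin SVD $M=U\Sigma W^\top$, $\mathrm{Orth}(M):=UW^\top$ where $U^\top U=W^\top W=I_n$; if $M$ is rank-deficient, $\mathrm{Orth}(M)$ is any measurable choice of a thin-SVD completion, so that $\|\mathrm{Orth}(M)\|_2=1$, $\|\mathrm{Orth}(M)\|_F^2=n$ and $\langle \mathrm{Orth}(M),M\rangle=\|M\|_*\ge\|M\|_F$. OptMuon-I: fix a deterministic $X_1\in\mathbb R^{m\times n}$; set $X_0=X_1$, $M_0=0$, $\rho_{-1}=\rho_0=1$, $\alpha_0=\alpha_1=1$. For $t=1,2,\dots$: draw $\xi_t\sim\mathcal D$ independently of the past; set $G_t=\nabla f(X_t;\xi_t)$, $g_t=\|G_t\|_F$; $\alpha_t=\rho_{t-1}$ and $\rho_t=\Big(\frac{1+\max_{1\le i\le t}g_i^2}{1+\sum_{i=1}^tg_i^2}\Big)^{2/3}$; $M_t=(1-\alpha_t)\big(M_{t-1}-\nabla f(X_{t-1};\xi_t)\big)+G_t$; $\gamma_t=\min\big\{\sqrt{\alpha_t},\ \big(1+\sum_{j=1}^t\alpha_j^{-1/2}\|M_j\|_F^2\big)^{-1/2}\big\}$; $X_{t+1}=X_t-\theta\gamma_t\|M_t\|_F\,\mathrm{Orth}(M_t)$.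 Constants: $\lambda:=1+\hat G^2$, $\varpi:=\lambda^{2/3}$, $\delta:=nL^2\theta^2$, $\kappa:=2\max\big(12,\ 96\,\delta\varpi^{3/2}\ln(e+36\,\delta\varpi^{3/2}\lambda)\big)$, $c_0:=\theta/2$, $c_1:=n\theta/2$, $c_2:=Ln\theta^2/2$, $F_1:=f(X_1)-f_*$, $C_b:=\big(64(1+\hat G^2)^2+64nL^2\theta^2\big)\ln(e+\kappa+\kappa\hat G^2)$, $C_c:=12(\hat G^2+C_b)$, $C_d:=2\ln(e+\kappa(1+\hat G^2))$, $C_I:=90(1+\hat G^2)^2\ln(e+\hat G^2)$, $C_J:=64nL^2\theta^2\ln(e+\kappa(1+\hat G^2))$, $C_R:=8\sqrt\varpi\,\ln(e+\kappa(1+\hat G^2))$, $\widetilde C_w:=64\hat G^2\varpi C_c+64\delta C_R(\hat G^2+C_I+C_J)$, $C_K:=4(\widetilde C_w^2+\widetilde C_w)$, $C_u:=288(\hat G^4+C_I^2+C_J^2+C_K)$, $C_w:=\frac1{c_0}(F_1+c_1C_c+c_2C_d)$, $C_x:=\frac3{c_0^2}(F_1^2+c_1^2C_u+c_2^2C_d^2)$, $C_v:=4\varpi^2(C_w+C_x)$. *)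

theory Defs
  imports "HOL-Analysis.Analysis" "HOL-Probability.Probability"
begin

text \<open>
  An \<open>m \<times> n\<close> matrix is an element of \<open>real^'n^'m\<close>.  The library's inner product and norm on
  this type are the trace inner product and the Frobenius norm.
\<close>

lemma inner_matrix_eq_trace:
  fixes A B :: "real^'n^'m"
  shows "inner A B = trace (transpose A ** B)"
proof -
  have "trace (transpose A ** B) = (\<Sum>j\<in>UNIV. \<Sum>i\<in>UNIV. A$i$j * B$i$j)"
    by (simp add: trace_def matrix_matrix_mult_def transpose_def)
  also have "\<dots> = (\<Sum>i\<in>UNIV. \<Sum>j\<in>UNIV. A$i$j * B$i$j)"
    by (rule sum.swap)
  finally show ?thesis
    by (simp add: inner_vec_def)
qed

lemma norm_matrix_eq_frobenius:
  fixes A :: "real^'n^'m"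
  shows "norm A = sqrt (\<Sum>i\<in>UNIV. \<Sum>j\<in>UNIV. (A$i$j)\<^sup>2)"
  by (simp add: norm_eq_sqrt_inner inner_vec_def power2_eq_square)

definition grad :: "('a::real_inner \<Rightarrow> real) \<Rightarrow> 'a \<Rightarrow> 'a"
  where "grad f x = (THE D. GDERIV f x :> D)"

lemma GDERIV_grad:
  fixes f :: "'a::euclidean_space \<Rightarrow> real"
  assumes "f differentiable at x"
  shows "GDERIV f x :> grad f x"
proof -
  obtain f' where f': "(f has_derivative f') (at x)"
    using assms by (auto simp: differentiable_def)
  have lin: "linear f'"
    using f' by (rule has_derivative_linear)
  have "f' = (\<lambda>h. inner h (\<Sum>b\<in>Basis. f' b *\<^sub>R b))"
  proof
    fix h
    have "f' h = f' (\<Sum>b\<in>Basis. inner h b *\<^sub>R b)"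
      by (simp add: euclidean_representation)
    also have "\<dots> = (\<Sum>b\<in>Basis. inner h b * f' b)"
      by (simp add: linear_sum[OF lin] linear_scale[OF lin])
    also have "\<dots> = inner h (\<Sum>b\<in>Basis. f' b *\<^sub>R b)"
      by (simp add: inner_sum_right mult.commute)
    finally show "f' h = inner h (\<Sum>b\<in>Basis. f' b *\<^sub>R b)" .
  qed
  then have ex: "GDERIV f x :> (\<Sum>b\<in>Basis. f' b *\<^sub>R b)"
    using f' by (simp add: gderiv_def)
  have uniq: "D = E" if "GDERIV f x :> D" "GDERIV f x :> E" for D E
  proof -
    have "(\<lambda>h. inner h D) = (\<lambda>h. inner h E)"
      using that unfolding gderiv_def by (rule has_derivative_unique)
    then have "inner (D - E) D = inner (D - E) E"
      by metis
    then show ?thesis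
      by (metis eq_iff_diff_eq_0 inner_diff_right inner_eq_zero_iff)
  qed
  show ?thesis
    unfolding grad_def by (rule theI[of _ "\<Sum>b\<in>Basis. f' b *\<^sub>R b"]) (use ex uniq in auto)
qed


section \<open>Orthogonalization\<close>

text \<open>
  For \<open>M\<close> of full column rank \<open>U ** transpose W\<close> is the same for every thin SVD of \<open>M\<close>.  As \<open>U\<close> is
  required to have orthonormal columns even if some singular values vanish, for rank-deficient \<open>M\<close>
  the thin SVDs below range over all completions.
\<close>

definition thin_svd ::
    "real^'n^'m \<Rightarrow> real^'n^'m \<Rightarrow> real^'n^'n \<Rightarrow> real^'n^'n \<Rightarrow> bool"
  where "thin_svd M U S W \<longleftrightarrow>
    transpose U ** U = mat 1 \<and> transpose W ** W = mat 1 \<and>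
    (\<forall>i j. i \<noteq> j \<longrightarrow> S$i$j = 0) \<and> (\<forall>i. 0 \<le> S$i$i) \<and>
    M = U ** S ** transpose W"

definition orthogonalization :: "(real^'n^'m \<Rightarrow> real^'n^'m) \<Rightarrow> bool"
  where "orthogonalization Orth \<longleftrightarrow>
    Orth \<in> borel_measurable borel \<and>
    (\<forall>M. \<exists>U S W. thin_svd M U S W \<and> Orth M = U ** transpose W)"


section \<open>OptMuon-I\<close>

text \<open>
  \<open>F \<xi>\<close> is the sample function of \<open>\<xi>\<close>, \<open>s\<close> a realization of the sample sequence (indexed from 1),
  and \<open>X\<close> the sequence of iterates (indexed from 0).  All quantities at time \<open>t\<close> only depend on
  \<open>X 0, \<dots>, X t\<close> and \<open>s 1, \<dots>, s t\<close>.
\<close>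

definition stoch_grad ::
    "('s \<Rightarrow> real^'n^'m \<Rightarrow> real) \<Rightarrow> (nat \<Rightarrow> 's) \<Rightarrow> (nat \<Rightarrow> real^'n^'m) \<Rightarrow> nat \<Rightarrow> real^'n^'m"
  where "stoch_grad F s X t = grad (F (s t)) (X t)"

definition rho ::
    "('s \<Rightarrow> real^'n^'m \<Rightarrow> real) \<Rightarrow> (nat \<Rightarrow> 's) \<Rightarrow> (nat \<Rightarrow> real^'n^'m) \<Rightarrow> nat \<Rightarrow> real"
  where "rho F s X t =
    (if t = 0 then 1
     else ((1 + (MAX i\<in>{1..t}. (norm (stoch_grad F s X i))\<^sup>2)) /
           (1 + (\<Sum>i=1..t. (norm (stoch_grad F s X i))\<^sup>2))) powr (2/3))"

definition alpha ::
    "('s \<Rightarrow> real^'n^'m \<Rightarrow> real) \<Rightarrow> (nat \<Rightarrow> 's) \<Rightarrow> (nat \<Rightarrow> real^'n^'m) \<Rightarrow> nat \<Rightarrow> real"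
  where "alpha F s X t = (if t = 0 then 1 else rho F s X (t - 1))"

primrec momentum ::
    "('s \<Rightarrow> real^'n^'m \<Rightarrow> real) \<Rightarrow> (nat \<Rightarrow> 's) \<Rightarrow> (nat \<Rightarrow> real^'n^'m) \<Rightarrow> nat \<Rightarrow> real^'n^'m"
  where
    "momentum F s X 0 = 0"
  | "momentum F s X (Suc t) =
      (1 - alpha F s X (Suc t)) *\<^sub>R (momentum F s X t - grad (F (s (Suc t))) (X t))
      + stoch_grad F s X (Suc t)"

definition gamma ::
    "('s \<Rightarrow> real^'n^'m \<Rightarrow> real) \<Rightarrow> (nat \<Rightarrow> 's) \<Rightarrow> (nat \<Rightarrow> real^'n^'m) \<Rightarrow> nat \<Rightarrow> real"
  where "gamma F s X t =
    min (sqrt (alpha F s X t))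
        ((1 + (\<Sum>j=1..t. alpha F s X j powr (-1/2) * (norm (momentum F s X j))\<^sup>2)) powr (-1/2))"

definition OptMuon_I ::
    "('s \<Rightarrow> real^'n^'m \<Rightarrow> real) \<Rightarrow> (real^'n^'m \<Rightarrow> real^'n^'m) \<Rightarrow> real \<Rightarrow> real^'n^'m \<Rightarrow>
     (nat \<Rightarrow> 's) \<Rightarrow> (nat \<Rightarrow> real^'n^'m) \<Rightarrow> bool"
  where "OptMuon_I F Orth \<theta> X1 s X \<longleftrightarrow>
    X 0 = X1 \<and> X 1 = X1 \<and>
    (\<forall>t\<ge>1. X (t + 1) =
       X t - (\<theta> * gamma F s X t * norm (momentum F s X t)) *\<^sub>R Orth (momentum F s X t))"

lemma OptMuon_I_quantities_cong:
  assumes "\<And>i. i \<le> t \<Longrightarrow> X i = Y i"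
  shows "rho F s X t = rho F s Y t" "alpha F s X t = alpha F s Y t"
    "momentum F s X t = momentum F s Y t" "gamma F s X t = gamma F s Y t"
proof -
  have rho: "rho F s X k = rho F s Y k" if "k \<le> t" for k
    using that assms by (simp add: rho_def stoch_grad_def cong: image_cong_simp)
  have alpha: "alpha F s X k = alpha F s Y k" if "k \<le> t" for k
    using that by (simp add: alpha_def rho)
  have momentum: "momentum F s X k = momentum F s Y k" if "k \<le> t" for k
    using that by (induction k) (simp_all add: alpha assms stoch_grad_def)
  show "rho F s X t = rho F s Y t" "alpha F s X t = alpha F s Y t"
    "momentum F s X t = momentum F s Y t" "gamma F s X t = gamma F s Y t"
    by (simp_all add: rho alpha momentum gamma_def)
qed

lemma OptMuon_I_exists: "\<exists>X. OptMuon_I F Orth \<theta> X1 s X"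
proof -
  define step where "step X t =
      X t - (\<theta> * gamma F s X t * norm (momentum F s X t)) *\<^sub>R Orth (momentum F s X t)" for X t
  define H where "H = rec_nat (\<lambda>_. X1)
      (\<lambda>t X. if t = 0 then X else X(Suc t := step X t))"
  have H0: "H 0 = (\<lambda>_. X1)"
    and HS: "H (Suc t) = (if t = 0 then H t else (H t)(Suc t := step (H t) t))" for t
    by (simp_all add: H_def)
  have H_eq: "H (i + d) i = H i i" for i d
    by (induction d) (auto simp: HS)
  define X where "X t = H t t" for t
  have X_eq: "H t i = X i" if "i \<le> t" for i t
    using H_eq[of i "t - i"] that by (simp add: X_def)
  have "X (Suc t) = step X t" if "t \<ge> 1" for t
  proof -
    have "X (Suc t) = step (H t) t"
      using that by (simp add: X_def HS)
    also have "\<dots> = step X t"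
      using OptMuon_I_quantities_cong[of t "H t" X F s] by (simp add: step_def X_eq)
    finally show ?thesis .
  qed
  moreover have "X 0 = X1" "X 1 = X1"
    by (simp_all add: X_def HS H0)
  ultimately have "OptMuon_I F Orth \<theta> X1 s X"
    by (simp add: OptMuon_I_def step_def)
  then show ?thesis
    by (rule exI[of _ X])
qed


section \<open>Constants of the convergence rate\<close>

text \<open>
  Arguments: the number \<open>n\<close> of columns, the Lipschitz constant \<open>L\<close>, the learning rate \<open>\<theta>\<close>, the
  gradient bound \<open>G\<close> and the initial gap \<open>F1\<close>.
\<close>

definition lam :: "real \<Rightarrow> real"
  where "lam G = 1 + G\<^sup>2"

definition varpi :: "real \<Rightarrow> real"
  where "varpi G = lam G powr (2/3)"

definition delta :: "nat \<Rightarrow> real \<Rightarrow> real \<Rightarrow> real"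
  where "delta n L \<theta> = real n * L\<^sup>2 * \<theta>\<^sup>2"

definition kappa :: "nat \<Rightarrow> real \<Rightarrow> real \<Rightarrow> real \<Rightarrow> real"
  where "kappa n L \<theta> G =
    2 * max 12 (96 * delta n L \<theta> * varpi G powr (3/2) *
                ln (exp 1 + 36 * delta n L \<theta> * varpi G powr (3/2) * lam G))"

definition c_0 :: "real \<Rightarrow> real"
  where "c_0 \<theta> = \<theta> / 2"

definition c_1 :: "nat \<Rightarrow> real \<Rightarrow> real"
  where "c_1 n \<theta> = real n * \<theta> / 2"

definition c_2 :: "nat \<Rightarrow> real \<Rightarrow> real \<Rightarrow> real"
  where "c_2 n L \<theta> = L * real n * \<theta>\<^sup>2 / 2"

definition C_b :: "nat \<Rightarrow> real \<Rightarrow> real \<Rightarrow> real \<Rightarrow> real"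
  where "C_b n L \<theta> G =
    (64 * (1 + G\<^sup>2)\<^sup>2 + 64 * real n * L\<^sup>2 * \<theta>\<^sup>2) *
    ln (exp 1 + kappa n L \<theta> G + kappa n L \<theta> G * G\<^sup>2)"

definition C_c :: "nat \<Rightarrow> real \<Rightarrow> real \<Rightarrow> real \<Rightarrow> real"
  where "C_c n L \<theta> G = 12 * (G\<^sup>2 + C_b n L \<theta> G)"

definition C_d :: "nat \<Rightarrow> real \<Rightarrow> real \<Rightarrow> real \<Rightarrow> real"
  where "C_d n L \<theta> G = 2 * ln (exp 1 + kappa n L \<theta> G * (1 + G\<^sup>2))"

definition C_I :: "real \<Rightarrow> real"
  where "C_I G = 90 * (1 + G\<^sup>2)\<^sup>2 * ln (exp 1 + G\<^sup>2)"

definition C_J :: "nat \<Rightarrow> real \<Rightarrow> real \<Rightarrow> real \<Rightarrow> real"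
  where "C_J n L \<theta> G =
    64 * real n * L\<^sup>2 * \<theta>\<^sup>2 * ln (exp 1 + kappa n L \<theta> G * (1 + G\<^sup>2))"

definition C_R :: "nat \<Rightarrow> real \<Rightarrow> real \<Rightarrow> real \<Rightarrow> real"
  where "C_R n L \<theta> G = 8 * sqrt (varpi G) * ln (exp 1 + kappa n L \<theta> G * (1 + G\<^sup>2))"

definition C_w_tilde :: "nat \<Rightarrow> real \<Rightarrow> real \<Rightarrow> real \<Rightarrow> real"
  where "C_w_tilde n L \<theta> G =
    64 * G\<^sup>2 * varpi G * C_c n L \<theta> G +
    64 * delta n L \<theta> * C_R n L \<theta> G * (G\<^sup>2 + C_I G + C_J n L \<theta> G)"

definition C_K :: "nat \<Rightarrow> real \<Rightarrow> real \<Rightarrow> real \<Rightarrow> real"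
  where "C_K n L \<theta> G = 4 * ((C_w_tilde n L \<theta> G)\<^sup>2 + C_w_tilde n L \<theta> G)"

definition C_u :: "nat \<Rightarrow> real \<Rightarrow> real \<Rightarrow> real \<Rightarrow> real"
  where "C_u n L \<theta> G = 288 * (G^4 + (C_I G)\<^sup>2 + (C_J n L \<theta> G)\<^sup>2 + C_K n L \<theta> G)"

definition C_w :: "nat \<Rightarrow> real \<Rightarrow> real \<Rightarrow> real \<Rightarrow> real \<Rightarrow> real"
  where "C_w n L \<theta> G F1 =
    1 / c_0 \<theta> * (F1 + c_1 n \<theta> * C_c n L \<theta> G + c_2 n L \<theta> * C_d n L \<theta> G)"

definition C_x :: "nat \<Rightarrow> real \<Rightarrow> real \<Rightarrow> real \<Rightarrow> real \<Rightarrow> real"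
  where "C_x n L \<theta> G F1 =
    3 / (c_0 \<theta>)\<^sup>2 *
    (F1\<^sup>2 + (c_1 n \<theta>)\<^sup>2 * C_u n L \<theta> G + (c_2 n L \<theta>)\<^sup>2 * (C_d n L \<theta> G)\<^sup>2)"

definition C_v :: "nat \<Rightarrow> real \<Rightarrow> real \<Rightarrow> real \<Rightarrow> real \<Rightarrow> real"
  where "C_v n L \<theta> G F1 = 4 * (varpi G)\<^sup>2 * (C_w n L \<theta> G F1 + C_x n L \<theta> G F1)"

definition C_z :: "nat \<Rightarrow> real \<Rightarrow> real \<Rightarrow> real \<Rightarrow> real \<Rightarrow> real"
  where "C_z n L \<theta> G F1 =
    sqrt (2 * C_v n L \<theta> G F1) + sqrt (2 * C_c n L \<theta> G) * varpi G powr (1/4)"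

definition C_A1 :: "nat \<Rightarrow> real \<Rightarrow> real \<Rightarrow> real \<Rightarrow> real \<Rightarrow> real"
  where "C_A1 n L \<theta> G F1 = 4 * (C_z n L \<theta> G F1)\<^sup>2"

definition C_A2 :: "nat \<Rightarrow> real \<Rightarrow> real \<Rightarrow> real \<Rightarrow> real \<Rightarrow> real"
  where "C_A2 n L \<theta> G F1 = 2 * C_z n L \<theta> G F1"

end

theory Submission
  imports Defs
begin

text \<open>
  Write \<open>q\<^sub>t = \<alpha>\<^sub>t powr (-1/2)\<close> and \<open>E\<^sub>t = M\<^sub>t - \<nabla>f(X\<^sub>t)\<close>.  Since \<open>q\<^sub>t\<^sub>+\<^sub>1\<^sup>3 \<le> q\<^sub>t\<^sup>3 + 1\<close>, the weight
  grows so slowly that the potential \<open>\<Phi>\<^sub>t = q\<^sub>t \<bar>E\<^sub>t\<bar>\<^sup>2\<close> decreases in conditional mean by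
  \<open>2/3 \<bar>E\<^sub>t\<bar>\<^sup>2 / q\<^sub>t\<^sub>+\<^sub>1\<close>, up to increments whose sum is bounded pathwise by a multiple of \<open>ln (e + T)\<close>.
  This bounds the mean of \<open>A = \<Sum> \<bar>E\<^sub>t\<bar>\<^sup>2 / q\<^sub>t\<close>, and the same argument for the square of the potential plus its
  accumulated decrease bounds the second moment of \<open>A\<close>.

  With \<open>S = 1 + \<Sum> \<bar>G\<^sub>t\<bar>\<^sup>2\<close>, the descent inequality and \<open>q\<^sub>t \<le> S powr (1/3)\<close> give
  \<open>\<Sum> \<bar>M\<^sub>t\<bar>\<^sup>2 \<le> S powr (1/3) (2B + 2B\<^sup>2)\<close> with \<open>B\<close> affine in \<open>A\<close>.  Hence, up to \<open>sqrt T\<close>, the sum of the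
  gradient norms is at most \<open>y k\<close> with \<open>y = S powr (1/6)\<close> and \<open>k\<close> having mean square of order \<open>ln\<^sup>2 (e + T)\<close>,
  while the triangle inequality in \<open>\<ell>\<^sup>2\<close> gives \<open>y\<^sup>3 \<le> sqrt (1 + N) + y k\<close> for the accumulated noise \<open>N\<close>
  of mean at most \<open>\<sigma>\<^sup>2 T\<close>.  So \<open>y\<^sup>2 \<le> (1 + N) powr (1/3) + k\<close>, and taking expectations yields the rate.
\<close>

section \<open>Orthogonalization and smoothness\<close>

text \<open>The final bound involves the product \<open>y * k\<close>, whose factors are driven by
  the same samples, so moments of the two cannot be taken separately. The product is split by
  Young's inequality with deterministic parameters fixed in advance; only the mean of
  \<open>k^2\<close> is then needed. As self-bounding makes \<open>k^2\<close> quadratic in A, this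
  is what calls for a second moment of A. Conditioning works because \<alpha> lags by one index: the
  weight at time t + 1 uses gradients up to time t and is known before the next sample is drawn. In
  the estimate for the potential, the mean square of the fresh gradient is converted back into the
  realised gradient, because the realised gradients, divided by \<open>q_t^3\<close>, sum to a
  logarithm on every path; \<sigma> thus enters only through the mean of N. The second moment has
  one further obstacle: expanding the square produces products of drift and potential, and the
  potential has no pathwise bound of logarithmic size. The pathwise bound on the total drift settles
  these products in the mean.\<close>

lemma sum_div_partial_sums_le_ln:
  fixes w :: "nat \<Rightarrow> real"
  assumes "\<And>t. 0 \<le> w t"
  shows "(\<Sum>t=1..T. w t / (1 + (\<Sum>j=1..t. w j))) \<le> ln (1 + (\<Sum>j=1..T. w j))"
proof (induction T)
  case 0
  then show ?case by simp
next
  case (Suc T)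
  define W where "W = (\<Sum>j=1..T. w j)"
  have W: "W \<ge> 0" "w (Suc T) \<ge> 0"
    using assms by (auto simp: W_def sum_nonneg)
  \<comment> \<open>\<open>ln u \<le> u - 1\<close> at the ratio of two consecutive partial sums
    bounds the new summand by a difference of logarithms, which telescopes.\<close>
  have "ln ((1 + W) / (1 + W + w (Suc T))) \<le> (1 + W) / (1 + W + w (Suc T)) - 1"
    using W by (intro ln_le_minus_one divide_pos_pos) auto
  also have "\<dots> = - (w (Suc T) / (1 + W + w (Suc T)))"
    using W by (simp add: field_simps)
  finally have "w (Suc T) / (1 + W + w (Suc T)) \<le> ln (1 + W + w (Suc T)) - ln (1 + W)"
    using W by (simp add: ln_div)
  then show ?case
    using Suc.IH by (simp add: W_def add.assoc)
qed

text \<open>Both logarithms are at least 1, and the sum of two such numbers is at most twice their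
  product. This separates the dependence on the gradient bound from the factor
  \<open>ln (exp 1 + T)\<close>.\<close>

lemma ln_mult_le_two_mult:
  fixes a b :: real
  assumes "a \<ge> 0" "b \<ge> 0"
  shows "ln ((exp 1 + a) * (exp 1 + b)) \<le> 2 * ln (exp 1 + a) * ln (exp 1 + b)"
proof -
  have pos: "exp 1 + x > 0" if "x \<ge> 0" for x :: real
    using that by (simp add: add_pos_nonneg)
  have "1 \<le> ln (exp 1 + x)" if "x \<ge> 0" for x :: real
    using that pos[OF that] by (simp add: ln_ge_iff)
  then have ab: "1 \<le> ln (exp 1 + a)" "1 \<le> ln (exp 1 + b)"
    using assms by auto
  have "ln ((exp 1 + a) * (exp 1 + b)) = ln (exp 1 + a) + ln (exp 1 + b)"
    using pos[OF assms(1)] pos[OF assms(2)] by (simp add: ln_mult)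
  moreover have "ln (exp 1 + a) * 1 \<le> ln (exp 1 + a) * ln (exp 1 + b)"
    "1 * ln (exp 1 + b) \<le> ln (exp 1 + a) * ln (exp 1 + b)"
    using ab by (intro mult_mono; simp)+
  ultimately show ?thesis by linarith
qed

text \<open>For a matrix of singular values this is the l2 norm against the l1 norm, that is,
  Frobenius norm against nuclear norm.\<close>

lemma trace_diagonal_ge_norm:
  fixes S :: "real^'n^'n"
  assumes "\<And>i j. i \<noteq> j \<Longrightarrow> S$i$j = 0" "\<And>i. 0 \<le> S$i$i"
  shows "norm S \<le> trace S"
proof -
  have "(norm S)\<^sup>2 = (\<Sum>i\<in>UNIV. \<Sum>j\<in>UNIV. (S$i$j)\<^sup>2)"
    by (simp add: norm_matrix_eq_frobenius sum_nonneg)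
  also have "\<dots> = (\<Sum>i\<in>UNIV. \<Sum>j\<in>UNIV. if j = i then (S$i$i)\<^sup>2 else 0)"
    using assms(1) by (intro sum.cong) auto
  also have "\<dots> = (\<Sum>i\<in>UNIV. S$i$i * S$i$i)"
    by (simp add: power2_eq_square)
  also have "\<dots> \<le> (\<Sum>i\<in>UNIV. S$i$i * (\<Sum>j\<in>UNIV. S$j$j))"
    using assms(2) by (intro sum_mono mult_left_mono member_le_sum) auto
  also have "\<dots> = (trace S)\<^sup>2"
    by (simp add: trace_def power2_eq_square sum_distrib_right)
  finally have "(norm S)\<^sup>2 \<le> (trace S)\<^sup>2" .
  moreover have "0 \<le> trace S"
    using assms(2) by (simp add: trace_def sum_nonneg)
  ultimately show ?thesis
    by (rule power2_le_imp_le)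
qed

lemma norm_orthonormal_columns:
  fixes U :: "real^'n^'m"
  assumes "transpose U ** U = mat 1"
  shows "(norm U)\<^sup>2 = CARD('n)"
  using assms by (simp add: power2_norm_eq_inner inner_matrix_eq_trace trace_I)

lemma norm_matrix_mult_orthogonal:
  fixes U :: "real^'n^'m" and S :: "real^'k^'n"
  assumes "transpose U ** U = mat 1"
  shows "norm (U ** S) = norm S"
proof -
  have "transpose (U ** S) ** (U ** S) = transpose S ** (transpose U ** U) ** S"
    by (simp add: matrix_transpose_mul matrix_mul_assoc)
  then show ?thesis
    using assms by (simp add: norm_eq_sqrt_inner inner_matrix_eq_trace)
qed

lemma norm_transpose:
  fixes A :: "real^'n^'m"
  shows "norm (transpose A) = norm A"
  unfolding norm_matrix_eq_frobenius transpose_def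
  by (subst sum.swap) simp

text \<open>With \<open>M = U S W^T\<close>, cyclic invariance of the trace gives
  \<open>inner (Orth M) M = trace S\<close>, the nuclear norm. Rank-deficient matrices are covered,
  since U and W have orthonormal columns in every thin SVD.\<close>

lemma
  fixes Orth :: "real^'n^'m \<Rightarrow> real^'n^'m"
  assumes "orthogonalization Orth"
  shows norm_Orth: "(norm (Orth M))\<^sup>2 = CARD('n)"
    and inner_Orth: "norm M \<le> inner (Orth M) M"
proof -
  obtain U S W where svd: "thin_svd M U S W" and O: "Orth M = U ** transpose W"
    using assms unfolding orthogonalization_def by blast
  have U: "transpose U ** U = mat 1" and W: "transpose W ** W = mat 1"
    and S: "\<And>i j. i \<noteq> j \<Longrightarrow> S$i$j = 0" "\<And>i. 0 \<le> S$i$i" and M: "M = U ** S ** transpose W"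
    using svd by (auto simp: thin_svd_def)
  \<comment> \<open>\<open>W\<close> is square, so its left inverse is also a right inverse; for the
    rectangular \<open>U\<close> only \<open>transpose U ** U = mat 1\<close> is available.\<close>
  have W': "W ** transpose W = mat 1"
    using W by (simp add: matrix_left_right_inverse)
  have "transpose (Orth M) ** Orth M = W ** (transpose U ** U) ** transpose W"
    by (simp add: O matrix_transpose_mul matrix_mul_assoc)
  then show "(norm (Orth M))\<^sup>2 = CARD('n)"
    by (intro norm_orthonormal_columns) (simp add: U W')
  have "norm M = norm (S ** transpose W)"
    by (simp add: M matrix_mul_assoc[symmetric] norm_matrix_mult_orthogonal[OF U])
  also have "\<dots> = norm (W ** transpose S)"
    by (subst norm_transpose[symmetric]) (simp add: matrix_transpose_mul)
  also have "\<dots> = norm S"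
    by (simp add: norm_matrix_mult_orthogonal[OF W] norm_transpose)
  also have "\<dots> \<le> trace S"
    using S by (rule trace_diagonal_ge_norm)
  also have "\<dots> = trace (S ** (transpose W ** W))"
    by (simp add: W)
  also have "\<dots> = trace (W ** (S ** transpose W))"
    by (subst trace_mul_sym) (simp add: matrix_mul_assoc)
  also have "\<dots> = trace (W ** (transpose U ** U) ** S ** transpose W)"
    by (simp add: U matrix_mul_assoc)
  also have "\<dots> = inner (Orth M) M"
    unfolding inner_matrix_eq_trace O
    by (subst M) (simp add: matrix_transpose_mul matrix_mul_assoc)
  finally show "norm M \<le> inner (Orth M) M" .
qed

text \<open>\<open>\<phi>\<close> is \<open>f\<close> on the segment minus its quadratic upper
  model. The Lipschitz gradient makes its derivative nonpositive on [0, 1], so monotonicity replaces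
  integration along the segment.\<close>

lemma smooth_descent:
  fixes f :: "'a::euclidean_space \<Rightarrow> real"
  assumes diff: "\<And>x. f differentiable at x"
    and lip: "\<And>x y. norm (grad f x - grad f y) \<le> L * norm (x - y)"
  shows "f (x + d) \<le> f x + inner (grad f x) d + L / 2 * (norm d)\<^sup>2"
proof -
  define \<phi> where "\<phi> s = f (x + s *\<^sub>R d) - s * inner (grad f x) d - L / 2 * s\<^sup>2 * (norm d)\<^sup>2" for s :: real
  define \<phi>' where "\<phi>' s = inner d (grad f (x + s *\<^sub>R d)) - inner (grad f x) d - L * s * (norm d)\<^sup>2" for s
  have D1: "((\<lambda>s. f (x + s *\<^sub>R d)) has_real_derivative inner d (grad f (x + s *\<^sub>R d))) (at s)" for s
  proof -
    have g: "((\<lambda>s. x + s *\<^sub>R d) has_derivative (\<lambda>h. h *\<^sub>R d)) (at s)"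
      by (auto intro!: derivative_eq_intros)
    have "(f has_derivative (\<lambda>h. inner h (grad f (x + s *\<^sub>R d)))) (at (x + s *\<^sub>R d))"
      using GDERIV_grad[OF diff] by (simp add: gderiv_def)
    from has_derivative_compose[OF g this]
    moreover have "(\<lambda>h. inner (h *\<^sub>R d) (grad f (x + s *\<^sub>R d))) = (*) (inner d (grad f (x + s *\<^sub>R d)))"
      by (auto simp: mult.commute)
    ultimately show ?thesis
      by (simp only: has_field_derivative_def)
  qed
  have D: "(\<phi> has_real_derivative \<phi>' s) (at s)" for s
    unfolding \<phi>_def \<phi>'_def
    by (auto intro!: derivative_eq_intros D1)
  have "\<exists>y. (\<phi> has_real_derivative y) (at s) \<and> y \<le> 0" if s: "0 \<le> s" "s \<le> 1" for s
  proof -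
    have "inner d (grad f (x + s *\<^sub>R d)) - inner (grad f x) d = inner d (grad f (x + s *\<^sub>R d) - grad f x)"
      by (simp add: inner_diff_right inner_commute)
    also have "\<dots> \<le> norm d * norm (grad f (x + s *\<^sub>R d) - grad f x)"
      by (rule norm_cauchy_schwarz)
    also have "\<dots> \<le> norm d * (L * norm (s *\<^sub>R d))"
      using lip[of "x + s *\<^sub>R d" x] by (intro mult_left_mono) auto
    also have "\<dots> = L * s * (norm d)\<^sup>2"
      using s by (simp add: power2_eq_square)
    finally have "\<phi>' s \<le> 0" by (simp add: \<phi>'_def)
    then show "\<exists>y. (\<phi> has_real_derivative y) (at s) \<and> y \<le> 0"
      using D by blast
  qed
  then have "\<phi> 1 \<le> \<phi> 0"
    by (rule DERIV_nonpos_imp_nonincreasing[OF zero_le_one])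
  then show ?thesis by (simp add: \<phi>_def)
qed

section \<open>Step sizes along a path\<close>

definition grad_sq_sum ::
    "('s \<Rightarrow> real^'n^'m \<Rightarrow> real) \<Rightarrow> (nat \<Rightarrow> 's) \<Rightarrow> (nat \<Rightarrow> real^'n^'m) \<Rightarrow> nat \<Rightarrow> real"
  where "grad_sq_sum F s X t = (\<Sum>i=1..t. (norm (stoch_grad F s X i))\<^sup>2)"

text \<open>The value 0 at \<open>t = 0\<close> makes the formula for \<open>rho\<close> in terms of
  sum and maximum valid there too, as \<open>(1 + 0) / (1 + 0) = 1\<close>.\<close>

definition grad_sq_max ::
    "('s \<Rightarrow> real^'n^'m \<Rightarrow> real) \<Rightarrow> (nat \<Rightarrow> 's) \<Rightarrow> (nat \<Rightarrow> real^'n^'m) \<Rightarrow> nat \<Rightarrow> real"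
  where "grad_sq_max F s X t =
    (if t = 0 then 0 else MAX i\<in>{1..t}. (norm (stoch_grad F s X i))\<^sup>2)"

definition weight ::
    "('s \<Rightarrow> real^'n^'m \<Rightarrow> real) \<Rightarrow> (nat \<Rightarrow> 's) \<Rightarrow> (nat \<Rightarrow> real^'n^'m) \<Rightarrow> nat \<Rightarrow> real"
  where "weight F s X t = alpha F s X t powr (-1/2)"

context
  fixes F :: "'s \<Rightarrow> real^'n^'m \<Rightarrow> real" and s :: "nat \<Rightarrow> 's" and X :: "nat \<Rightarrow> real^'n^'m"
begin

lemma grad_sq_max_nonneg: "0 \<le> grad_sq_max F s X t"
  unfolding grad_sq_max_def by (auto simp: Max_ge_iff intro!: bexI[of _ 1])

lemma grad_sq_sum_nonneg: "0 \<le> grad_sq_sum F s X t"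
  unfolding grad_sq_sum_def by (simp add: sum_nonneg)

lemma grad_sq_le_max: "1 \<le> i \<Longrightarrow> i \<le> t \<Longrightarrow> (norm (stoch_grad F s X i))\<^sup>2 \<le> grad_sq_max F s X t"
  unfolding grad_sq_max_def by auto

lemma grad_sq_max_le:
  assumes "\<And>i. 1 \<le> i \<Longrightarrow> (norm (stoch_grad F s X i))\<^sup>2 \<le> B" "0 \<le> B"
  shows "grad_sq_max F s X t \<le> B"
  using assms by (auto simp: grad_sq_max_def)

lemma grad_sq_max_mono: "grad_sq_max F s X t \<le> grad_sq_max F s X (Suc t)"
proof (cases "t = 0")
  case True
  then show ?thesis
    using grad_sq_max_nonneg by (simp add: grad_sq_max_def)
next
  case False
  then have "(MAX i\<in>{1..t}. (norm (stoch_grad F s X i))\<^sup>2) \<le> (MAX i\<in>{1..Suc t}. (norm (stoch_grad F s X i))\<^sup>2)"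
    by (intro Max_mono image_mono) auto
  then show ?thesis
    using False by (simp add: grad_sq_max_def)
qed

lemma grad_sq_max_le_sum: "grad_sq_max F s X t \<le> grad_sq_sum F s X t"
  unfolding grad_sq_max_def grad_sq_sum_def
  by (auto intro!: member_le_sum)

lemma grad_sq_sum_le: "grad_sq_sum F s X t \<le> real t * grad_sq_max F s X t"
proof -
  have "grad_sq_sum F s X t \<le> (\<Sum>i=1..t. grad_sq_max F s X t)"
    unfolding grad_sq_sum_def by (intro sum_mono grad_sq_le_max) auto
  then show ?thesis by simp
qed

lemma grad_sq_sum_Suc: "grad_sq_sum F s X (Suc t) = grad_sq_sum F s X t + (norm (stoch_grad F s X (Suc t)))\<^sup>2"
  by (simp add: grad_sq_sum_def)

lemma rho_eq: "rho F s X t = ((1 + grad_sq_sum F s X t) / (1 + grad_sq_max F s X t)) powr (-2/3)"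
proof -
  have "0 < 1 + grad_sq_sum F s X t" "0 < 1 + grad_sq_max F s X t"
    using grad_sq_sum_nonneg[of t] grad_sq_max_nonneg[of t] by auto
  moreover have "rho F s X t = ((1 + grad_sq_max F s X t) / (1 + grad_sq_sum F s X t)) powr (2/3)"
    by (simp add: rho_def grad_sq_sum_def grad_sq_max_def)
  ultimately show ?thesis
    by (simp add: powr_minus powr_divide divide_simps)
qed

text \<open>The exponents \<open>2/3\<close> of \<open>rho\<close> and \<open>-1/2\<close> of the
  weight combine to a cube root, so cubes of weights are plain ratios. Truncated subtraction covers
  \<open>t = 0\<close>, where \<open>alpha\<close> and \<open>rho\<close> are both 1.\<close>

lemma weight_eq:
  "weight F s X t = ((1 + grad_sq_sum F s X (t - 1)) / (1 + grad_sq_max F s X (t - 1))) powr (1/3)"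
proof -
  have "alpha F s X t = rho F s X (t - 1)"
    by (simp add: alpha_def rho_def)
  then show ?thesis
    by (simp add: weight_def rho_eq powr_powr)
qed

lemma weight_pow3:
  "(weight F s X t)^3 = (1 + grad_sq_sum F s X (t - 1)) / (1 + grad_sq_max F s X (t - 1))"
proof -
  have "0 < 1 + grad_sq_sum F s X (t - 1)" "0 < 1 + grad_sq_max F s X (t - 1)"
    using grad_sq_sum_nonneg[of "t - 1"] grad_sq_max_nonneg[of "t - 1"] by auto
  then show ?thesis
    by (simp add: weight_eq powr_power)
qed

lemma weight_ge_1: "1 \<le> weight F s X t"
proof -
  have "1 \<le> (1 + grad_sq_sum F s X (t - 1)) / (1 + grad_sq_max F s X (t - 1))"
    using grad_sq_max_le_sum[of "t - 1"] grad_sq_max_nonneg[of "t - 1"]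
    by (subst le_divide_eq_1_pos) auto
  then show ?thesis
    unfolding weight_eq by (rule ge_one_powr_ge_zero) simp
qed

lemma weight_pos: "0 < weight F s X t"
  using weight_ge_1[of t] by linarith

lemma alpha_eq: "alpha F s X t = 1 / (weight F s X t)\<^sup>2"
proof -
  have "0 < alpha F s X t"
    using weight_pos[of t] unfolding weight_def powr_gt_zero
    by (metis alpha_def less_le powr_ge_zero rho_eq zero_le_one)
  then show ?thesis
    by (simp add: weight_def powr_power powr_minus_divide power_divide)
qed

lemma weight_0: "weight F s X 0 = 1" and weight_1: "weight F s X (Suc 0) = 1"
  by (simp_all add: weight_eq grad_sq_sum_def grad_sq_max_def)

lemma alpha_pos: "0 < alpha F s X t" and alpha_le_1: "alpha F s X t \<le> 1"
  using weight_ge_1[of t] by (auto simp: alpha_eq)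

lemma alpha_1: "alpha F s X (Suc 0) = 1"
  by (simp add: alpha_eq weight_1)

lemma sqrt_alpha: "sqrt (alpha F s X t) = 1 / weight F s X t"
  using weight_pos[of t] by (simp add: alpha_eq real_sqrt_divide)

text \<open>The sum of \<open>t - 1\<close> squared norms is at most \<open>t - 1\<close> times
  their maximum.\<close>

lemma weight_pow3_le: "1 \<le> t \<Longrightarrow> (weight F s X t)^3 \<le> real t"
proof -
  assume t: "1 \<le> t"
  define S m where "S = grad_sq_sum F s X (t - 1)" and "m = grad_sq_max F s X (t - 1)"
  have "S \<le> real (t - 1) * m" "0 \<le> m"
    using grad_sq_sum_le[of "t - 1"] grad_sq_max_nonneg by (auto simp: S_def m_def)
  then have "S \<le> real t * m - m" using t by (simp add: algebra_simps of_nat_diff)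
  then have "1 + S \<le> real t * (1 + m)"
    using t \<open>0 \<le> m\<close> by (simp add: algebra_simps)
  then show ?thesis
    using \<open>0 \<le> m\<close> unfolding weight_pow3 S_def[symmetric] m_def[symmetric]
    by (simp add: divide_le_eq)
qed

lemma weight_le_powr: "1 \<le> t \<Longrightarrow> weight F s X t \<le> real t powr (1/3)"
proof -
  assume "1 \<le> t"
  then have "(weight F s X t)^3 \<le> (real t powr (1/3))^3"
    using weight_pow3_le[of t] by (simp add: powr_power)
  then show ?thesis
    using weight_pos[of t] by (simp add: power_mono_iff)
qed

lemma weight_pow3_Suc: "(weight F s X (Suc t))^3 \<le> (weight F s X t)^3 + 1"
proof (cases t)
  case 0
  then show ?thesis by (simp add: weight_0 weight_1)
next
  case (Suc u)
  define S m S' m' where "S = grad_sq_sum F s X u" and "m = grad_sq_max F s X u"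
    and "S' = grad_sq_sum F s X t" and "m' = grad_sq_max F s X t"
  have *: "0 \<le> m" "m \<le> m'" "S' - S \<le> m'" "0 \<le> S"
    using grad_sq_max_nonneg grad_sq_max_mono[of u] grad_sq_sum_Suc[of u] grad_sq_le_max[of t t]
      grad_sq_sum_nonneg by (auto simp: S_def m_def S'_def m'_def Suc)
  \<comment> \<open>The new squared norm is at most the new maximum and so adds at most 1 to the
    ratio; the old sum is only divided by a larger number.\<close>
  have "(1 + S') / (1 + m') = (1 + S) / (1 + m') + (S' - S) / (1 + m')"
    by (simp add: add_divide_distrib diff_divide_distrib)
  also have "\<dots> \<le> (1 + S) / (1 + m) + 1"
    using * by (intro add_mono divide_left_mono) (auto simp: divide_le_eq)
  finally show ?thesis
    by (simp add: weight_pow3 Suc S_def m_def S'_def m'_def)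
qed

text \<open>\<open>q^3 - p^3\<close> has the factor \<open>q^2 + q p + p^2\<close>, which is at
  least \<open>3 q\<close> for \<open>p, q \<ge> 1\<close>. The correction carries index
  \<open>Suc t\<close> so that it can be compared with the loss \<open>1 / q\<close> in
  \<open>weight_contraction\<close>, of which it takes back a third.\<close>

lemma weight_Suc: "weight F s X (Suc t) \<le> weight F s X t + 1 / (3 * weight F s X (Suc t))"
proof -
  define p q where "p = weight F s X t" and "q = weight F s X (Suc t)"
  have pq: "1 \<le> p" "1 \<le> q" "q^3 \<le> p^3 + 1"
    using weight_ge_1 weight_pow3_Suc by (auto simp: p_def q_def)
  show ?thesis
  proof (cases "q \<le> p")
    case True
    then show ?thesis
      using pq by (simp add: p_def[symmetric] q_def[symmetric] add_increasing2)
  next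
    case False
    have "3 * q \<le> q\<^sup>2 + q + 1"
      using zero_le_power2[of "q - 1"] by (simp add: power2_eq_square algebra_simps)
    also have "\<dots> \<le> q\<^sup>2 + q * p + p\<^sup>2"
      using pq by (intro add_mono) (auto simp: mult_le_cancel_left1)
    finally have "(q - p) * (3 * q) \<le> (q - p) * (q\<^sup>2 + q * p + p\<^sup>2)"
      using False by (intro mult_left_mono) auto
    also have "\<dots> = q^3 - p^3"
      by (simp add: algebra_simps power2_eq_square power3_eq_cube)
    finally show ?thesis
      using pq by (simp add: p_def[symmetric] q_def[symmetric] field_simps)
  qed
qed

lemma weight_Suc_le: "weight F s X (Suc t) \<le> 4/3 * weight F s X t"
proof -
  have "1 / (3 * weight F s X (Suc t)) \<le> 1 / 3 * weight F s X t"
    using weight_ge_1[of t] weight_ge_1[of "Suc t"] 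
      mult_mono[OF weight_ge_1[of t] weight_ge_1[of "Suc t"]] by (simp add: field_simps)
  then show ?thesis using weight_Suc[of t] by linarith
qed

lemma gamma_nonneg: "0 \<le> gamma F s X t"
  using alpha_pos[of t] by (simp add: gamma_def)

lemma gamma_le_inverse_weight: "gamma F s X t \<le> 1 / weight F s X t"
  unfolding gamma_def sqrt_alpha by simp

lemma gamma_eq:
  "gamma F s X t = min (1 / weight F s X t)
     ((1 + (\<Sum>j=1..t. weight F s X j * (norm (momentum F s X j))\<^sup>2)) powr (-1/2))"
  unfolding gamma_def sqrt_alpha weight_def ..

lemma gamma_sq_le:
  "(gamma F s X t)\<^sup>2 \<le> 1 / (1 + (\<Sum>j=1..t. weight F s X j * (norm (momentum F s X j))\<^sup>2))"
proof -
  define W where "W = (\<Sum>j=1..t. weight F s X j * (norm (momentum F s X j))\<^sup>2)"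
  have W: "0 \<le> W" unfolding W_def using weight_pos by (intro sum_nonneg) (simp add: less_imp_le)
  have "(gamma F s X t)\<^sup>2 \<le> ((1 + W) powr (-1/2))\<^sup>2"
    using gamma_nonneg[of t] by (intro power_mono) (auto simp: gamma_eq W_def)
  also have "\<dots> = 1 / (1 + W)"
    using W by (simp add: powr_power powr_minus_divide power_divide)
  finally show ?thesis by (simp add: W_def)
qed

text \<open>The sum inside \<open>gamma\<close> consists exactly of the terms
  \<open>q |M|^2\<close>, so each summand here is at most such a term divided by 1 plus its own
  partial sum.\<close>

lemma sum_weight_gamma_sq_le_ln:
  "(\<Sum>t=1..T. weight F s X t * (gamma F s X t)\<^sup>2 * (norm (momentum F s X t))\<^sup>2)
    \<le> ln (1 + (\<Sum>j=1..T. weight F s X j * (norm (momentum F s X j))\<^sup>2))"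
proof -
  define w where "w t = weight F s X t * (norm (momentum F s X t))\<^sup>2" for t
  have w: "0 \<le> w t" for t
    using weight_pos[of t] by (simp add: w_def)
  have "(\<Sum>t=1..T. weight F s X t * (gamma F s X t)\<^sup>2 * (norm (momentum F s X t))\<^sup>2)
      \<le> (\<Sum>t=1..T. w t / (1 + (\<Sum>j=1..t. w j)))"
  proof (rule sum_mono)
    fix t
    have "w t * (gamma F s X t)\<^sup>2 \<le> w t * (1 / (1 + (\<Sum>j=1..t. w j)))"
      using gamma_sq_le[of t, folded w_def] w by (rule mult_left_mono)
    then show "weight F s X t * (gamma F s X t)\<^sup>2 * (norm (momentum F s X t))\<^sup>2
        \<le> w t / (1 + (\<Sum>j=1..t. w j))"
      by (simp add: w_def mult_ac)
  qed
  also have "\<dots> \<le> ln (1 + (\<Sum>j=1..T. w j))"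
    by (rule sum_div_partial_sums_le_ln) (rule w)
  finally show ?thesis by (simp add: w_def)
qed

end

section \<open>Pathwise bounds\<close>

text \<open>The share of the weighted second moment of the noise that stems from the move from
  \<open>X (t - 1)\<close> to \<open>X t\<close>: one sample's gradients at the two points differ by
  at most L times the displacement. Its value at t depends only on samples before t.\<close>

definition drift ::
    "('s \<Rightarrow> real^'n^'m \<Rightarrow> real) \<Rightarrow> (nat \<Rightarrow> 's) \<Rightarrow> (nat \<Rightarrow> real^'n^'m) \<Rightarrow> real \<Rightarrow> nat \<Rightarrow> real"
  where "drift F s X L t =
    2 * L\<^sup>2 * weight F s X t * (1 - alpha F s X t)\<^sup>2 * (norm (X t - X (t - 1)))\<^sup>2"

section \<open>Numerical lower bounds for \<open>kappa\<close> and for logarithms\<close>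

lemma delta_nonneg: "0 \<le> delta n L \<theta>"
  by (simp add: delta_def)

lemma lam_ge_1: "1 \<le> lam G"
  by (simp add: lam_def)

text \<open>Twice a maximum is at least the sum of its two entries, and the second entry is at least
  \<open>96 * delta\<close> because \<open>varpi powr (3/2) = lam \<ge> 1\<close> and the logarithm
  is at least 1.\<close>

lemma kappa_ge: "12 + 96 * delta n L \<theta> \<le> kappa n L \<theta> G"
proof -
  have v: "varpi G powr (3/2) = lam G"
    using lam_ge_1[of G] by (simp add: varpi_def powr_powr)
  have "0 \<le> 36 * delta n L \<theta> * lam G * lam G"
    using lam_ge_1[of G] delta_nonneg[of n L \<theta>] by (intro mult_nonneg_nonneg) auto
  then have "1 \<le> ln (exp 1 + 36 * delta n L \<theta> * lam G * lam G)"
    by (subst ln_ge_iff) (auto simp: add_pos_nonneg)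
  then have "96 * delta n L \<theta> * 1 * 1 \<le> 96 * delta n L \<theta> * lam G * ln (exp 1 + 36 * delta n L \<theta> * lam G * lam G)"
    using lam_ge_1[of G] delta_nonneg[of n L \<theta>] by (intro mult_mono) auto
  then show ?thesis
    unfolding kappa_def v by linarith
qed

text \<open>The first bound absorbs the prefactor \<open>1 + 2 G^2 + 2 delta\<close> of the
  accumulated momenta into the logarithm of \<open>C_d\<close>; the second makes that logarithm at
  least 3.\<close>

lemma kappa_lam_ge_delta: "2 * lam G + 2 * delta n L \<theta> \<le> kappa n L \<theta> G * lam G"
  and kappa_lam_ge: "24 \<le> kappa n L \<theta> G * lam G"
proof -
  have "(12 + 96 * delta n L \<theta>) * lam G \<le> kappa n L \<theta> G * lam G"
    using kappa_ge[of n L \<theta> G] lam_ge_1[of G] by (intro mult_right_mono) auto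
  moreover have "96 * delta n L \<theta> * 1 \<le> 96 * delta n L \<theta> * lam G"
    using lam_ge_1[of G] delta_nonneg[of n L \<theta>] by (intro mult_left_mono) auto
  ultimately show "2 * lam G + 2 * delta n L \<theta> \<le> kappa n L \<theta> G * lam G"
    using lam_ge_1[of G] delta_nonneg[of n L \<theta>] by (simp add: algebra_simps)
  have "24 * 1 \<le> kappa n L \<theta> G * lam G"
    using lam_ge_1[of G] by (intro mult_mono) (auto simp: kappa_def)
  then show "24 \<le> kappa n L \<theta> G * lam G" by simp
qed

lemma ln_exp_plus_ge_5_4:
  assumes "1 \<le> x"
  shows "5/4 \<le> ln (exp 1 + x :: real)"
proof -
  have e: "exp 1 \<le> (272/100 :: real)"
    using e_approx_32 by (simp add: abs_if split: if_splits)
  have "(exp (1/4))^4 = exp (1::real)"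
    by (simp flip: exp_of_nat_mult)
  \<comment> \<open>A rational number just above the fourth root of e:
    \<open>(9/7)^4 > 2.73\<close>, while \<open>2.72 * 2/7 < 1\<close> leaves room for x.\<close>
  also have "\<dots> \<le> (9/7)^4"
    using e by (simp add: power4_eq_xxxx)
  finally have "exp (1/4) \<le> (9/7 :: real)"
    by (simp add: power_mono_iff)
  have "exp (5/4 :: real) = exp 1 * exp (1/4)"
    by (simp flip: exp_add)
  also have "\<dots> \<le> exp 1 * (9/7)"
    using \<open>exp (1/4) \<le> 9/7\<close> by (intro mult_left_mono) auto
  also have "\<dots> \<le> exp 1 + x"
    using e assms by simp
  finally show ?thesis
    using assms by (subst ln_ge_iff) (auto simp: add_pos_nonneg)
qed

lemma ln_exp_plus_ge_3: "3 \<le> ln (exp 1 + x :: real)" if "24 \<le> x"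
proof -
  have e: "exp 1 \<le> (272/100 :: real)"
    using e_approx_32 by (simp add: abs_if split: if_splits)
  have "exp (3::real) = exp 1 ^ 3"
    by (simp flip: exp_of_nat_mult)
  also have "\<dots> \<le> (272/100)^3"
    using e by (intro power_mono) auto
  also have "\<dots> \<le> exp 1 + x"
    using that by (simp add: power3_eq_cube add_increasing)
  finally show ?thesis
    using that by (subst ln_ge_iff) (auto simp: add_pos_nonneg)
qed

text \<open>A deterministic trajectory. The two gradient conditions concern only the samples drawn
  at times \<open>t \<ge> 1\<close>, so that almost every outcome of the random process is an
  instance.\<close>

locale optmuon_path =
  fixes F :: "'s \<Rightarrow> real^'n^'m \<Rightarrow> real" and s :: "nat \<Rightarrow> 's" and X :: "nat \<Rightarrow> real^'n^'m"
    and Orth :: "real^'n^'m \<Rightarrow> real^'n^'m" and \<theta> L G :: real and X1 :: "real^'n^'m"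
  assumes run: "OptMuon_I F Orth \<theta> X1 s X"
    and Orth: "orthogonalization Orth"
    and \<theta>_pos: "0 < \<theta>" and L_pos: "0 < L" and G_nonneg: "0 \<le> G"
    and lipschitz: "\<And>t Y Z. 1 \<le> t \<Longrightarrow> norm (grad (F (s t)) Y - grad (F (s t)) Z) \<le> L * norm (Y - Z)"
    and bounded: "\<And>t Y. 1 \<le> t \<Longrightarrow> norm (grad (F (s t)) Y) \<le> G"
begin

abbreviation "\<alpha> \<equiv> alpha F s X"
abbreviation "\<gamma> \<equiv> gamma F s X"
abbreviation "M \<equiv> momentum F s X"
abbreviation "q \<equiv> weight F s X"

lemma X_init: "X 0 = X1" "X (Suc 0) = X1"
  using run by (auto simp: OptMuon_I_def)

lemma X_Suc: "1 \<le> t \<Longrightarrow> X (Suc t) = X t - (\<theta> * \<gamma> t * norm (M t)) *\<^sub>R Orth (M t)"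
  using run by (auto simp: OptMuon_I_def)

lemma norm_step: "(norm (X (Suc t) - X t))\<^sup>2 = CARD('n) * \<theta>\<^sup>2 * ((\<gamma> t)\<^sup>2 * (norm (M t))\<^sup>2)"
proof (cases "t = 0")
  case True
  \<comment> \<open>Both sides vanish, as \<open>X 0 = X 1\<close> and the initial momentum is 0;
    index 0 therefore fits into sums over steps.\<close>
  then show ?thesis by (simp add: X_init)
next
  case False
  then show ?thesis
    using norm_Orth[OF Orth, of "M t"] by (simp add: X_Suc power_mult_distrib mult_ac)
qed

lemma L_norm_step: "L\<^sup>2 * (norm (X (Suc t) - X t))\<^sup>2 = delta CARD('n) L \<theta> * ((\<gamma> t)\<^sup>2 * (norm (M t))\<^sup>2)"
  by (simp add: norm_step delta_def)

text \<open>Keeps every displacement bounded however large the momentum: up to a weight of at least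
  1, \<open>|M|^2\<close> is itself one of the terms summed inside \<open>\<gamma>\<close>.\<close>

lemma gamma_momentum_le_1: "(\<gamma> t)\<^sup>2 * (norm (M t))\<^sup>2 \<le> 1"
proof (cases "t = 0")
  case False
  define W where "W = (\<Sum>j=1..t. q j * (norm (M j))\<^sup>2)"
  have nonneg: "0 \<le> q j * (norm (M j))\<^sup>2" for j
    using weight_pos[of F s X j] by simp
  have "1 * (norm (M t))\<^sup>2 \<le> q t * (norm (M t))\<^sup>2"
    using weight_ge_1 by (rule mult_right_mono) simp
  also have "\<dots> \<le> W"
    unfolding W_def using False nonneg by (intro member_le_sum) auto
  finally have M: "(norm (M t))\<^sup>2 \<le> 1 + W" by simp
  have W: "0 \<le> W"
    unfolding W_def using nonneg by (rule sum_nonneg)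
  have "(\<gamma> t)\<^sup>2 * (norm (M t))\<^sup>2 \<le> 1 / (1 + W) * (1 + W)"
    using gamma_sq_le[of F s X t, folded W_def] M W by (intro mult_mono) auto
  then show ?thesis using W by simp
qed simp

text \<open>The update is a convex combination of the fresh gradient and the old momentum shifted by
  a gradient difference of bounded size. Linear growth is good enough inside a logarithm and for
  integrability.\<close>

lemma norm_momentum_le: "norm (M t) \<le> G + real t * sqrt (delta CARD('n) L \<theta>)"
proof (induction t)
  case 0
  then show ?case using G_nonneg by simp
next
  case (Suc t)
  define D where "D = grad (F (s (Suc t))) (X (Suc t)) - grad (F (s (Suc t))) (X t)"
  have \<alpha>: "0 \<le> 1 - \<alpha> (Suc t)" "0 \<le> \<alpha> (Suc t)"
    using alpha_pos[of F s X "Suc t"] alpha_le_1[of F s X "Suc t"] by auto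
  have "(norm D)\<^sup>2 \<le> (L * norm (X (Suc t) - X t))\<^sup>2"
    unfolding D_def by (intro power_mono lipschitz) auto
  also have "\<dots> \<le> delta CARD('n) L \<theta> * 1"
    unfolding power_mult_distrib L_norm_step using gamma_momentum_le_1 delta_nonneg
    by (rule mult_left_mono)
  finally have D: "norm D \<le> sqrt (delta CARD('n) L \<theta>)"
    by (intro real_le_rsqrt) simp
  have "M (Suc t) = (1 - \<alpha> (Suc t)) *\<^sub>R (M t + D) + \<alpha> (Suc t) *\<^sub>R stoch_grad F s X (Suc t)"
    by (simp add: D_def stoch_grad_def algebra_simps)
  also have "norm \<dots> \<le> (1 - \<alpha> (Suc t)) * norm (M t + D) + \<alpha> (Suc t) * norm (stoch_grad F s X (Suc t))"
    using \<alpha> by (intro norm_triangle_le) simp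
  also have "\<dots> \<le> (1 - \<alpha> (Suc t)) * (G + real (Suc t) * sqrt (delta CARD('n) L \<theta>)) + \<alpha> (Suc t) * (G + real (Suc t) * sqrt (delta CARD('n) L \<theta>))"
  proof (intro add_mono mult_left_mono \<alpha>)
    show "norm (M t + D) \<le> G + real (Suc t) * sqrt (delta CARD('n) L \<theta>)"
      using Suc D norm_triangle_ineq[of "M t" D] by (simp add: algebra_simps)
    have "norm (stoch_grad F s X (Suc t)) \<le> G"
      by (simp add: stoch_grad_def bounded)
    moreover have "0 \<le> real (Suc t) * sqrt (delta CARD('n) L \<theta>)"
      using delta_nonneg by simp
    ultimately show "norm (stoch_grad F s X (Suc t)) \<le> G + real (Suc t) * sqrt (delta CARD('n) L \<theta>)"
      by linarith
  qed
  finally show ?case by (simp add: algebra_simps)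
qed

text \<open>The exponent adds up 1/3 from the weight, 2 from the squared linear growth and 1 from
  the number of summands.\<close>

lemma sum_weight_momentum_le:
  assumes "1 \<le> T"
  shows "1 + (\<Sum>j=1..T. q j * (norm (M j))\<^sup>2) \<le> real T powr (10/3) * (1 + 2 * G\<^sup>2 + 2 * delta CARD('n) L \<theta>)"
proof -
  have "q j * (norm (M j))\<^sup>2 \<le> real T powr (1/3) * ((real T)\<^sup>2 * (2 * G\<^sup>2 + 2 * delta CARD('n) L \<theta>))" if j: "1 \<le> j" "j \<le> T" for j
  proof (rule mult_mono)
    show "q j \<le> real T powr (1/3)"
      using weight_le_powr[of j F s X] j by (intro order_trans[OF _ powr_mono2[of "1/3" "real j" "real T"]]) auto
    have "G + real j * sqrt (delta CARD('n) L \<theta>) \<le> real T * (G + sqrt (delta CARD('n) L \<theta>))"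
      using j G_nonneg delta_nonneg[of "CARD('n)" L \<theta>] mult_right_mono[of 1 "real T" G] 
        mult_right_mono[of "real j" "real T" "sqrt (delta CARD('n) L \<theta>)"] by (simp add: algebra_simps)
    then have "(norm (M j))\<^sup>2 \<le> (real T * (G + sqrt (delta CARD('n) L \<theta>)))\<^sup>2"
      using norm_momentum_le[of j] by (intro power_mono) auto
    also have "\<dots> \<le> (real T)\<^sup>2 * (2 * G\<^sup>2 + 2 * delta CARD('n) L \<theta>)"
      unfolding power_mult_distrib
      using delta_nonneg[of "CARD('n)" L \<theta>] zero_le_power2[of "G - sqrt (delta CARD('n) L \<theta>)"]
      by (intro mult_left_mono) (auto simp: power2_diff power2_sum)
    finally show "(norm (M j))\<^sup>2 \<le> (real T)\<^sup>2 * (2 * G\<^sup>2 + 2 * delta CARD('n) L \<theta>)" .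
  qed auto
  then have "(\<Sum>j=1..T. q j * (norm (M j))\<^sup>2) \<le> (\<Sum>j=1..T. real T powr (1/3) * ((real T)\<^sup>2 * (2 * G\<^sup>2 + 2 * delta CARD('n) L \<theta>)))"
    by (intro sum_mono) auto
  also have "\<dots> = real T ^ 3 * real T powr (1/3) * (2 * G\<^sup>2 + 2 * delta CARD('n) L \<theta>)"
    by (simp add: power2_eq_square power3_eq_cube)
  also have "real T ^ 3 * real T powr (1/3) = real T powr (10/3)"
    using assms by (simp flip: powr_add powr_numeral)
  finally have "(\<Sum>j=1..T. q j * (norm (M j))\<^sup>2) \<le> real T powr (10/3) * (2 * G\<^sup>2 + 2 * delta CARD('n) L \<theta>)" .
  moreover have "1 \<le> real T powr (10/3)"
    using assms by (intro ge_one_powr_ge_zero) auto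
  ultimately show ?thesis
    by (simp add: algebra_simps)
qed

lemma ln_sum_weight_momentum_le:
  assumes "1 \<le> T"
  shows "ln (1 + (\<Sum>j=1..T. q j * (norm (M j))\<^sup>2)) \<le> C_d CARD('n) L \<theta> G * ln (exp 1 + real T)"
proof -
  define \<Lambda> where "\<Lambda> = ln (exp 1 + real T)"
  define l where "l = ln (exp 1 + kappa CARD('n) L \<theta> G * (1 + G\<^sup>2))"
  define W where "W = (\<Sum>j=1..T. q j * (norm (M j))\<^sup>2)"
  have W: "0 \<le> W"
    unfolding W_def by (intro sum_nonneg mult_nonneg_nonneg) (auto intro: less_imp_le weight_pos)
  have \<Lambda>: "5/4 \<le> \<Lambda>"
    using assms ln_exp_plus_ge_5_4[of "real T"] by (simp add: \<Lambda>_def)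
  have "ln (real T) \<le> \<Lambda>"
    unfolding \<Lambda>_def using assms by (subst ln_le_cancel_iff) (auto intro: add_pos_nonneg)
  have l: "3 \<le> l"
    using kappa_lam_ge[of "CARD('n)" L \<theta> G] unfolding l_def lam_def by (rule ln_exp_plus_ge_3)
  have "1 + 2 * G\<^sup>2 + 2 * delta CARD('n) L \<theta> \<le> exp 1 + kappa CARD('n) L \<theta> G * (1 + G\<^sup>2)"
    using add_increasing[OF exp_ge_zero[of "1::real"] kappa_lam_ge_delta[of G "CARD('n)" L \<theta>]]
    unfolding lam_def by (simp add: algebra_simps)
  moreover have "0 < 1 + 2 * G\<^sup>2 + 2 * delta CARD('n) L \<theta>"
    using delta_nonneg[of "CARD('n)" L \<theta>] by (simp add: add_pos_nonneg)
  ultimately have l2: "ln (1 + 2 * G\<^sup>2 + 2 * delta CARD('n) L \<theta>) \<le> l"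
    by (simp add: l_def)
  have "ln (1 + W) \<le> ln (real T powr (10/3) * (1 + 2 * G\<^sup>2 + 2 * delta CARD('n) L \<theta>))"
    using sum_weight_momentum_le[OF assms] W by (subst ln_le_cancel_iff) (auto simp: W_def)
  also have "\<dots> = 10/3 * ln (real T) + ln (1 + 2 * G\<^sup>2 + 2 * delta CARD('n) L \<theta>)"
    using assms \<open>0 < 1 + 2 * G\<^sup>2 + 2 * delta CARD('n) L \<theta>\<close> by (simp add: ln_mult ln_powr)
  also have "\<dots> \<le> 10/3 * \<Lambda> + l"
    using \<open>ln (real T) \<le> \<Lambda>\<close> l2 by (intro add_mono mult_left_mono) auto
  also have "\<dots> \<le> 2 * l * \<Lambda>"
  proof -
    \<comment> \<open>The two numerical bounds meet here: \<open>\<Lambda> \<ge> 5/4\<close> gives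
      \<open>2 * \<Lambda> - 1 \<ge> 6/5 * \<Lambda>\<close>, and with \<open>l \<ge> 3\<close> the
      product is at least \<open>18/5 * \<Lambda>\<close>, which covers
      \<open>10/3 * \<Lambda>\<close>.\<close>
    have "(3 :: real) * (6/5 * \<Lambda>) \<le> l * (2 * \<Lambda> - 1)"
      using l \<Lambda> by (intro mult_mono) auto
    then show ?thesis using \<Lambda> by (simp add: algebra_simps)
  qed
  finally show ?thesis
    by (simp add: W_def \<Lambda>_def C_d_def l_def)
qed

lemma sum_gamma_momentum_le:
  assumes "1 \<le> T"
  shows "(\<Sum>t=1..T. q t * (\<gamma> t)\<^sup>2 * (norm (M t))\<^sup>2) \<le> C_d CARD('n) L \<theta> G * ln (exp 1 + real T)"
  using sum_weight_gamma_sq_le_ln ln_sum_weight_momentum_le[OF assms] by (rule order_trans)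

lemma drift_nonneg: "0 \<le> drift F s X L t"
  using weight_pos[of F s X t] by (simp add: drift_def)

lemma sum_drift_le:
  assumes "1 \<le> T"
  shows "(\<Sum>t=1..T. drift F s X L t) \<le> C_J CARD('n) L \<theta> G * ln (exp 1 + real T) / 12"
proof -
  have d: "drift F s X L (Suc t) \<le> 8/3 * delta CARD('n) L \<theta> * (q t * (\<gamma> t)\<^sup>2 * (norm (M t))\<^sup>2)" for t
  proof -
    have "(1 - \<alpha> (Suc t))\<^sup>2 \<le> 1\<^sup>2"
      using alpha_pos[of F s X "Suc t"] alpha_le_1[of F s X "Suc t"] by (intro power_mono) auto
    then have "q (Suc t) * (1 - \<alpha> (Suc t))\<^sup>2 \<le> (4/3 * q t) * 1"
      using weight_Suc_le[of F s X t] weight_pos[of F s X t] by (intro mult_mono) auto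
    then have "2 * (q (Suc t) * (1 - \<alpha> (Suc t))\<^sup>2) * (L\<^sup>2 * (norm (X (Suc t) - X t))\<^sup>2)
        \<le> 2 * ((4/3 * q t) * 1) * (L\<^sup>2 * (norm (X (Suc t) - X t))\<^sup>2)"
      by (intro mult_right_mono mult_left_mono) auto
    moreover have "drift F s X L (Suc t) =
        2 * (q (Suc t) * (1 - \<alpha> (Suc t))\<^sup>2) * (L\<^sup>2 * (norm (X (Suc t) - X t))\<^sup>2)"
      by (simp add: drift_def mult_ac)
    ultimately have "drift F s X L (Suc t) \<le> 2 * ((4/3 * q t) * 1) * (L\<^sup>2 * (norm (X (Suc t) - X t))\<^sup>2)"
      by simp
    then show ?thesis
      unfolding L_norm_step by (simp add: mult_ac)
  qed
  have "(\<Sum>t=1..T. drift F s X L t) = (\<Sum>t<T. drift F s X L (Suc t))"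
    by (rule sum.reindex_bij_witness[of _ Suc "\<lambda>t. t - 1"]) auto
  also have "\<dots> \<le> (\<Sum>t<T. 8/3 * delta CARD('n) L \<theta> * (q t * (\<gamma> t)\<^sup>2 * (norm (M t))\<^sup>2))"
    by (intro sum_mono d)
  \<comment> \<open>The initial momentum is 0, so the term at index 0 drops out.\<close>
  also have "\<dots> = (\<Sum>t\<in>{1..<T}. 8/3 * delta CARD('n) L \<theta> * (q t * (\<gamma> t)\<^sup>2 * (norm (M t))\<^sup>2))"
    by (rule sum.mono_neutral_right) (auto simp: Suc_le_eq)
  also have "\<dots> \<le> (\<Sum>t=1..T. 8/3 * delta CARD('n) L \<theta> * (q t * (\<gamma> t)\<^sup>2 * (norm (M t))\<^sup>2))"
    by (intro sum_mono2 mult_nonneg_nonneg) (auto intro: less_imp_le weight_pos delta_nonneg)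
  also have "\<dots> = 8/3 * delta CARD('n) L \<theta> * (\<Sum>t=1..T. q t * (\<gamma> t)\<^sup>2 * (norm (M t))\<^sup>2)"
    by (simp add: sum_distrib_left)
  also have "\<dots> \<le> 8/3 * delta CARD('n) L \<theta> * (C_d CARD('n) L \<theta> G * ln (exp 1 + real T))"
    using sum_gamma_momentum_le[OF assms] delta_nonneg by (intro mult_left_mono) auto
  also have "\<dots> = C_J CARD('n) L \<theta> G * ln (exp 1 + real T) / 12"
    by (simp add: C_d_def C_J_def delta_def)
  finally show ?thesis .
qed

text \<open>\<open>q^3\<close> is built from gradients before time t, one index short of the partial
  sum that the logarithmic bound needs. Boundedness repairs this: one factor \<open>lam\<close> pays
  for the last gradient in the sum, another for the maximum. The constant 2/45 is
  \<open>4/90\<close>, the 90 being that of \<open>C_I\<close>.\<close>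

lemma sum_grad_div_weight_le:
  "(\<Sum>t=1..T. 2 * (norm (stoch_grad F s X t))\<^sup>2 / (q t)^3) \<le> 2/45 * (C_I G * ln (exp 1 + real T))"
proof -
  define g where "g t = (norm (stoch_grad F s X t))\<^sup>2" for t
  let ?S = "grad_sq_sum F s X" and ?m = "grad_sq_max F s X"
  have g: "g t \<le> G\<^sup>2" "0 \<le> g t" if "1 \<le> t" for t
    using that by (auto simp: g_def stoch_grad_def intro!: power_mono bounded)
  have m: "0 \<le> ?m t" "?m t \<le> G\<^sup>2" "0 \<le> ?S t" for t
    using g by (auto intro!: grad_sq_max_le simp: g_def grad_sq_max_nonneg grad_sq_sum_nonneg)
  have term_le: "g t / (q t)^3 \<le> (lam G)\<^sup>2 * (g t / (1 + ?S t))" if t: "1 \<le> t" for t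
  proof -
    have S: "?S t = ?S (t - 1) + g t"
      using t grad_sq_sum_Suc[of F s X "t - 1"] by (simp add: g_def)
    have "1 + ?S t \<le> lam G * (1 + ?S (t - 1))"
    proof -
      have "0 \<le> G\<^sup>2 * ?S (t - 1)"
        using m(3) by (rule mult_nonneg_nonneg[OF zero_le_power2])
      then show ?thesis
        using g[OF t] unfolding lam_def S by (simp add: algebra_simps)
    qed
    moreover have "1 + ?m (t - 1) \<le> lam G"
      using m by (simp add: lam_def)
    ultimately have "(1 + ?m (t - 1)) * (1 + ?S t) \<le> lam G * (lam G * (1 + ?S (t - 1)))"
      using m lam_ge_1[of G] by (intro mult_mono) auto
    then have "(1 + ?m (t - 1)) / (1 + ?S (t - 1)) \<le> (lam G)\<^sup>2 / (1 + ?S t)"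
      using m(3)[of t] m(3)[of "t - 1"] by (simp add: divide_simps power2_eq_square mult_ac)
    from mult_left_mono[OF this g(2)[OF t]] show ?thesis
      using m[of "t - 1"] by (simp add: weight_pow3 mult_ac)
  qed
  have "(\<Sum>t=1..T. g t / (q t)^3) \<le> (\<Sum>t=1..T. (lam G)\<^sup>2 * (g t / (1 + ?S t)))"
    by (intro sum_mono term_le) auto
  also have "\<dots> = (lam G)\<^sup>2 * (\<Sum>t=1..T. g t / (1 + (\<Sum>i=1..t. g i)))"
    by (simp add: sum_distrib_left grad_sq_sum_def g_def)
  also have "\<dots> \<le> (lam G)\<^sup>2 * ln (1 + (\<Sum>i=1..T. g i))"
    by (intro mult_left_mono sum_div_partial_sums_le_ln) (auto simp: g_def)
  also have "\<dots> \<le> (lam G)\<^sup>2 * (2 * ln (exp 1 + G\<^sup>2) * ln (exp 1 + real T))"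
  proof (rule mult_left_mono)
    have "(\<Sum>i=1..T. g i) \<le> (\<Sum>i=1..T. G\<^sup>2)"
      using g by (intro sum_mono) auto
    then have "1 + (\<Sum>i=1..T. g i) \<le> 1 * 1 + G\<^sup>2 * real T"
      by (simp add: mult.commute)
    also have "\<dots> \<le> exp 1 * exp 1 + G\<^sup>2 * real T"
      by (intro add_right_mono mult_mono) auto
    also have "\<dots> \<le> (exp 1 + G\<^sup>2) * (exp 1 + real T)"
      by (simp add: algebra_simps)
    finally have "ln (1 + (\<Sum>i=1..T. g i)) \<le> ln ((exp 1 + G\<^sup>2) * (exp 1 + real T))"
      by (subst ln_le_cancel_iff) (auto simp: g_def add_pos_nonneg sum_nonneg)
    also have "\<dots> \<le> 2 * ln (exp 1 + G\<^sup>2) * ln (exp 1 + real T)"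
      by (rule ln_mult_le_two_mult) auto
    finally show "ln (1 + (\<Sum>i=1..T. g i)) \<le> 2 * ln (exp 1 + G\<^sup>2) * ln (exp 1 + real T)" .
  qed simp
  finally have "2 * (\<Sum>t=1..T. g t / (q t)^3) \<le> 2/45 * (C_I G * ln (exp 1 + real T))"
    by (simp add: C_I_def lam_def mult_ac)
  then show ?thesis by (simp add: g_def sum_distrib_left)
qed

end


text \<open>With the convention \<open>err 0 = 0\<close> the error recursion holds from the first step on, since \<open>\<alpha>\<^sub>1 = 1\<close>.\<close>

definition err ::
    "(real^'n^'m \<Rightarrow> real) \<Rightarrow> ('s \<Rightarrow> real^'n^'m \<Rightarrow> real) \<Rightarrow> (nat \<Rightarrow> 's) \<Rightarrow> (nat \<Rightarrow> real^'n^'m) \<Rightarrow>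
     nat \<Rightarrow> real^'n^'m"
  where "err f F s X t = (if t = 0 then 0 else momentum F s X t - grad f (X t))"

text \<open>If the claim failed then \<open>p < y\<close>, whence
  \<open>p^3 + y k \<le> y (p^2 + k) < y^3\<close>.\<close>

lemma cubic_bound:
  fixes y p k :: real
  assumes "0 \<le> y" "0 \<le> p" "0 \<le> k" "y^3 \<le> p^3 + y * k"
  shows "y\<^sup>2 \<le> p\<^sup>2 + k"
proof (rule ccontr)
  assume "\<not> ?thesis"
  then have *: "p\<^sup>2 + k < y\<^sup>2" by simp
  then have "p\<^sup>2 < y\<^sup>2" using assms by linarith
  then have "p < y" using assms by (simp add: power_less_imp_less_base)
  have "p^3 + y * k \<le> y * (p\<^sup>2 + k)"
    using assms \<open>p < y\<close> mult_right_mono[of p y "p\<^sup>2"]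
    by (simp add: power3_eq_cube power2_eq_square algebra_simps)
  also have "\<dots> < y * y\<^sup>2"
    using * \<open>p < y\<close> assms by (intro mult_strict_left_mono) auto
  finally show False
    using assms by (simp add: power3_eq_cube power2_eq_square)
qed

lemma sum_norm_le_sqrt:
  fixes u :: "nat \<Rightarrow> real"
  shows "(\<Sum>t=1..T. u t) \<le> sqrt (real T) * sqrt (\<Sum>t=1..T. (u t)\<^sup>2)"
proof -
  have "(\<Sum>t=1..T. 1 * u t) \<le> L2_set (\<lambda>_. 1) {1..T} * L2_set u {1..T}"
    by (rule order_trans[OF sum_mono L2_set_mult_ineq]) (simp add: abs_le_iff)
  then show ?thesis by (simp add: L2_set_def)
qed

text \<open>
  The momentum step size is limited either by \<open>1 / Y\<close> with \<open>Y = y\<^sup>2\<close> (the reciprocal of the largest weight) or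
  by the accumulated momenta; the two cases give the two summands.
\<close>

lemma self_bounding_sum:
  fixes V B y :: real
  assumes "0 \<le> V" "0 \<le> B" "1 \<le> y"
    and "V * min (1 / y\<^sup>2) ((y\<^sup>2 * (1 + V)) powr (-1/2)) \<le> B"
  shows "V \<le> y\<^sup>2 * (2 * B + 2 * B\<^sup>2)"
proof -
  have y2: "0 < y\<^sup>2" using assms by simp
  consider (1) "V * (1 / y\<^sup>2) \<le> B" | (2) "V * ((y\<^sup>2 * (1 + V)) powr (-1/2)) \<le> B"
    using assms(4) by (auto simp: min_def split: if_splits)
  then show ?thesis
  proof cases
    case 1
    then have "V \<le> y\<^sup>2 * B"
      using y2 by (simp add: divide_le_eq mult.commute)
    also have "\<dots> \<le> y\<^sup>2 * (2 * B + 2 * B\<^sup>2)"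
      using assms(2) by (intro mult_left_mono) auto
    finally show ?thesis .
  next
    case 2
    have pos: "0 < y * sqrt (1 + V)"
      using assms by (intro mult_pos_pos) auto
    have "(y\<^sup>2 * (1 + V)) powr (-1/2) = 1 / (y * sqrt (1 + V))"
      using assms by (simp add: powr_minus_divide powr_half_sqrt real_sqrt_mult)
    with 2 have V: "V \<le> B * (y * sqrt (1 + V))"
      using pos by (simp add: divide_le_eq)
    have "V\<^sup>2 \<le> (B * (y * sqrt (1 + V)))\<^sup>2"
      using V assms by (intro power_mono) auto
    also have "\<dots> = B\<^sup>2 * (y\<^sup>2 * (1 + V))"
      using assms by (simp add: power_mult_distrib)
    finally have V2: "V\<^sup>2 \<le> B\<^sup>2 * y\<^sup>2 * (1 + V)" by simp
    have nn: "0 \<le> B\<^sup>2 * y\<^sup>2" "0 \<le> y\<^sup>2 * B" using assms by auto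
    show ?thesis
    \<comment> \<open>\<open>V^2 \<le> B^2 y^2 (1 + V)\<close> can be divided by V once
      \<open>1 + V \<le> 2 V\<close>; for smaller V the root is at most 2 and
      \<open>y \<le> y^2\<close> suffices.\<close>
    proof (cases "1 \<le> V")
      case True
      have "B\<^sup>2 * y\<^sup>2 * (1 + V) \<le> B\<^sup>2 * y\<^sup>2 * (2 * V)"
        using True nn by (intro mult_left_mono) auto
      with V2 have "V * V \<le> (2 * (B\<^sup>2 * y\<^sup>2)) * V"
        by (simp add: power2_eq_square mult_ac)
      then have "V \<le> 2 * (B\<^sup>2 * y\<^sup>2)"
        using True by (simp add: mult_le_cancel_right)
      then show ?thesis using nn by (simp add: algebra_simps)
    next
      case False
      have "sqrt (1 + V) \<le> sqrt (2\<^sup>2)"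
        using False by (intro real_sqrt_le_mono) simp
      then have "B * (y * sqrt (1 + V)) \<le> B * (y * 2)"
        using assms by (intro mult_left_mono) auto
      also have "\<dots> \<le> B * (y * y * 2)"
        using assms by (intro mult_left_mono mult_right_mono) (auto simp: mult_le_cancel_left1)
      finally show ?thesis using V nn by (simp add: power2_eq_square algebra_simps)
    qed
  qed
qed

section \<open>Descent inequality and gradient sums along a path\<close>

locale optmuon_objective_path = optmuon_path F s X Orth \<theta> L G X1
  for F :: "'s \<Rightarrow> real^'n^'m \<Rightarrow> real" and s X Orth \<theta> L G X1 +
  fixes f :: "real^'n^'m \<Rightarrow> real" and fstar :: real
  assumes differentiable: "\<And>Y. f differentiable at Y"
    and smooth: "\<And>Y Z. norm (grad f Y - grad f Z) \<le> L * norm (Y - Z)"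
    and lower: "\<And>Y. fstar \<le> f Y"
begin

abbreviation "E \<equiv> err f F s X"

text \<open>The quantity B of the self-bounding argument: the summed descent inequality divided by
  \<open>c_0\<close>, with the quadratic step terms already replaced by their logarithmic
  bound.\<close>

definition momentum_bound :: "nat \<Rightarrow> real"
  where "momentum_bound T = 1 / c_0 \<theta> * ((f X1 - fstar) + c_1 CARD('n) \<theta> * (\<Sum>t=1..T. (norm (E t))\<^sup>2 / q t)
    + c_2 CARD('n) L \<theta> * (C_d CARD('n) L \<theta> G * ln (exp 1 + real T)))"

text \<open>With the gradient written as \<open>M - E\<close>, the first part gives a decrease of
  \<open>\<theta> \<gamma> |M|^2\<close>; Young's inequality spends half of it on the error part.
  This is the origin of \<open>c_0 = \<theta> / 2\<close>; the factor n in \<open>c_1\<close> and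
  \<open>c_2\<close> is the squared norm of \<open>Orth\<close>.\<close>

lemma descent:
  assumes t: "1 \<le> t"
  shows "f (X (Suc t)) \<le> f (X t) - c_0 \<theta> * (\<gamma> t * (norm (M t))\<^sup>2)
    + c_1 CARD('n) \<theta> * (\<gamma> t * (norm (E t))\<^sup>2) + c_2 CARD('n) L \<theta> * ((\<gamma> t)\<^sup>2 * (norm (M t))\<^sup>2)"
proof -
  define O' where "O' = Orth (M t)"
  define n where "n = real CARD('n)"
  define a where "a = \<theta> * \<gamma> t * norm (M t)"
  have a: "0 \<le> a"
    using \<theta>_pos gamma_nonneg[of F s X t] by (simp add: a_def)
  have O': "(norm O')\<^sup>2 = n" "norm (M t) \<le> inner O' (M t)"
    using norm_Orth[OF Orth] inner_Orth[OF Orth] by (auto simp: O'_def n_def)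
  have gradf: "grad f (X t) = M t - E t"
    using t by (simp add: err_def)
  have "X (Suc t) = X t + - a *\<^sub>R O'"
    using t by (simp add: X_Suc a_def O'_def)
  then have "f (X (Suc t)) \<le> f (X t) + inner (grad f (X t)) (- a *\<^sub>R O') + L / 2 * (norm (- a *\<^sub>R O'))\<^sup>2"
    using smooth_descent[OF differentiable smooth, of "X t" "- a *\<^sub>R O'"] by simp
  also have "inner (grad f (X t)) (- a *\<^sub>R O') = - a * inner O' (M t) + a * inner (E t) O'"
    by (simp add: gradf inner_diff_left inner_commute algebra_simps)
  also have "(norm (- a *\<^sub>R O'))\<^sup>2 = a\<^sup>2 * n"
    by (simp add: power_mult_distrib O')
  also have "f (X t) + (- a * inner O' (M t) + a * inner (E t) O') + L / 2 * (a\<^sup>2 * n)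
      \<le> f (X t) + (- a * norm (M t) + \<theta> * \<gamma> t * (1/2 * (norm (M t))\<^sup>2 + n / 2 * (norm (E t))\<^sup>2)) + L / 2 * (a\<^sup>2 * n)"
  proof (intro add_mono order_refl)
    show "- a * inner O' (M t) \<le> - a * norm (M t)"
      using O'(2) a by (simp add: mult_left_mono)
    have "inner (E t) O' \<le> norm (E t) * norm O'"
      by (rule norm_cauchy_schwarz)
    then have "norm (M t) * inner (E t) O' \<le> norm (M t) * (norm (E t) * norm O')"
      by (intro mult_left_mono) auto
    also have "\<dots> \<le> 1/2 * (norm (M t))\<^sup>2 + n / 2 * (norm (E t))\<^sup>2"
      using zero_le_power2[of "norm (M t) - norm (E t) * norm O'"]
      by (simp add: power2_diff power_mult_distrib O'(1) mult_ac)
    finally have "(\<theta> * \<gamma> t) * (norm (M t) * inner (E t) O') \<le> (\<theta> * \<gamma> t) * (1/2 * (norm (M t))\<^sup>2 + n / 2 * (norm (E t))\<^sup>2)"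
      using \<theta>_pos gamma_nonneg[of F s X t] by (intro mult_left_mono) auto
    then show "a * inner (E t) O' \<le> \<theta> * \<gamma> t * (1/2 * (norm (M t))\<^sup>2 + n / 2 * (norm (E t))\<^sup>2)"
      by (simp add: a_def mult_ac)
  qed
  also have "\<dots> = f (X t) - c_0 \<theta> * (\<gamma> t * (norm (M t))\<^sup>2)
    + c_1 CARD('n) \<theta> * (\<gamma> t * (norm (E t))\<^sup>2) + c_2 CARD('n) L \<theta> * ((\<gamma> t)\<^sup>2 * (norm (M t))\<^sup>2)"
    by (simp add: a_def c_0_def c_1_def c_2_def n_def power2_eq_square algebra_simps)
  finally show ?thesis .
qed

lemma sum_gamma_momentum_le_bound:
  assumes T: "1 \<le> T"
  shows "(\<Sum>t=1..T. \<gamma> t * (norm (M t))\<^sup>2) \<le> momentum_bound T"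
proof -
  have "f (X (Suc T)) + c_0 \<theta> * (\<Sum>t=1..T. \<gamma> t * (norm (M t))\<^sup>2) \<le> f X1
    + c_1 CARD('n) \<theta> * (\<Sum>t=1..T. \<gamma> t * (norm (E t))\<^sup>2) + c_2 CARD('n) L \<theta> * (\<Sum>t=1..T. (\<gamma> t)\<^sup>2 * (norm (M t))\<^sup>2)" for T
  proof (induction T)
    case 0
    then show ?case by (simp add: X_init)
  next
    case (Suc T)
    then show ?case
      using descent[of "Suc T"] by (simp add: distrib_left)
  qed
  from this[of T] have "c_0 \<theta> * (\<Sum>t=1..T. \<gamma> t * (norm (M t))\<^sup>2) \<le> (f X1 - fstar)
    + c_1 CARD('n) \<theta> * (\<Sum>t=1..T. \<gamma> t * (norm (E t))\<^sup>2) + c_2 CARD('n) L \<theta> * (\<Sum>t=1..T. (\<gamma> t)\<^sup>2 * (norm (M t))\<^sup>2)"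
    using lower[of "X (Suc T)"] by linarith
  also have "\<dots> \<le> (f X1 - fstar) + c_1 CARD('n) \<theta> * (\<Sum>t=1..T. (norm (E t))\<^sup>2 / q t)
    + c_2 CARD('n) L \<theta> * (C_d CARD('n) L \<theta> G * ln (exp 1 + real T))"
  proof (intro add_mono order_refl mult_left_mono)
    \<comment> \<open>The first entry of the minimum in \<open>\<gamma>\<close> is used here: it
      gives the errors the weights \<open>1 / q\<close> with which the potential decreases.\<close>
    show "(\<Sum>t=1..T. \<gamma> t * (norm (E t))\<^sup>2) \<le> (\<Sum>t=1..T. (norm (E t))\<^sup>2 / q t)"
    proof (rule sum_mono)
      fix t
      show "\<gamma> t * (norm (E t))\<^sup>2 \<le> (norm (E t))\<^sup>2 / q t"
        using mult_right_mono[OF gamma_le_inverse_weight[of F s X t], of "(norm (E t))\<^sup>2"] by simp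
    qed
    have "(\<Sum>t=1..T. (\<gamma> t)\<^sup>2 * (norm (M t))\<^sup>2) \<le> (\<Sum>t=1..T. q t * (\<gamma> t)\<^sup>2 * (norm (M t))\<^sup>2)"
    proof (rule sum_mono)
      fix t
      show "(\<gamma> t)\<^sup>2 * (norm (M t))\<^sup>2 \<le> q t * (\<gamma> t)\<^sup>2 * (norm (M t))\<^sup>2"
        using mult_right_mono[OF weight_ge_1[of F s X t], of "(\<gamma> t)\<^sup>2 * (norm (M t))\<^sup>2"] by (simp add: mult_ac)
    qed
    also have "\<dots> \<le> C_d CARD('n) L \<theta> G * ln (exp 1 + real T)"
      by (rule sum_gamma_momentum_le[OF T])
    finally show "(\<Sum>t=1..T. (\<gamma> t)\<^sup>2 * (norm (M t))\<^sup>2) \<le> C_d CARD('n) L \<theta> G * ln (exp 1 + real T)" .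
  qed (use \<theta>_pos L_pos in \<open>auto simp: c_1_def c_2_def\<close>)
  finally show ?thesis
    using \<theta>_pos by (simp add: momentum_bound_def c_0_def field_simps)
qed

lemma momentum_bound_nonneg: "1 \<le> T \<Longrightarrow> 0 \<le> momentum_bound T"
  by (rule order_trans[OF _ sum_gamma_momentum_le_bound]) (auto intro!: sum_nonneg simp: gamma_nonneg)

text \<open>\<open>y^2\<close> is the cube root of 1 plus the full gradient sum and dominates every
  weight up to T, because \<open>q^3\<close> is at most 1 plus an earlier partial sum. Replacing all
  weights by \<open>y^2\<close> gives one lower bound for all step sizes, as
  \<open>self_bounding_sum\<close> requires.\<close>

lemma sum_momentum_le:
  assumes T: "1 \<le> T" and y: "y = (1 + grad_sq_sum F s X T) powr (1/6)"
  shows "(\<Sum>t=1..T. (norm (M t))\<^sup>2) \<le> y\<^sup>2 * (2 * momentum_bound T + 2 * (momentum_bound T)\<^sup>2)"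
    and "\<And>t. 1 \<le> t \<Longrightarrow> t \<le> T \<Longrightarrow> q t \<le> y\<^sup>2"
    and "1 \<le> y"
proof -
  define V where "V = (\<Sum>t=1..T. (norm (M t))\<^sup>2)"
  have V: "0 \<le> V" by (simp add: V_def sum_nonneg)
  show y1: "1 \<le> y"
    unfolding y using grad_sq_sum_nonneg by (intro ge_one_powr_ge_zero) auto
  have y6: "y^6 = 1 + grad_sq_sum F s X T"
    using grad_sq_sum_nonneg[of F s X T] by (simp add: y powr_power)
  show q: "q t \<le> y\<^sup>2" if t: "1 \<le> t" "t \<le> T" for t
  proof -
    have "(q t)^3 \<le> (1 + grad_sq_sum F s X (t - 1)) / 1"
      unfolding weight_pow3 using grad_sq_sum_nonneg[of F s X "t - 1"] grad_sq_max_nonneg[of F s X "t - 1"]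
      by (intro divide_left_mono) auto
    also have "\<dots> \<le> y^6"
      unfolding y6 grad_sq_sum_def using t by (auto intro!: sum_mono2)
    also have "\<dots> = (y\<^sup>2)^3" by simp
    finally show ?thesis
      using weight_pos[of F s X t] by (subst (asm) power_mono_iff) auto
  qed
  have lower: "min (1 / y\<^sup>2) ((y\<^sup>2 * (1 + V)) powr (-1/2)) \<le> \<gamma> t" if t: "1 \<le> t" "t \<le> T" for t
    unfolding gamma_eq
  proof (rule min.mono)
    show "1 / y\<^sup>2 \<le> 1 / q t"
      using q[OF t] weight_pos[of F s X t] y1 by (intro divide_left_mono) auto
    have "(\<Sum>j=1..t. q j * (norm (M j))\<^sup>2) \<le> (\<Sum>j=1..t. y\<^sup>2 * (norm (M j))\<^sup>2)"
      using q t by (intro sum_mono mult_right_mono) auto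
    also have "\<dots> \<le> (\<Sum>j=1..T. y\<^sup>2 * (norm (M j))\<^sup>2)"
      using t by (intro sum_mono2) auto
    also have "\<dots> = y\<^sup>2 * V" by (simp add: V_def sum_distrib_left)
    finally have "1 + (\<Sum>j=1..t. q j * (norm (M j))\<^sup>2) \<le> y\<^sup>2 * (1 + V)"
      using one_le_power[OF y1, of 2] by (simp add: distrib_left)
    moreover have "0 \<le> (\<Sum>j=1..t. q j * (norm (M j))\<^sup>2)"
      by (intro sum_nonneg mult_nonneg_nonneg) (auto intro: less_imp_le weight_pos)
    ultimately show "(y\<^sup>2 * (1 + V)) powr (-1/2) \<le> (1 + (\<Sum>j=1..t. q j * (norm (M j))\<^sup>2)) powr (-1/2)"
      by (intro powr_mono2') auto
  qed
  have "V * min (1 / y\<^sup>2) ((y\<^sup>2 * (1 + V)) powr (-1/2)) \<le> (\<Sum>t=1..T. \<gamma> t * (norm (M t))\<^sup>2)"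
    unfolding V_def sum_distrib_right
  proof (rule sum_mono)
    fix t assume "t \<in> {1..T}"
    then show "(norm (M t))\<^sup>2 * min (1 / y\<^sup>2) ((y\<^sup>2 * (1 + (\<Sum>t=1..T. (norm (M t))\<^sup>2))) powr (-1/2))
        \<le> \<gamma> t * (norm (M t))\<^sup>2"
      using lower[of t, unfolded V_def] by (subst mult.commute) (intro mult_right_mono, auto)
  qed
  also have "\<dots> \<le> momentum_bound T"
    by (rule sum_gamma_momentum_le_bound[OF T])
  finally show "(\<Sum>t=1..T. (norm (M t))\<^sup>2) \<le> y\<^sup>2 * (2 * momentum_bound T + 2 * (momentum_bound T)\<^sup>2)"
    unfolding V_def[symmetric] by (rule self_bounding_sum[OF V momentum_bound_nonneg[OF T] y1])
qed

text \<open>The triangle inequality in l2 over time is used twice. Gradient = momentum - error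
  bounds the gradients by \<open>y k\<close>. Sample gradient = noise + gradient then closes the
  loop, since \<open>y^3\<close> is the l2 norm of the sample gradients together with the leading
  1.\<close>

lemma sum_grad_bounds:
  fixes T :: nat
  defines "y \<equiv> (1 + grad_sq_sum F s X T) powr (1/6)"
    and "k \<equiv> sqrt (2 * momentum_bound T + 2 * (momentum_bound T)\<^sup>2) + sqrt (\<Sum>t=1..T. (norm (E t))\<^sup>2 / q t)"
    and "N \<equiv> (\<Sum>t=1..T. (norm (stoch_grad F s X t - grad f (X t)))\<^sup>2)"
  assumes T: "1 \<le> T"
  shows "(\<Sum>t=1..T. norm (grad f (X t))) \<le> sqrt (real T) * (y * k)"
    and "y\<^sup>2 \<le> (1 + N) powr (1/3) + k"
proof -
  define K where "K = 2 * momentum_bound T + 2 * (momentum_bound T)\<^sup>2"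
  define A where "A = (\<Sum>t=1..T. (norm (E t))\<^sup>2 / q t)"
  note y = sum_momentum_le[OF T, of y]
  have yy: "y = (1 + grad_sq_sum F s X T) powr (1/6)" by (simp add: y_def)
  have y1: "1 \<le> y" using y(3)[OF yy] .
  have nonneg: "0 \<le> K" "0 \<le> A" "0 \<le> N"
    using momentum_bound_nonneg[OF T] weight_pos[of F s X]
    by (auto simp: K_def A_def N_def intro!: sum_nonneg divide_nonneg_nonneg intro: less_imp_le)
  have k: "k = sqrt K + sqrt A" "0 \<le> k"
    using nonneg by (auto simp: k_def K_def A_def)
  have M: "L2_set (\<lambda>t. norm (M t)) {1..T} \<le> y * sqrt K"
    unfolding L2_set_def using y(1)[OF yy] y1 by (intro real_le_lsqrt) (auto simp: K_def power_mult_distrib nonneg[unfolded K_def])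
  have E: "L2_set (\<lambda>t. norm (E t)) {1..T} \<le> y * sqrt A"
  proof -
    have "(\<Sum>t=1..T. (norm (E t))\<^sup>2) \<le> (\<Sum>t=1..T. y\<^sup>2 * ((norm (E t))\<^sup>2 / q t))"
    proof (rule sum_mono)
      fix t assume "t \<in> {1..T}"
      then have "q t \<le> y\<^sup>2" using y(2)[OF yy] by auto
      from mult_right_mono[OF this, of "(norm (E t))\<^sup>2 / q t"]
      show "(norm (E t))\<^sup>2 \<le> y\<^sup>2 * ((norm (E t))\<^sup>2 / q t)"
        using weight_pos[of F s X t] by simp
    qed
    also have "\<dots> = y\<^sup>2 * A"
      by (simp add: A_def sum_distrib_left)
    finally show ?thesis
      unfolding L2_set_def using y1 nonneg by (intro real_le_lsqrt) (auto simp: power_mult_distrib)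
  qed
  have grad: "norm (grad f (X t)) \<le> norm (M t) + norm (E t)" if "t \<in> {1..T}" for t
  proof -
    have "grad f (X t) = M t - E t" using that by (simp add: err_def)
    then show ?thesis by (simp add: norm_triangle_ineq4)
  qed
  have "L2_set (\<lambda>t. norm (grad f (X t))) {1..T} \<le> L2_set (\<lambda>t. norm (M t) + norm (E t)) {1..T}"
    by (intro L2_set_mono grad) auto
  also have "\<dots> \<le> L2_set (\<lambda>t. norm (M t)) {1..T} + L2_set (\<lambda>t. norm (E t)) {1..T}"
    by (rule L2_set_triangle_ineq)
  also have "\<dots> \<le> y * k"
    using M E by (simp add: k distrib_left)
  finally have Q: "L2_set (\<lambda>t. norm (grad f (X t))) {1..T} \<le> y * k" .
  have "(\<Sum>t=1..T. norm (grad f (X t))) \<le> sqrt (real T) * L2_set (\<lambda>t. norm (grad f (X t))) {1..T}"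
    unfolding L2_set_def by (rule sum_norm_le_sqrt)
  also have "\<dots> \<le> sqrt (real T) * (y * k)"
    using Q by (intro mult_left_mono) auto
  finally show "(\<Sum>t=1..T. norm (grad f (X t))) \<le> sqrt (real T) * (y * k)" .
  define p where "p = (1 + N) powr (1/6)"
  have S: "0 \<le> grad_sq_sum F s X T" by (rule grad_sq_sum_nonneg)
  \<comment> \<open>Index 0 is an additional coordinate for the leading 1; it is booked under the
    noise, so that \<open>sqrt (1 + N)\<close> appears.\<close>
  define h where "h t = (if t = 0 then 1 else norm (stoch_grad F s X t - grad f (X t)))" for t
  define v where "v t = (if t = 0 then 0 else norm (grad f (X t)))" for t
  have split: "{0..T} = insert 0 {1..T}" by auto
  have "y^3 = sqrt (1 + grad_sq_sum F s X T)"
    using S by (simp add: y_def powr_power powr_half_sqrt)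
  also have "\<dots> = L2_set (\<lambda>t. if t = 0 then 1 else norm (stoch_grad F s X t)) {0..T}"
    unfolding L2_set_def split by (simp add: grad_sq_sum_def)
  also have "\<dots> \<le> L2_set (\<lambda>t. h t + v t) {0..T}"
  proof (rule L2_set_mono)
    fix t
    show "(if t = 0 then 1 else norm (stoch_grad F s X t)) \<le> h t + v t"
      using norm_triangle_ineq[of "stoch_grad F s X t - grad f (X t)" "grad f (X t)"]
      by (simp add: h_def v_def)
  qed auto
  also have "\<dots> \<le> L2_set h {0..T} + L2_set v {0..T}"
    by (rule L2_set_triangle_ineq)
  also have "L2_set h {0..T} = sqrt (1 + N)"
    unfolding L2_set_def split by (simp add: h_def N_def)
  also have "\<dots> = p^3"
    using nonneg by (simp add: p_def powr_power powr_half_sqrt)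
  also have "L2_set v {0..T} = L2_set (\<lambda>t. norm (grad f (X t))) {1..T}"
    unfolding L2_set_def split by (simp add: v_def)
  also have "p^3 + \<dots> \<le> p^3 + y * k"
    using Q by simp
  finally have "y^3 \<le> p^3 + y * k" .
  then have "y\<^sup>2 \<le> p\<^sup>2 + k"
    using y1 k by (intro cubic_bound) (auto simp: p_def)
  also have "p\<^sup>2 = (1 + N) powr (1/3)"
    using nonneg by (simp add: p_def powr_power)
  finally show "y\<^sup>2 \<le> (1 + N) powr (1/3) + k" .
qed

end

section \<open>Adaptedness and conditioning\<close>

text \<open>Measurability in x is given only for fixed y. Along simple functions approximating
  \<open>b\<close> it holds piecewise on finitely many values, and continuity in y carries it to the
  limit.\<close>

lemma caratheodory_measurable:
  fixes g :: "'x \<Rightarrow> 'a::{metric_space, second_countable_topology} \<Rightarrow> 'b::{metric_space, second_countable_topology}"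
  assumes meas: "\<And>y. (\<lambda>x. g x y) \<in> borel_measurable D"
    and cont: "\<And>x. x \<in> space D \<Longrightarrow> continuous_on UNIV (g x)"
    and a: "a \<in> measurable N D" and b: "b \<in> borel_measurable N"
  shows "(\<lambda>z. g (a z) (b z)) \<in> borel_measurable N"
proof -
  obtain B where B: "\<And>i. simple_function N (B i)" "\<And>z. z \<in> space N \<Longrightarrow> (\<lambda>i. B i z) \<longlonglongrightarrow> b z"
    using borel_measurable_implies_sequence_metric[OF b] by blast
  have "(\<lambda>z. g (a z) (B i z)) \<in> borel_measurable N" for i
  proof (rule measurable_compose_countable'[where I = "B i ` space N" and g = "B i" and f = "\<lambda>y z. g (a z) y"])
    show "B i \<in> measurable N (count_space (B i ` space N))"
      using B(1)[of i] by (subst measurable_count_space_eq2) (auto simp: simple_function_def)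
    show "countable (B i ` space N)"
      using B(1)[of i] by (auto simp: simple_function_def intro: countable_finite)
  qed (rule measurable_compose[OF a meas])
  then show ?thesis
  proof (rule borel_measurable_LIMSEQ_metric)
    fix z assume z: "z \<in> space N"
    then have "a z \<in> space D" using a by (rule measurable_space[rotated])
    then have "isCont (g (a z)) (b z)"
      using cont continuous_on_eq_continuous_at open_UNIV by blast
    then show "(\<lambda>i. g (a z) (B i z)) \<longlonglongrightarrow> g (a z) (b z)"
      using B(2)[OF z] by (rule isCont_tendsto_compose)
  qed
qed

lemma (in prob_space) expectation_norm_centered_le:
  fixes v :: "'a \<Rightarrow> 'b::euclidean_space"
  assumes v: "integrable M v" and v2: "integrable M (\<lambda>x. (norm (v x))\<^sup>2)"
  shows "integrable M (\<lambda>x. (norm (v x - expectation v))\<^sup>2)"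
    and "expectation (\<lambda>x. (norm (v x - expectation v))\<^sup>2) \<le> expectation (\<lambda>x. (norm (v x))\<^sup>2)"
proof -
  have eq: "(norm (v x - expectation v))\<^sup>2 = (norm (v x))\<^sup>2 - 2 * inner (v x) (expectation v) + (norm (expectation v))\<^sup>2" for x
    by (simp add: power2_norm_eq_inner inner_diff_left inner_diff_right inner_commute)
  show "integrable M (\<lambda>x. (norm (v x - expectation v))\<^sup>2)"
    unfolding eq using v v2 by auto
  have "expectation (\<lambda>x. (norm (v x - expectation v))\<^sup>2) =
      expectation (\<lambda>x. (norm (v x))\<^sup>2) - (norm (expectation v))\<^sup>2"
    unfolding eq using v v2 by (simp add: prob_space power2_norm_eq_inner)
  then show "expectation (\<lambda>x. (norm (v x - expectation v))\<^sup>2) \<le> expectation (\<lambda>x. (norm (v x))\<^sup>2)"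
    by simp
qed

locale optmuon_process = P: prob_space P + D: prob_space D
  for P :: "'w measure" and D :: "'s measure" +
  fixes F :: "'s \<Rightarrow> real^'n^'m \<Rightarrow> real"
    and f :: "real^'n^'m \<Rightarrow> real"
    and Orth :: "real^'n^'m \<Rightarrow> real^'n^'m"
    and \<xi> :: "nat \<Rightarrow> 'w \<Rightarrow> 's"
    and X1 :: "real^'n^'m"
    and X :: "nat \<Rightarrow> 'w \<Rightarrow> real^'n^'m"
    and \<theta> L \<sigma> G fstar :: real
  assumes params: "\<theta> > 0" "L > 0" "\<sigma> \<ge> 0" "G > 0"
    and differentiable_f: "\<And>Y. f differentiable at Y"
    and lower_bound: "\<And>Y. f Y \<ge> fstar"
    and unbiased: "\<And>Y. has_bochner_integral D (\<lambda>x. grad (F x) Y) (grad f Y)"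
    and variance:
      "\<And>Y. D.expectation (\<lambda>x. (norm (grad (F x) Y - grad f Y))\<^sup>2) \<le> \<sigma>\<^sup>2"
    and lipschitz_F:
      "\<And>x Y Z. x \<in> space D \<Longrightarrow> norm (grad (F x) Y - grad (F x) Z) \<le> L * norm (Y - Z)"
    and bounded_grad: "AE x in D. \<forall>Y. norm (grad (F x) Y) \<le> G"
    and Orth: "orthogonalization Orth"
    and samples_indep: "P.indep_vars (\<lambda>_. D) \<xi> {1..}"
    and samples_distr: "\<And>t. t \<ge> 1 \<Longrightarrow> distr P D (\<xi> t) = D"
    and run: "\<And>w. w \<in> space P \<Longrightarrow> OptMuon_I F Orth \<theta> X1 (\<lambda>t. \<xi> t w) (\<lambda>t. X t w)"
begin

lemma grad_F_measurable [measurable (raw)]: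
  assumes "a \<in> measurable N D" "b \<in> borel_measurable N"
  shows "(\<lambda>z. grad (F (a z)) (b z)) \<in> borel_measurable N"
proof (rule caratheodory_measurable[where g = "\<lambda>x. grad (F x)", OF _ _ assms])
  show "(\<lambda>x. grad (F x) y) \<in> borel_measurable D" for y
    using unbiased[of y] by (rule has_bochner_integral_iff[THEN iffD1, THEN conjunct1, THEN borel_measurable_integrable])
  fix x assume "x \<in> space D"
  then have "L-lipschitz_on UNIV (grad (F x))"
    using lipschitz_F params by (intro lipschitz_onI) (auto simp: dist_norm)
  then show "continuous_on UNIV (grad (F x))"
    by (rule lipschitz_on_continuous_on)
qed

lemma grad_F_integrable: "integrable D (\<lambda>x. grad (F x) Y)"
  and integral_grad_F: "D.expectation (\<lambda>x. grad (F x) Y) = grad f Y"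
  using unbiased[of Y] by (auto simp: has_bochner_integral_iff)

lemma grad_f_lipschitz: "norm (grad f Y - grad f Z) \<le> L * norm (Y - Z)"
proof -
  have "grad f Y - grad f Z = D.expectation (\<lambda>x. grad (F x) Y - grad (F x) Z)"
    by (simp add: integral_grad_F grad_F_integrable)
  also have "norm \<dots> \<le> D.expectation (\<lambda>x. norm (grad (F x) Y - grad (F x) Z))"
    by (rule integral_norm_bound)
  also have "\<dots> \<le> D.expectation (\<lambda>x. L * norm (Y - Z))"
    using lipschitz_F by (intro integral_mono) (auto intro!: integrable_norm Bochner_Integration.integrable_diff grad_F_integrable)
  also have "\<dots> = L * norm (Y - Z)"
    by (simp add: D.prob_space)
  finally show ?thesis .
qed

lemma grad_f_bounded: "norm (grad f Y) \<le> G"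
proof -
  have "norm (grad f Y) \<le> D.expectation (\<lambda>x. norm (grad (F x) Y))"
    unfolding integral_grad_F[symmetric] by (rule integral_norm_bound)
  also have "\<dots> \<le> D.expectation (\<lambda>x. G)"
    using bounded_grad by (intro integral_mono_AE) (auto intro: integrable_norm grad_F_integrable)
  also have "\<dots> = G"
    by (simp add: D.prob_space)
  finally show ?thesis .
qed

lemma grad_f_measurable [measurable]: "grad f \<in> borel_measurable borel"
proof (rule borel_measurable_continuous_onI)
  have "L-lipschitz_on UNIV (grad f)"
    using grad_f_lipschitz params by (intro lipschitz_onI) (auto simp: dist_norm)
  then show "continuous_on UNIV (grad f)"
    by (rule lipschitz_on_continuous_on)
qed

lemma Orth_measurable [measurable]: "Orth \<in> borel_measurable borel"
  using Orth by (simp add: orthogonalization_def)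

section \<open>Filtration of the samples and conditioning on the past\<close>

lemma sample_measurable: "1 \<le> t \<Longrightarrow> \<xi> t \<in> measurable P D"
  using samples_indep by (auto simp: P.indep_vars_def2)

text \<open>A pull-back along the whole block of samples, so that independence of blocks from
  \<open>indep_var_restrict\<close> applies directly. Time 0 gives the trivial
  sigma-algebra.\<close>

definition Fil :: "nat \<Rightarrow> 'w measure"
  where "Fil t = vimage_algebra (space P) (\<lambda>w. \<lambda>i\<in>{1..t}. \<xi> i w) (Pi\<^sub>M {1..t} (\<lambda>_. D))"

lemma space_Fil [simp]: "space (Fil t) = space P"
  by (simp add: Fil_def)

lemma samples_in_space: "w \<in> space P \<Longrightarrow> 1 \<le> i \<Longrightarrow> \<xi> i w \<in> space D"
  using sample_measurable by (rule measurable_space)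

lemma sample_measurable_vimage:
  assumes "J \<subseteq> {1..}" "i \<in> J"
  shows "\<xi> i \<in> measurable (vimage_algebra (space P) (\<lambda>w. \<lambda>i\<in>J. \<xi> i w) (Pi\<^sub>M J (\<lambda>_. D))) D"
proof -
  have "(\<lambda>w. \<lambda>i\<in>J. \<xi> i w) \<in> measurable (vimage_algebra (space P) (\<lambda>w. \<lambda>i\<in>J. \<xi> i w) (Pi\<^sub>M J (\<lambda>_. D))) (Pi\<^sub>M J (\<lambda>_. D))"
    using assms samples_in_space by (intro measurable_vimage_algebra1) (auto simp: space_PiM)
  from measurable_compose[OF this measurable_component_singleton[OF assms(2)]]
  show ?thesis using assms(2) by simp
qed

lemma sample_measurable_Fil: "1 \<le> i \<Longrightarrow> i \<le> t \<Longrightarrow> \<xi> i \<in> measurable (Fil t) D"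
  unfolding Fil_def by (rule sample_measurable_vimage) auto

text \<open>Inclusion of sigma-algebras is expressed as measurability of the identity:
  \<open>Fil t\<close> is the least one making the first t samples measurable. It yields
  monotonicity in t and inclusion in \<open>P\<close> and in the sigma-algebra of all
  samples.\<close>

lemma id_measurable_Fil:
  assumes "space N = space P" "\<And>i. 1 \<le> i \<Longrightarrow> i \<le> t \<Longrightarrow> \<xi> i \<in> measurable N D"
  shows "(\<lambda>w. w) \<in> measurable N (Fil t)"
  unfolding Fil_def
proof (rule measurable_vimage_algebra2)
  show "(\<lambda>w. \<lambda>i\<in>{1..t}. \<xi> i w) \<in> measurable N (Pi\<^sub>M {1..t} (\<lambda>_. D))"
    using assms(2) by (intro measurable_restrict) auto
qed (use assms(1) in auto)

lemma Fil_measurable_mono: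
  assumes "Y \<in> measurable (Fil t) N" "t \<le> u"
  shows "Y \<in> measurable (Fil u) N"
  using measurable_compose[OF id_measurable_Fil assms(1)] assms(2) sample_measurable_Fil by simp

lemma Fil_measurable_P:
  assumes "Y \<in> measurable (Fil t) N"
  shows "Y \<in> measurable P N"
  using measurable_compose[OF id_measurable_Fil assms(1)] sample_measurable by simp

lemma sample_indep:
  assumes A: "A \<in> sets (Fil t)" and B: "B \<in> sets D"
  shows "P.prob (A \<inter> (\<xi> (Suc t) -` B \<inter> space P)) = P.prob A * P.prob (\<xi> (Suc t) -` B \<inter> space P)"
proof -
  let ?past = "\<lambda>w. \<lambda>i\<in>{1..t}. \<xi> i w" and ?next = "\<lambda>w. \<lambda>i\<in>{Suc t}. \<xi> i w"
  let ?B = "(\<lambda>z. z (Suc t)) -` B \<inter> space (Pi\<^sub>M {Suc t} (\<lambda>_. D))"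
  have ind: "P.indep_var (Pi\<^sub>M {1..t} (\<lambda>_. D)) ?past (Pi\<^sub>M {Suc t} (\<lambda>_. D)) ?next"
    using samples_indep by (intro P.indep_var_restrict) auto
  have past: "?past \<in> space P \<rightarrow> space (Pi\<^sub>M {1..t} (\<lambda>_. D))"
    using samples_in_space by (auto simp: space_PiM)
  obtain A' where A': "A' \<in> sets (Pi\<^sub>M {1..t} (\<lambda>_. D))" "A = ?past -` A' \<inter> space P"
    using A unfolding Fil_def sets_vimage_algebra2[OF past] by auto
  have "?B \<in> sets (Pi\<^sub>M {Suc t} (\<lambda>_. D))"
    using B by (intro measurable_sets[OF measurable_component_singleton]) auto
  from P.indep_varD[OF ind A'(1) this]
  have "P.prob ((\<lambda>w. (?past w, ?next w)) -` (A' \<times> ?B) \<inter> space P) =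
      P.prob (?past -` A' \<inter> space P) * P.prob (?next -` ?B \<inter> space P)" .
  moreover have "?next -` ?B \<inter> space P = \<xi> (Suc t) -` B \<inter> space P"
    using samples_in_space by (auto simp: space_PiM)
  moreover have "(\<lambda>w. (?past w, ?next w)) -` (A' \<times> ?B) \<inter> space P =
      (?past -` A' \<inter> space P) \<inter> (?next -` ?B \<inter> space P)"
    by auto
  ultimately show ?thesis
    by (simp only: A'(2))
qed

text \<open>\<open>distr P (Fil t) (\<lambda>w. w)\<close> is \<open>P\<close> restricted to the
  past. Independence of past and next sample becomes a product law, checked on rectangles.\<close>

lemma joint_distribution:
  "distr P (Fil t \<Otimes>\<^sub>M D) (\<lambda>w. (w, \<xi> (Suc t) w)) = distr P (Fil t) (\<lambda>w. w) \<Otimes>\<^sub>M D"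
proof -
  let ?Q = "distr P (Fil t) (\<lambda>w. w)"
  have id: "(\<lambda>w. w) \<in> measurable P (Fil t)"
    by (rule Fil_measurable_P[OF measurable_ident_sets[OF refl]])
  have \<xi>: "\<xi> (Suc t) \<in> measurable P D"
    by (rule sample_measurable) simp
  have pair: "(\<lambda>w. (w, \<xi> (Suc t) w)) \<in> measurable P (Fil t \<Otimes>\<^sub>M D)"
    using id \<xi> by (rule measurable_Pair)
  interpret Q: prob_space ?Q by (rule P.prob_space_distr[OF id])
  show ?thesis
  proof (rule pair_measure_eqI[symmetric])
    fix A B assume "A \<in> sets ?Q" and B: "B \<in> sets D"
    then have A: "A \<in> sets (Fil t)" by simp
    have AP: "A \<inter> space P = A"
      using sets.sets_into_space[OF A] by auto
    have "emeasure D B = emeasure (distr P D (\<xi> (Suc t))) B"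
      by (simp add: samples_distr)
    also have "\<dots> = emeasure P (\<xi> (Suc t) -` B \<inter> space P)"
      using \<xi> B by (rule emeasure_distr)
    finally have DB: "emeasure D B = emeasure P (\<xi> (Suc t) -` B \<inter> space P)" .
    have "emeasure ?Q A = emeasure P A"
      using A by (subst emeasure_distr[OF id]) (auto simp: AP)
    moreover have "emeasure (distr P (Fil t \<Otimes>\<^sub>M D) (\<lambda>w. (w, \<xi> (Suc t) w))) (A \<times> B) =
        emeasure P (A \<inter> (\<xi> (Suc t) -` B \<inter> space P))"
      using A B by (subst emeasure_distr[OF pair]) (auto intro!: arg_cong[where f = "emeasure P"])
    ultimately show "emeasure ?Q A * emeasure D B =
        emeasure (distr P (Fil t \<Otimes>\<^sub>M D) (\<lambda>w. (w, \<xi> (Suc t) w))) (A \<times> B)"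
      using sample_indep[OF A B] by (simp add: DB P.emeasure_eq_measure flip: ennreal_mult')
  qed (auto intro!: sets_pair_measure_cong simp: Q.sigma_finite_measure_axioms D.sigma_finite_measure_axioms)
qed

text \<open>Fubini for the product law stands in for conditional expectation: conditioning on the
  past means integrating over a fresh sample with the past frozen.\<close>

lemma
  fixes H :: "'w \<times> 's \<Rightarrow> real"
  assumes H: "H \<in> borel_measurable (Fil t \<Otimes>\<^sub>M D)"
    and int: "integrable P (\<lambda>w. H (w, \<xi> (Suc t) w))"
  shows integrable_condition: "integrable P (\<lambda>w. D.expectation (\<lambda>x. H (w, x)))"
    and expectation_condition:
      "P.expectation (\<lambda>w. H (w, \<xi> (Suc t) w)) = P.expectation (\<lambda>w. D.expectation (\<lambda>x. H (w, x)))"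
proof -
  let ?Q = "distr P (Fil t) (\<lambda>w. w)"
  have id: "(\<lambda>w. w) \<in> measurable P (Fil t)"
    by (rule Fil_measurable_P[OF measurable_ident_sets[OF refl]])
  have \<xi>: "\<xi> (Suc t) \<in> measurable P D"
    by (rule sample_measurable) simp
  have pair: "(\<lambda>w. (w, \<xi> (Suc t) w)) \<in> measurable P (Fil t \<Otimes>\<^sub>M D)"
    using id \<xi> by (rule measurable_Pair)
  interpret Q: prob_space ?Q by (rule P.prob_space_distr[OF id])
  interpret QD: pair_prob_space ?Q D ..
  have joint: "distr P (Fil t \<Otimes>\<^sub>M D) (\<lambda>w. (w, \<xi> (Suc t) w)) = ?Q \<Otimes>\<^sub>M D"
    by (rule joint_distribution)
  have intQ: "integrable (?Q \<Otimes>\<^sub>M D) H"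
    unfolding joint[symmetric] using int by (subst integrable_distr_eq[OF pair H])
  have meas: "(\<lambda>w. D.expectation (\<lambda>x. H (w, x))) \<in> borel_measurable (Fil t)"
    using H by measurable
  have "integrable ?Q (\<lambda>w. D.expectation (\<lambda>x. H (w, x)))"
    using QD.integrable_fst'[OF intQ] .
  then show "integrable P (\<lambda>w. D.expectation (\<lambda>x. H (w, x)))"
    by (subst (asm) integrable_distr_eq[OF id meas])
  have "P.expectation (\<lambda>w. H (w, \<xi> (Suc t) w)) = integral\<^sup>L (?Q \<Otimes>\<^sub>M D) H"
    unfolding joint[symmetric] by (subst integral_distr[OF pair H]) simp
  also have "\<dots> = (\<integral>w. D.expectation (\<lambda>x. H (w, x)) \<partial>?Q)"
    using QD.integral_fst'[OF intQ] by simp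
  also have "\<dots> = P.expectation (\<lambda>w. D.expectation (\<lambda>x. H (w, x)))"
    by (rule integral_distr[OF id meas])
  finally show "P.expectation (\<lambda>w. H (w, \<xi> (Suc t) w)) = P.expectation (\<lambda>w. D.expectation (\<lambda>x. H (w, x)))" .
qed

section \<open>Adaptedness of the iterates\<close>

abbreviation "s w \<equiv> (\<lambda>t. \<xi> t w)"
abbreviation "x w \<equiv> (\<lambda>t. X t w)"

text \<open>Stated for an arbitrary \<open>N\<close> so that it is available inside the induction
  proving the iterates adapted. \<open>alpha\<close> reaches index \<open>Suc t\<close> since it
  lags one gradient behind.\<close>

lemma run_quantities_measurable:
  assumes \<xi>: "\<And>i. 1 \<le> i \<Longrightarrow> i \<le> t \<Longrightarrow> \<xi> i \<in> measurable N D"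
    and X: "\<And>i. i \<le> t \<Longrightarrow> X i \<in> borel_measurable N"
  shows "(\<lambda>w. alpha F (s w) (x w) (Suc t)) \<in> borel_measurable N"
    and "(\<lambda>w. momentum F (s w) (x w) t) \<in> borel_measurable N"
    and "(\<lambda>w. gamma F (s w) (x w) t) \<in> borel_measurable N"
proof -
  have g: "(\<lambda>w. stoch_grad F (s w) (x w) i) \<in> borel_measurable N" if "1 \<le> i" "i \<le> t" for i
    unfolding stoch_grad_def using that \<xi> X by (intro grad_F_measurable) auto
  have rho: "(\<lambda>w. rho F (s w) (x w) i) \<in> borel_measurable N" if "i \<le> t" for i
  proof -
    have "(\<lambda>w. (norm (stoch_grad F (s w) (x w) j))\<^sup>2) \<in> borel_measurable N" if "j \<in> {1..i}" for j
      using g[of j] that \<open>i \<le> t\<close> by simp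
    then have [measurable]: "(\<lambda>w. MAX j\<in>{1..i}. (norm (stoch_grad F (s w) (x w) j))\<^sup>2) \<in> borel_measurable N"
      "(\<lambda>w. \<Sum>j=1..i. (norm (stoch_grad F (s w) (x w) j))\<^sup>2) \<in> borel_measurable N"
      by (auto intro!: borel_measurable_Max borel_measurable_sum)
    show ?thesis
      unfolding rho_def by measurable
  qed
  have alpha: "(\<lambda>w. alpha F (s w) (x w) i) \<in> borel_measurable N" if "i \<le> Suc t" for i
    unfolding alpha_def using rho[of "i - 1"] that by (cases "i = 0") auto
  have momentum: "(\<lambda>w. momentum F (s w) (x w) i) \<in> borel_measurable N" if "i \<le> t" for i
    using that
  proof (induction i)
    case (Suc i)
    have [measurable]: "(\<lambda>w. momentum F (s w) (x w) i) \<in> borel_measurable N"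
      "(\<lambda>w. alpha F (s w) (x w) (Suc i)) \<in> borel_measurable N"
      "(\<lambda>w. stoch_grad F (s w) (x w) (Suc i)) \<in> borel_measurable N"
      "(\<lambda>w. grad (F (\<xi> (Suc i) w)) (X i w)) \<in> borel_measurable N"
      using Suc alpha[of "Suc i"] g[of "Suc i"] \<xi>[of "Suc i"] X[of i] grad_F_measurable by auto
    show ?case by simp
  qed simp
  show "(\<lambda>w. alpha F (s w) (x w) (Suc t)) \<in> borel_measurable N"
    "(\<lambda>w. momentum F (s w) (x w) t) \<in> borel_measurable N"
    using alpha momentum by auto
  have "(\<lambda>w. alpha F (s w) (x w) j powr (-1/2) * (norm (momentum F (s w) (x w) j))\<^sup>2) \<in> borel_measurable N"
    if "j \<in> {1..t}" for j
    using alpha[of j] momentum[of j] that by simp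
  then have [measurable]: "(\<lambda>w. \<Sum>j=1..t. alpha F (s w) (x w) j powr (-1/2) * (norm (momentum F (s w) (x w) j))\<^sup>2) \<in> borel_measurable N"
    by (rule borel_measurable_sum)
  have [measurable]: "(\<lambda>w. alpha F (s w) (x w) t) \<in> borel_measurable N"
    using alpha[of t] by simp
  show "(\<lambda>w. gamma F (s w) (x w) t) \<in> borel_measurable N"
    unfolding gamma_def by measurable
qed

text \<open>The iterate at t is determined by samples before t. The induction is strong because a
  step depends on all earlier iterates through the accumulated sums; the iterates 0 and 1 are
  constant.\<close>

lemma X_measurable_Fil: "X t \<in> borel_measurable (Fil (t - 1))"
proof (induction t rule: less_induct)
  case (less t)
  consider "t = 0" | "t = 1" | u where "t = Suc u" "1 \<le> u"
    by (cases t) (auto simp: Suc_le_eq)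
  then show ?case
  proof cases
    case 1
    have "(\<lambda>_. X1) \<in> borel_measurable (Fil 0)" by simp
    then show ?thesis
      using run by (subst measurable_cong[of _ _ "\<lambda>_. X1"]) (auto simp: 1 OptMuon_I_def)
  next
    case 2
    have "(\<lambda>_. X1) \<in> borel_measurable (Fil 0)" by simp
    then show ?thesis
      using run by (subst measurable_cong[of _ _ "\<lambda>_. X1"]) (auto simp: 2 OptMuon_I_def)
  next
    case (3 u)
    have "X i \<in> borel_measurable (Fil u)" if "i \<le> u" for i
      using Fil_measurable_mono[OF less[of i]] that 3 by simp
    note m = run_quantities_measurable[OF sample_measurable_Fil this]
    have [measurable]: "X u \<in> borel_measurable (Fil u)"
      "(\<lambda>w. momentum F (s w) (x w) u) \<in> borel_measurable (Fil u)"
      "(\<lambda>w. gamma F (s w) (x w) u) \<in> borel_measurable (Fil u)"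
      using Fil_measurable_mono[OF less[of u]] 3 m[of u] by auto
    have "(\<lambda>w. X u w - (\<theta> * gamma F (s w) (x w) u * norm (momentum F (s w) (x w) u)) *\<^sub>R
        Orth (momentum F (s w) (x w) u)) \<in> borel_measurable (Fil u)"
      by measurable
    then show ?thesis
      using run 3 by (subst measurable_cong[where g = "\<lambda>w. X u w - (\<theta> * gamma F (s w) (x w) u *
        norm (momentum F (s w) (x w) u)) *\<^sub>R Orth (momentum F (s w) (x w) u)"]) (auto simp: OptMuon_I_def)
  qed
qed

lemma X_measurable: "i \<le> Suc t \<Longrightarrow> X i \<in> borel_measurable (Fil t)"
  by (rule Fil_measurable_mono[OF X_measurable_Fil]) simp

lemma alpha_measurable: "(\<lambda>w. alpha F (s w) (x w) (Suc t)) \<in> borel_measurable (Fil t)"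
  and momentum_measurable: "(\<lambda>w. momentum F (s w) (x w) t) \<in> borel_measurable (Fil t)"
  using run_quantities_measurable[OF sample_measurable_Fil X_measurable] by auto

lemma weight_measurable: "(\<lambda>w. weight F (s w) (x w) (Suc t)) \<in> borel_measurable (Fil t)"
  unfolding weight_def using alpha_measurable by simp

lemma stoch_grad_measurable: "(\<lambda>w. stoch_grad F (s w) (x w) (Suc t)) \<in> borel_measurable (Fil (Suc t))"
  unfolding stoch_grad_def by (intro grad_F_measurable sample_measurable_Fil X_measurable) auto

lemma err_measurable: "(\<lambda>w. err f F (s w) (x w) t) \<in> borel_measurable (Fil t)"
proof -
  have [measurable]: "X t \<in> borel_measurable (Fil t)" "(\<lambda>w. momentum F (s w) (x w) t) \<in> borel_measurable (Fil t)"
    using X_measurable[of t t] momentum_measurable by auto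
  show ?thesis
    unfolding err_def by (cases "t = 0") simp_all
qed

lemma drift_measurable: "(\<lambda>w. drift F (s w) (x w) L (Suc t)) \<in> borel_measurable (Fil t)"
proof -
  have [measurable]: "X t \<in> borel_measurable (Fil t)" "X (Suc t) \<in> borel_measurable (Fil t)"
    "(\<lambda>w. alpha F (s w) (x w) (Suc t)) \<in> borel_measurable (Fil t)"
    "(\<lambda>w. weight F (s w) (x w) (Suc t)) \<in> borel_measurable (Fil t)"
    using X_measurable[of t t] X_measurable[of "Suc t" t] alpha_measurable weight_measurable by auto
  show ?thesis
    unfolding drift_def by simp
qed

section \<open>Almost sure path bounds and integrability\<close>

lemma AE_sample_bounded: "AE w in P. \<forall>t\<ge>1. \<forall>Y. norm (grad (F (\<xi> t w)) Y) \<le> G"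
proof -
  have "AE w in P. 1 \<le> t \<longrightarrow> (\<forall>Y. norm (grad (F (\<xi> t w)) Y) \<le> G)" for t
  proof (cases "1 \<le> t")
    case True
    have "AE x in distr P D (\<xi> t). \<forall>Y. norm (grad (F x) Y) \<le> G"
      unfolding samples_distr[OF True] by (rule bounded_grad)
    from AE_distrD[OF sample_measurable[OF True] this] show ?thesis by simp
  qed simp
  then show ?thesis
    by (subst AE_all_countable) auto
qed

text \<open>Turns every pathwise estimate into an almost sure one; the exceptional null set collects
  the outcomes where some drawn sample violates the gradient bound.\<close>

lemma AE_path:
  "AE w in P. optmuon_objective_path F (s w) (x w) Orth \<theta> L G X1 f fstar"
  using AE_sample_bounded
proof (rule AE_mp, intro AE_I2 impI)
  fix w assume w: "w \<in> space P" and b: "\<forall>t\<ge>1. \<forall>Y. norm (grad (F (\<xi> t w)) Y) \<le> G"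
  show "optmuon_objective_path F (s w) (x w) Orth \<theta> L G X1 f fstar"
    using run[OF w] Orth params lipschitz_F[OF samples_in_space[OF w]] b differentiable_f
      grad_f_lipschitz lower_bound
    by unfold_locales auto
qed

text \<open>Adapted and essentially bounded, with a bound that may depend on time. The class is
  closed under the arithmetic used below, so measurability and integrability reduce to introduction
  rules.\<close>

definition bdd_rv :: "nat \<Rightarrow> ('w \<Rightarrow> real) \<Rightarrow> bool"
  where "bdd_rv t Y \<longleftrightarrow> Y \<in> borel_measurable (Fil t) \<and> (\<exists>B. AE w in P. \<bar>Y w\<bar> \<le> B)"

lemma bdd_rvI: "Y \<in> borel_measurable (Fil t) \<Longrightarrow> (AE w in P. \<bar>Y w\<bar> \<le> B) \<Longrightarrow> bdd_rv t Y"
  by (auto simp: bdd_rv_def)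

lemma bdd_rv_mono: "bdd_rv t Y \<Longrightarrow> t \<le> u \<Longrightarrow> bdd_rv u Y"
  unfolding bdd_rv_def using Fil_measurable_mono by blast

lemma bdd_rv_measurable: "bdd_rv t Y \<Longrightarrow> Y \<in> borel_measurable (Fil t)"
  by (simp add: bdd_rv_def)

lemma bdd_rv_integrable:
  assumes "bdd_rv t Y"
  shows "integrable P Y"
proof -
  obtain B where "AE w in P. norm (Y w) \<le> B"
    using assms by (auto simp: bdd_rv_def)
  moreover have "Y \<in> borel_measurable P"
    by (rule Fil_measurable_P[OF bdd_rv_measurable[OF assms]])
  ultimately show ?thesis
    by (rule P.integrable_const_bound)
qed

lemma bdd_rv_const: "bdd_rv t (\<lambda>_. c)"
  by (rule bdd_rvI[of _ _ "\<bar>c\<bar>"]) auto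

lemma bdd_rv_add:
  assumes "bdd_rv t Y" "bdd_rv t Z"
  shows "bdd_rv t (\<lambda>w. Y w + Z w)"
proof -
  obtain A B where AB: "AE w in P. \<bar>Y w\<bar> \<le> A" "AE w in P. \<bar>Z w\<bar> \<le> B"
    using assms by (auto simp: bdd_rv_def)
  have "AE w in P. \<bar>Y w + Z w\<bar> \<le> A + B"
    using AB by eventually_elim auto
  then show ?thesis
    using assms by (intro bdd_rvI) (auto simp: bdd_rv_def)
qed

lemma bdd_rv_mult:
  assumes "bdd_rv t Y" "bdd_rv t Z"
  shows "bdd_rv t (\<lambda>w. Y w * Z w)"
proof -
  obtain A B where AB: "AE w in P. \<bar>Y w\<bar> \<le> A" "AE w in P. \<bar>Z w\<bar> \<le> B"
    using assms by (auto simp: bdd_rv_def)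
  have "AE w in P. \<bar>Y w * Z w\<bar> \<le> A * B"
    using AB by eventually_elim (auto simp: abs_mult intro!: mult_mono)
  then show ?thesis
    using assms by (intro bdd_rvI) (auto simp: bdd_rv_def)
qed

lemma bdd_rv_diff:
  assumes "bdd_rv t Y" "bdd_rv t Z"
  shows "bdd_rv t (\<lambda>w. Y w - Z w)"
  using bdd_rv_add[OF assms(1) bdd_rv_mult[OF bdd_rv_const[of t "-1"] assms(2)]] by simp

lemma bdd_rv_power:
  assumes "bdd_rv t Y"
  shows "bdd_rv t (\<lambda>w. Y w ^ k)"
  using assms by (induction k) (simp_all add: bdd_rv_const bdd_rv_mult)

lemma bdd_rv_sum:
  assumes "\<And>i. i \<in> I \<Longrightarrow> bdd_rv t (Y i)"
  shows "bdd_rv t (\<lambda>w. \<Sum>i\<in>I. Y i w)"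
  using assms by (induction I rule: infinite_finite_induct) (simp_all add: bdd_rv_const bdd_rv_add)

lemmas bdd_rv_intros = bdd_rv_const bdd_rv_add bdd_rv_mult bdd_rv_diff bdd_rv_power bdd_rv_sum

lemma bdd_weight: "bdd_rv t (\<lambda>w. weight F (s w) (x w) (Suc t))"
proof (rule bdd_rvI[OF weight_measurable])
  show "AE w in P. \<bar>weight F (s w) (x w) (Suc t)\<bar> \<le> real (Suc t) powr (1/3)"
    using weight_le_powr[of "Suc t"] weight_pos[of F] by (intro AE_I2) (simp add: less_imp_le)
qed

lemma bdd_inverse_weight: "bdd_rv t (\<lambda>w. 1 / weight F (s w) (x w) (Suc t))"
proof (rule bdd_rvI)
  show "(\<lambda>w. 1 / weight F (s w) (x w) (Suc t)) \<in> borel_measurable (Fil t)"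
    using weight_measurable by simp
  show "AE w in P. \<bar>1 / weight F (s w) (x w) (Suc t)\<bar> \<le> 1"
    using weight_ge_1[of F "s w" "x w" "Suc t" for w] by (intro AE_I2) (simp add: abs_of_pos weight_pos)
qed

lemma bdd_alpha: "bdd_rv t (\<lambda>w. alpha F (s w) (x w) (Suc t))"
proof (rule bdd_rvI[OF alpha_measurable])
  show "AE w in P. \<bar>alpha F (s w) (x w) (Suc t)\<bar> \<le> 1"
    using alpha_pos[of F] alpha_le_1[of F] by (intro AE_I2) (simp add: less_imp_le)
qed

lemma AE_norm_err: "AE w in P. norm (err f F (s w) (x w) t) \<le> G + real t * sqrt (delta CARD('n) L \<theta>) + G"
  using AE_path
proof eventually_elim
  case (elim w)
  then interpret path: optmuon_objective_path F "s w" "x w" Orth \<theta> L G X1 f fstar .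
  show ?case
    using path.norm_momentum_le[of t] grad_f_bounded[of "X t w"] params delta_nonneg[of "CARD('n)" L \<theta>]
      norm_triangle_ineq4[of "momentum F (s w) (x w) t" "grad f (X t w)"]
    by (auto simp: err_def)
qed

lemma bdd_err: "bdd_rv t (\<lambda>w. (norm (err f F (s w) (x w) t))\<^sup>2)"
proof (rule bdd_rv_power, rule bdd_rvI)
  show "(\<lambda>w. norm (err f F (s w) (x w) t)) \<in> borel_measurable (Fil t)"
    using err_measurable by simp
  show "AE w in P. \<bar>norm (err f F (s w) (x w) t)\<bar> \<le> G + real t * sqrt (delta CARD('n) L \<theta>) + G"
    using AE_norm_err by simp
qed

lemma bdd_stoch_grad: "bdd_rv (Suc t) (\<lambda>w. (norm (stoch_grad F (s w) (x w) (Suc t)))\<^sup>2)"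
proof (rule bdd_rv_power, rule bdd_rvI)
  show "(\<lambda>w. norm (stoch_grad F (s w) (x w) (Suc t))) \<in> borel_measurable (Fil (Suc t))"
    using stoch_grad_measurable by simp
  show "AE w in P. \<bar>norm (stoch_grad F (s w) (x w) (Suc t))\<bar> \<le> G"
    using AE_sample_bounded by eventually_elim (simp add: stoch_grad_def)
qed

lemma bdd_drift: "bdd_rv t (\<lambda>w. drift F (s w) (x w) L (Suc t))"
proof (rule bdd_rvI[OF drift_measurable])
  show "AE w in P. \<bar>drift F (s w) (x w) L (Suc t)\<bar> \<le> C_J CARD('n) L \<theta> G * ln (exp 1 + real (Suc t)) / 12"
    using AE_path
  proof eventually_elim
    case (elim w)
    then interpret path: optmuon_objective_path F "s w" "x w" Orth \<theta> L G X1 f fstar .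
    have "drift F (s w) (x w) L (Suc t) \<le> (\<Sum>i=1..Suc t. drift F (s w) (x w) L i)"
      using path.drift_nonneg by (intro member_le_sum) auto
    also have "\<dots> \<le> C_J CARD('n) L \<theta> G * ln (exp 1 + real (Suc t)) / 12"
      by (rule path.sum_drift_le) simp
    finally show ?case using path.drift_nonneg[of "Suc t"] by simp
  qed
qed

end

section \<open>Conditional decrease of the potential\<close>

text \<open>Shrinking the error by \<open>1 - 1 / q^2\<close> costs the weighted square at least
  \<open>1 / q\<close> in weight, and the growth of the weight returns at most
  \<open>1 / (3 q)\<close>; the net loss is the 2/3 in \<open>decr\<close>.\<close>

lemma weight_contraction:
  "weight F s X (Suc t) * (1 - alpha F s X (Suc t))\<^sup>2 \<le> weight F s X t - 2/3 / weight F s X (Suc t)"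
proof -
  define q where "q = weight F s X (Suc t)"
  have q: "1 \<le> q" by (simp add: q_def weight_ge_1)
  have z: "0 \<le> 1 - 1 / q\<^sup>2" "1 - 1 / q\<^sup>2 \<le> 1"
    using q by auto
  have "(1 - 1 / q\<^sup>2)\<^sup>2 \<le> 1 - 1 / q\<^sup>2"
    using mult_left_mono[OF z(2) z(1)] by (simp add: power2_eq_square)
  then have "q * (1 - 1 / q\<^sup>2)\<^sup>2 \<le> q * (1 - 1 / q\<^sup>2)"
    using q by (intro mult_left_mono) auto
  also have "\<dots> = q - 1 / q"
    using q by (simp add: field_simps power2_eq_square)
  also have "\<dots> \<le> weight F s X t - 2/3 / q"
  proof -
    have "1 / (3 * q) = 1/3 * (1 / q)" "2/3 / q = 2/3 * (1 / q)" by simp_all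
    then show ?thesis
      using weight_Suc[of F s X t] unfolding q_def[symmetric] by linarith
  qed
  finally show ?thesis by (simp add: q_def alpha_eq)
qed

lemma norm_scaleR_add_sq:
  fixes a b :: "'a::real_inner"
  shows "(norm (c *\<^sub>R a + b))\<^sup>2 = c\<^sup>2 * (norm a)\<^sup>2 + 2 * c * inner a b + (norm b)\<^sup>2"
  unfolding power2_norm_eq_inner
  by (simp add: inner_add_left inner_add_right inner_commute power2_eq_square algebra_simps)

lemma norm_diff_scaleR_sq:
  fixes a b :: "'a::real_inner"
  shows "(norm (b - c *\<^sub>R a))\<^sup>2 = (norm b)\<^sup>2 - 2 * c * inner a b + c\<^sup>2 * (norm a)\<^sup>2"
  using norm_scaleR_add_sq[of "- c" a b] by simp

context optmuon_process
begin

abbreviation "E t w \<equiv> err f F (s w) (x w) t"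
abbreviation "q t w \<equiv> weight F (s w) (x w) t"
abbreviation "\<alpha> t w \<equiv> alpha F (s w) (x w) t"
abbreviation "d t w \<equiv> drift F (s w) (x w) L t"
abbreviation "g t w \<equiv> stoch_grad F (s w) (x w) t"

text \<open>
  The quantities \<open>contr\<close>, \<open>decr\<close>, \<open>incr\<close>, \<open>noise\<close> at index \<open>t\<close> belong to the step from \<open>t\<close> to \<open>Suc t\<close>; the first two are
  already known at time \<open>t\<close>.
\<close>

definition pot :: "nat \<Rightarrow> 'w \<Rightarrow> real"
  where "pot t w = q t w * (norm (E t w))\<^sup>2"

definition contr :: "nat \<Rightarrow> 'w \<Rightarrow> real"
  where "contr t w = q (Suc t) w * (1 - \<alpha> (Suc t) w)\<^sup>2 * (norm (E t w))\<^sup>2"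

definition decr :: "nat \<Rightarrow> 'w \<Rightarrow> real"
  where "decr t w = 2/3 * ((norm (E t w))\<^sup>2 * (1 / q (Suc t) w))"

definition incr :: "nat \<Rightarrow> 'w \<Rightarrow> real"
  where "incr t w = d (Suc t) w + 2 * (norm (g (Suc t) w))\<^sup>2 * (1 / q (Suc t) w)^3"

definition noise :: "nat \<Rightarrow> 'w \<Rightarrow> 's \<Rightarrow> real^'n^'m"
  where "noise t w y =
    (grad (F y) (X (Suc t) w) - (1 - \<alpha> (Suc t) w) *\<^sub>R grad (F y) (X t w))
    - (grad f (X (Suc t) w) - (1 - \<alpha> (Suc t) w) *\<^sub>R grad f (X t w))"

text \<open>Both gradients in the update are taken at the same fresh sample, so what remains beside
  the shrunk old error is centered given the past.\<close>

lemma err_Suc: "E (Suc t) w = (1 - \<alpha> (Suc t) w) *\<^sub>R E t w + noise t w (\<xi> (Suc t) w)"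
  by (cases "t = 0") (simp_all add: err_def noise_def stoch_grad_def alpha_1 algebra_simps)

lemma contr_le: "contr t w \<le> pot t w - decr t w"
  using mult_right_mono[OF weight_contraction[of F "s w" "x w" t], of "(norm (E t w))\<^sup>2"]
  by (simp add: contr_def pot_def decr_def algebra_simps)

lemma contr_nonneg: "0 \<le> contr t w" and decr_nonneg: "0 \<le> decr t w" and pot_nonneg: "0 \<le> pot t w"
  and incr_nonneg: "0 \<le> incr t w"
  using weight_pos[of F "s w" "x w" t] weight_pos[of F "s w" "x w" "Suc t"]
  by (simp_all add: contr_def decr_def pot_def incr_def drift_def)

lemma bdd_contr: "bdd_rv t (contr t)" and bdd_decr: "bdd_rv t (decr t)" and bdd_incr: "bdd_rv (Suc t) (incr t)"
  unfolding contr_def[abs_def] decr_def[abs_def] incr_def[abs_def]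
  by (intro bdd_rv_intros bdd_weight bdd_inverse_weight bdd_alpha bdd_err bdd_stoch_grad
      bdd_rv_mono[OF bdd_drift] bdd_rv_mono[OF bdd_inverse_weight] le_SucI order_refl)+

lemma bdd_pot: "bdd_rv t (pot t)"
proof (cases t)
  case 0
  then show ?thesis
    using bdd_rv_const[of 0 0] by (simp add: pot_def[abs_def] err_def)
next
  case (Suc u)
  then show ?thesis
    unfolding pot_def[abs_def]
    by (intro bdd_rv_mult bdd_err) (simp add: bdd_rv_mono[OF bdd_weight])
qed

lemma bdd_inner_err: "bdd_rv (Suc t) (\<lambda>w. inner (E t w) (E (Suc t) w))"
proof -
  \<comment> \<open>Polarization reduces the inner product to norms, whose bounds are already
    known.\<close>
  have eq: "inner (E t w) (E (Suc t) w) = 1/2 * (norm (E t w + E (Suc t) w))\<^sup>2 - 1/2 * (norm (E t w))\<^sup>2 - 1/2 * (norm (E (Suc t) w))\<^sup>2" for w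
    by (simp add: power2_norm_eq_inner inner_add_left inner_add_right inner_commute add_divide_distrib)
  have "bdd_rv (Suc t) (\<lambda>w. norm (E t w + E (Suc t) w))"
  proof (rule bdd_rvI)
    have [measurable]: "E t \<in> borel_measurable (Fil (Suc t))" "E (Suc t) \<in> borel_measurable (Fil (Suc t))"
      using Fil_measurable_mono[OF err_measurable[of t], of "Suc t"] err_measurable[of "Suc t"] by auto
    show "(\<lambda>w. norm (E t w + E (Suc t) w)) \<in> borel_measurable (Fil (Suc t))"
      by simp
    show "AE w in P. \<bar>norm (E t w + E (Suc t) w)\<bar> \<le>
        (G + real t * sqrt (delta CARD('n) L \<theta>) + G) + (G + real (Suc t) * sqrt (delta CARD('n) L \<theta>) + G)"
      using AE_norm_err[of t] AE_norm_err[of "Suc t"]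
    proof eventually_elim
      case (elim w)
      then show ?case
        unfolding abs_norm_cancel by (intro norm_triangle_le add_mono)
    qed
  qed
  then show ?thesis
    unfolding eq by (intro bdd_rv_intros bdd_err bdd_rv_mono[OF bdd_err]) auto
qed

text \<open>On the realised sample the noise is a combination of two errors; its boundedness is
  inherited from theirs.\<close>

lemma noise_eq: "noise t w (\<xi> (Suc t) w) = E (Suc t) w - (1 - \<alpha> (Suc t) w) *\<^sub>R E t w"
  by (simp add: err_Suc)

lemma bdd_inner_noise: "bdd_rv (Suc t) (\<lambda>w. inner (E t w) (noise t w (\<xi> (Suc t) w)))"
proof -
  have "inner (E t w) (noise t w (\<xi> (Suc t) w)) = inner (E t w) (E (Suc t) w) - (1 - \<alpha> (Suc t) w) * (norm (E t w))\<^sup>2" for w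
    by (simp add: noise_eq inner_diff_right power2_norm_eq_inner)
  then show ?thesis
    by (simp only:) (intro bdd_rv_intros bdd_inner_err bdd_rv_mono[OF bdd_alpha] bdd_rv_mono[OF bdd_err] le_SucI order_refl)
qed

lemma bdd_norm_noise: "bdd_rv (Suc t) (\<lambda>w. (norm (noise t w (\<xi> (Suc t) w)))\<^sup>2)"
proof -
  have "(norm (noise t w (\<xi> (Suc t) w)))\<^sup>2 = (norm (E (Suc t) w))\<^sup>2 - 2 * (1 - \<alpha> (Suc t) w) * inner (E t w) (E (Suc t) w)
      + (1 - \<alpha> (Suc t) w)\<^sup>2 * (norm (E t w))\<^sup>2" for w
    unfolding noise_eq by (rule norm_diff_scaleR_sq)
  then show ?thesis
    by (simp only:) (intro bdd_rv_intros bdd_inner_err bdd_rv_mono[OF bdd_alpha] bdd_rv_mono[OF bdd_err] bdd_err le_SucI order_refl)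
qed

lemma grad_F_snd_measurable:
  assumes "Y \<in> borel_measurable (Fil t)"
  shows "(\<lambda>z. grad (F (snd z)) (Y (fst z))) \<in> borel_measurable (Fil t \<Otimes>\<^sub>M D)"
  by (intro grad_F_measurable measurable_compose[OF measurable_fst assms]) measurable

lemma noise_measurable: "(\<lambda>z. noise t (fst z) (snd z)) \<in> borel_measurable (Fil t \<Otimes>\<^sub>M D)"
proof -
  have X [measurable]: "X t \<in> borel_measurable (Fil t)" "X (Suc t) \<in> borel_measurable (Fil t)"
    "\<alpha> (Suc t) \<in> borel_measurable (Fil t)"
    using X_measurable[of t t] X_measurable[of "Suc t" t] alpha_measurable by auto
  have [measurable]: "(\<lambda>z. grad (F (snd z)) (X t (fst z))) \<in> borel_measurable (Fil t \<Otimes>\<^sub>M D)"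
    "(\<lambda>z. grad (F (snd z)) (X (Suc t) (fst z))) \<in> borel_measurable (Fil t \<Otimes>\<^sub>M D)"
    using X by (auto intro: grad_F_snd_measurable)
  show ?thesis
    unfolding noise_def by measurable
qed

lemma
  fixes c :: real
  shows integrable_mix: "integrable D (\<lambda>y. grad (F y) Y - c *\<^sub>R grad (F y) Z)"
    and integral_mix: "D.expectation (\<lambda>y. grad (F y) Y - c *\<^sub>R grad (F y) Z) = grad f Y - c *\<^sub>R grad f Z"
    and integrable_mix_sq: "integrable D (\<lambda>y. (norm (grad (F y) Y - c *\<^sub>R grad (F y) Z))\<^sup>2)"
proof -
  show int: "integrable D (\<lambda>y. grad (F y) Y - c *\<^sub>R grad (F y) Z)"
    by (intro Bochner_Integration.integrable_diff integrable_scaleR_right grad_F_integrable)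
  show "D.expectation (\<lambda>y. grad (F y) Y - c *\<^sub>R grad (F y) Z) = grad f Y - c *\<^sub>R grad f Z"
    by (simp add: grad_F_integrable integral_grad_F)
  show "integrable D (\<lambda>y. (norm (grad (F y) Y - c *\<^sub>R grad (F y) Z))\<^sup>2)"
  proof (rule D.integrable_const_bound)
    show "AE y in D. norm ((norm (grad (F y) Y - c *\<^sub>R grad (F y) Z))\<^sup>2) \<le> (G + \<bar>c\<bar> * G)\<^sup>2"
      using bounded_grad
    proof eventually_elim
      case (elim y)
      have "norm (grad (F y) Y - c *\<^sub>R grad (F y) Z) \<le> norm (grad (F y) Y) + norm (c *\<^sub>R grad (F y) Z)"
        by (rule norm_triangle_ineq4)
      also have "\<dots> \<le> G + \<bar>c\<bar> * G"
        using elim by (auto intro!: add_mono mult_left_mono)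
      finally show ?case by (simp add: power_mono)
    qed
    show "(\<lambda>y. (norm (grad (F y) Y - c *\<^sub>R grad (F y) Z))\<^sup>2) \<in> borel_measurable D"
      using borel_measurable_integrable[OF int] by simp
  qed
qed

text \<open>With the past frozen, \<open>U\<close> and \<open>E t\<close> are constants and
  \<open>noise\<close> has mean 0 over the fresh sample.\<close>

lemma expectation_inner_noise:
  assumes U: "bdd_rv t U"
  shows "P.expectation (\<lambda>w. U w * inner (E t w) (noise t w (\<xi> (Suc t) w))) = 0"
proof -
  define H where "H z = U (fst z) * inner (E t (fst z)) (noise t (fst z) (snd z))" for z
  have [measurable]: "U \<in> borel_measurable (Fil t)" "E t \<in> borel_measurable (Fil t)"
    using U err_measurable by (auto simp: bdd_rv_def)
  note [measurable] = noise_measurable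
  have H: "H \<in> borel_measurable (Fil t \<Otimes>\<^sub>M D)"
    unfolding H_def[abs_def] by measurable
  have int: "integrable P (\<lambda>w. H (w, \<xi> (Suc t) w))"
    unfolding H_def by (simp, rule bdd_rv_integrable[of "Suc t"]) (intro bdd_rv_mult bdd_rv_mono[OF U] bdd_inner_noise, simp)
  have "integrable D (noise t w)" "D.expectation (noise t w) = 0" for w
    unfolding noise_def[abs_def] using integrable_mix[of "X (Suc t) w"] integral_mix[of "X (Suc t) w"]
    by (auto simp: D.prob_space)
  then have "D.expectation (\<lambda>y. inner (E t w) (noise t w y)) = 0" for w
    by (subst integral_inner_right) simp_all
  then show ?thesis
    using expectation_condition[OF H int] by (simp add: H_def)
qed

text \<open>The variance is at most the second moment of the uncentered combination. That splits
  into a Lipschitz part, the drift, and \<open>\<alpha>\<close> times the fresh gradient, where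
  \<open>q \<alpha>^2 = 1 / q^3\<close>.\<close>

lemma expectation_norm_noise_le:
  assumes U: "bdd_rv t U" "AE w in P. 0 \<le> U w"
  shows "P.expectation (\<lambda>w. U w * (q (Suc t) w * (norm (noise t w (\<xi> (Suc t) w)))\<^sup>2))
    \<le> P.expectation (\<lambda>w. U w * incr t w)"
proof -
  define H where "H z = U (fst z) * (q (Suc t) (fst z) * (norm (noise t (fst z) (snd z)))\<^sup>2)" for z
  define K where "K z = U (fst z) * (d (Suc t) (fst z) +
    2 * (norm (grad (F (snd z)) (X (Suc t) (fst z))))\<^sup>2 * (1 / q (Suc t) (fst z))^3)" for z
  have X [measurable]: "U \<in> borel_measurable (Fil t)" "q (Suc t) \<in> borel_measurable (Fil t)" "d (Suc t) \<in> borel_measurable (Fil t)"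
    "X (Suc t) \<in> borel_measurable (Fil t)"
    using U weight_measurable drift_measurable X_measurable[of "Suc t" t] by (auto simp: bdd_rv_def)
  have [measurable]: "(\<lambda>z. grad (F (snd z)) (X (Suc t) (fst z))) \<in> borel_measurable (Fil t \<Otimes>\<^sub>M D)"
    using X by (auto intro: grad_F_snd_measurable)
  note [measurable] = noise_measurable
  have H: "H \<in> borel_measurable (Fil t \<Otimes>\<^sub>M D)"
    unfolding H_def[abs_def] by measurable
  have K: "K \<in> borel_measurable (Fil t \<Otimes>\<^sub>M D)"
    unfolding K_def[abs_def] by measurable
  have intH: "integrable P (\<lambda>w. H (w, \<xi> (Suc t) w))"
    unfolding H_def by (simp, rule bdd_rv_integrable[of "Suc t"])
      (intro bdd_rv_mult bdd_rv_mono[OF U(1)] bdd_rv_mono[OF bdd_weight] bdd_norm_noise le_SucI order_refl)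
  have Kincr: "K (w, \<xi> (Suc t) w) = U w * incr t w" for w
    by (simp add: K_def incr_def stoch_grad_def)
  have intK: "integrable P (\<lambda>w. K (w, \<xi> (Suc t) w))"
    unfolding Kincr by (rule bdd_rv_integrable[of "Suc t"])
      (intro bdd_rv_mult bdd_rv_mono[OF U(1)] bdd_incr le_SucI order_refl)
  have le: "D.expectation (\<lambda>y. H (w, y)) \<le> D.expectation (\<lambda>y. K (w, y))" if "0 \<le> U w" for w
  proof -
    define c where "c = 1 - \<alpha> (Suc t) w"
    define Q where "Q = q (Suc t) w"
    define Y Z where "Y = X (Suc t) w" and "Z = X t w"
    have c: "0 \<le> c" "1 - c = 1 / Q\<^sup>2" and Q: "0 < Q"
      using alpha_le_1[of F "s w" "x w" "Suc t"] weight_pos[of F "s w" "x w" "Suc t"]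
      by (auto simp: c_def Q_def alpha_eq)
    have noise: "noise t w y = (grad (F y) Y - c *\<^sub>R grad (F y) Z) - D.expectation (\<lambda>y. grad (F y) Y - c *\<^sub>R grad (F y) Z)" for y
      by (simp add: integral_mix noise_def c_def Y_def Z_def)
    note centered = D.expectation_norm_centered_le[OF integrable_mix integrable_mix_sq, of Y c Z, folded noise]
    have intY: "integrable D (\<lambda>y. (norm (grad (F y) Y))\<^sup>2)"
      using integrable_mix_sq[of Y 0 Z] by simp
    have "D.expectation (\<lambda>y. (norm (noise t w y))\<^sup>2) \<le> D.expectation (\<lambda>y. (norm (grad (F y) Y - c *\<^sub>R grad (F y) Z))\<^sup>2)"
      by (rule centered(2))
    also have "\<dots> \<le> D.expectation (\<lambda>y. 2 * (c * (L * norm (Y - Z)))\<^sup>2 + 2 * (1 - c)\<^sup>2 * (norm (grad (F y) Y))\<^sup>2)"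
    proof (rule integral_mono)
      fix y assume y: "y \<in> space D"
      have split: "grad (F y) Y - c *\<^sub>R grad (F y) Z = c *\<^sub>R (grad (F y) Y - grad (F y) Z) + (1 - c) *\<^sub>R grad (F y) Y"
        by (simp add: algebra_simps)
      define a b where "a = norm (c *\<^sub>R (grad (F y) Y - grad (F y) Z))" and "b = norm ((1 - c) *\<^sub>R grad (F y) Y)"
      have "(norm (grad (F y) Y - c *\<^sub>R grad (F y) Z))\<^sup>2 \<le> (a + b)\<^sup>2"
        unfolding split a_def b_def by (intro power_mono norm_triangle_ineq) auto
      also have "\<dots> \<le> 2 * a\<^sup>2 + 2 * b\<^sup>2"
        using zero_le_power2[of "a - b"] by (simp add: power2_diff power2_sum)
      also have "\<dots> \<le> 2 * (c * (L * norm (Y - Z)))\<^sup>2 + 2 * b\<^sup>2"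
        unfolding a_def using c lipschitz_F[OF y] by (intro add_right_mono mult_left_mono power_mono) (auto intro: mult_left_mono)
      also have "b\<^sup>2 = (1 - c)\<^sup>2 * (norm (grad (F y) Y))\<^sup>2"
        by (simp add: b_def power_mult_distrib)
      finally show "(norm (grad (F y) Y - c *\<^sub>R grad (F y) Z))\<^sup>2
          \<le> 2 * (c * (L * norm (Y - Z)))\<^sup>2 + 2 * (1 - c)\<^sup>2 * (norm (grad (F y) Y))\<^sup>2"
        by (simp add: mult.assoc)
    qed (auto intro!: integrable_mix_sq intY)
    also have "\<dots> = 2 * (c * (L * norm (Y - Z)))\<^sup>2 + 2 * (1 - c)\<^sup>2 * D.expectation (\<lambda>y. (norm (grad (F y) Y))\<^sup>2)"
      using intY by (simp add: D.prob_space)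
    finally have "Q * D.expectation (\<lambda>y. (norm (noise t w y))\<^sup>2)
        \<le> Q * (2 * (c * (L * norm (Y - Z)))\<^sup>2 + 2 * (1 - c)\<^sup>2 * D.expectation (\<lambda>y. (norm (grad (F y) Y))\<^sup>2))"
      using Q by (intro mult_left_mono) auto
    also have "\<dots> = d (Suc t) w + 2 * D.expectation (\<lambda>y. (norm (grad (F y) Y))\<^sup>2) * (1 / Q)^3"
      using Q unfolding c(2)
      by (simp add: drift_def Q_def[symmetric] c_def[symmetric] Y_def[symmetric] Z_def[symmetric]
          field_simps power2_eq_square power3_eq_cube)
    finally have "U w * (Q * D.expectation (\<lambda>y. (norm (noise t w y))\<^sup>2))
        \<le> U w * (d (Suc t) w + 2 * D.expectation (\<lambda>y. (norm (grad (F y) Y))\<^sup>2) * (1 / Q)^3)"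
      using that by (rule mult_left_mono)
    then show ?thesis
      using centered(1) intY by (simp add: H_def K_def Q_def Y_def D.prob_space)
  qed
  have "P.expectation (\<lambda>w. H (w, \<xi> (Suc t) w)) = P.expectation (\<lambda>w. D.expectation (\<lambda>y. H (w, y)))"
    by (rule expectation_condition[OF H intH])
  also have "\<dots> \<le> P.expectation (\<lambda>w. D.expectation (\<lambda>y. K (w, y)))"
    using U(2) le by (intro integral_mono_AE integrable_condition[OF H intH] integrable_condition[OF K intK]) auto
  \<comment> \<open>Conditioning is undone: the mean over a fresh gradient becomes the realised
    gradient again, for which the path sum has a logarithmic bound.\<close>
  also have "\<dots> = P.expectation (\<lambda>w. K (w, \<xi> (Suc t) w))"
    by (rule expectation_condition[OF K intK, symmetric])
  finally show ?thesis
    unfolding Kincr by (simp add: H_def)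
qed

lemma pot_Suc: "pot (Suc t) w = contr t w
    + 2 * (q (Suc t) w * (1 - \<alpha> (Suc t) w)) * inner (E t w) (noise t w (\<xi> (Suc t) w))
    + q (Suc t) w * (norm (noise t w (\<xi> (Suc t) w)))\<^sup>2"
  unfolding pot_def contr_def err_Suc norm_scaleR_add_sq
  by (simp add: distrib_left mult_ac)

text \<open>\<open>U\<close> is any nonnegative weight known at time t: the constant 1 gives the
  first moment, the unspent drift budget a weighted sum.\<close>

lemma expectation_pot_Suc_le:
  assumes U: "bdd_rv t U" "AE w in P. 0 \<le> U w"
  shows "P.expectation (\<lambda>w. U w * pot (Suc t) w) \<le> P.expectation (\<lambda>w. U w * (pot t w - decr t w + incr t w))"
proof -
  let ?in = "\<lambda>w. inner (E t w) (noise t w (\<xi> (Suc t) w))"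
  define V where "V w = 2 * U w * (q (Suc t) w * (1 - \<alpha> (Suc t) w))" for w
  have V: "bdd_rv t V"
    unfolding V_def[abs_def] by (intro bdd_rv_intros U bdd_weight bdd_alpha)
  have eq: "U w * pot (Suc t) w = U w * contr t w + V w * ?in w
      + U w * (q (Suc t) w * (norm (noise t w (\<xi> (Suc t) w)))\<^sup>2)" for w
    unfolding pot_Suc V_def by (simp add: algebra_simps)
  have b: "bdd_rv (Suc t) (\<lambda>w. U w * contr t w)" "bdd_rv (Suc t) (\<lambda>w. V w * ?in w)"
    "bdd_rv (Suc t) (\<lambda>w. U w * (q (Suc t) w * (norm (noise t w (\<xi> (Suc t) w)))\<^sup>2))"
    "bdd_rv (Suc t) (\<lambda>w. U w * incr t w)" "bdd_rv (Suc t) (\<lambda>w. U w * (pot t w - decr t w))"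
    by (intro bdd_rv_intros bdd_rv_mono[OF U(1)] bdd_rv_mono[OF V] bdd_rv_mono[OF bdd_contr] bdd_rv_mono[OF bdd_weight] bdd_inner_noise bdd_norm_noise
         bdd_incr bdd_rv_mono[OF bdd_pot] bdd_rv_mono[OF bdd_decr] le_SucI order_refl)+
  note int = b[THEN bdd_rv_integrable]
  have "P.expectation (\<lambda>w. U w * pot (Suc t) w) = P.expectation (\<lambda>w. U w * contr t w)
      + P.expectation (\<lambda>w. U w * (q (Suc t) w * (norm (noise t w (\<xi> (Suc t) w)))\<^sup>2))"
    unfolding eq using int expectation_inner_noise[OF V] by simp
  also have "\<dots> \<le> P.expectation (\<lambda>w. U w * (pot t w - decr t w)) + P.expectation (\<lambda>w. U w * incr t w)"
  proof (rule add_mono)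
    show "P.expectation (\<lambda>w. U w * contr t w) \<le> P.expectation (\<lambda>w. U w * (pot t w - decr t w))"
      using int
    proof (intro integral_mono_AE)
      show "AE w in P. U w * contr t w \<le> U w * (pot t w - decr t w)"
        using U(2) by eventually_elim (intro mult_left_mono contr_le)
    qed auto
  qed (rule expectation_norm_noise_le[OF U])
  also have "\<dots> = P.expectation (\<lambda>w. U w * (pot t w - decr t w) + U w * incr t w)"
    using int by simp
  finally show ?thesis by (simp add: distrib_left)
qed

end

section \<open>Moments of the momentum error\<close>

context optmuon_process
begin

section \<open>First moment and drift-weighted sums of the potential\<close>

definition drift_bound :: "nat \<Rightarrow> real"
  where "drift_bound T = C_J CARD('n) L \<theta> G * ln (exp 1 + real T) / 12"

definition incr_bound :: "nat \<Rightarrow> real"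
  where "incr_bound T = drift_bound T + 2/45 * (C_I G * ln (exp 1 + real T))"

lemma drift_nonneg: "0 \<le> d t w"
  using weight_pos[of F "s w" "x w" t] by (simp add: drift_def)

lemma AE_drift_sum_le:
  assumes "t \<le> T" "1 \<le> T"
  shows "AE w in P. (\<Sum>i<t. d (Suc i) w) \<le> drift_bound T"
  using AE_path
proof eventually_elim
  case (elim w)
  then interpret path: optmuon_objective_path F "s w" "x w" Orth \<theta> L G X1 f fstar .
  have "(\<Sum>i<t. d (Suc i) w) \<le> (\<Sum>i<T. d (Suc i) w)"
    using assms drift_nonneg by (intro sum_mono2) auto
  also have "\<dots> = (\<Sum>i=1..T. d i w)"
    by (rule sum.reindex_bij_witness[of _ "\<lambda>t. t - 1" Suc]) auto
  also have "\<dots> \<le> drift_bound T"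
    unfolding drift_bound_def by (rule path.sum_drift_le[OF assms(2)])
  finally show ?case .
qed

lemma AE_incr_sum_le:
  assumes "1 \<le> T"
  shows "AE w in P. (\<Sum>i<T. incr i w) \<le> incr_bound T"
  using AE_path
proof eventually_elim
  case (elim w)
  then interpret path: optmuon_objective_path F "s w" "x w" Orth \<theta> L G X1 f fstar .
  have "(\<Sum>i<T. incr i w) = (\<Sum>i<T. d (Suc i) w + 2 * (norm (g (Suc i) w))\<^sup>2 / (q (Suc i) w)^3)"
    by (simp add: incr_def power_divide)
  also have "\<dots> = (\<Sum>i=1..T. d i w + 2 * (norm (g i w))\<^sup>2 / (q i w)^3)"
    by (rule sum.reindex_bij_witness[of _ "\<lambda>t. t - 1" Suc]) auto
  also have "\<dots> \<le> incr_bound T"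
    unfolding sum.distrib incr_bound_def drift_bound_def
    by (intro add_mono path.sum_drift_le[OF assms] path.sum_grad_div_weight_le)
  finally show ?case .
qed

lemma pot_0: "pot 0 w = 0"
  by (simp add: pot_def err_def)

lemma int_decr: "integrable P (decr t)" and int_pot: "integrable P (pot t)" and int_incr: "integrable P (incr t)"
  using bdd_decr bdd_pot bdd_incr by (auto intro: bdd_rv_integrable)

lemma bdd_drift_mono: "t \<le> u \<Longrightarrow> bdd_rv u (d (Suc t))"
  and bdd_decr_mono: "t \<le> u \<Longrightarrow> bdd_rv u (decr t)"
  using bdd_rv_mono[OF bdd_drift] bdd_rv_mono[OF bdd_decr] by auto

lemma bdd_drift_pot: "bdd_rv t (\<lambda>w. d (Suc t) w * pot t w)"
  by (intro bdd_rv_mult bdd_drift bdd_pot)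

lemma expectation_incr_sum_le:
  assumes "1 \<le> T"
  shows "(\<Sum>i<T. P.expectation (incr i)) \<le> incr_bound T"
proof -
  have "(\<Sum>i<T. P.expectation (incr i)) = P.expectation (\<lambda>w. \<Sum>i<T. incr i w)"
    by (simp add: int_incr)
  also have "\<dots> \<le> P.expectation (\<lambda>w. incr_bound T)"
    using AE_incr_sum_le[OF assms] by (intro integral_mono_AE) (auto intro: int_incr)
  finally show ?thesis by (simp add: P.prob_space)
qed

lemma expectation_decr_sum_le:
  "(\<Sum>i<t. P.expectation (decr i)) + P.expectation (pot t) \<le> (\<Sum>i<t. P.expectation (incr i))"
proof (induction t)
  case 0
  then show ?case by (simp add: pot_0)
next
  case (Suc t)
  have "P.expectation (pot (Suc t)) \<le> P.expectation (\<lambda>w. pot t w - decr t w + incr t w)"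
    using expectation_pot_Suc_le[of t "\<lambda>_. 1"] by (simp add: bdd_rv_const)
  also have "\<dots> = P.expectation (pot t) - P.expectation (decr t) + P.expectation (incr t)"
    by (simp add: int_pot int_decr int_incr)
  finally show ?case using Suc by simp
qed

text \<open>
  The remaining drift budget \<open>drift_bound T - (\<Sum>i<t. d (Suc i))\<close> is predictable, so it may serve as a
  weight of the potential; its decrements produce the weighted sum on the left.  This replaces a maximal inequality.
\<close>

lemma expectation_drift_pot_sum_le:
  assumes T: "1 \<le> T"
  shows "(\<Sum>i<T. P.expectation (\<lambda>w. d (Suc i) w * pot i w)) \<le> drift_bound T * (\<Sum>i<T. P.expectation (incr i))"
proof -
  define c where "c t w = drift_bound T - (\<Sum>i<t. d (Suc i) w)" for t w
  \<comment> \<open>\<open>c (Suc t)\<close> is known at time t, one step before its index, because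
    the drift at \<open>Suc t\<close> is; this allows it to multiply \<open>pot (Suc t)\<close>
    under conditioning.\<close>
  have bc: "bdd_rv t (c u)" if "u \<le> Suc t" for t u
    unfolding c_def[abs_def] using that by (intro bdd_rv_intros bdd_drift_mono) auto
  have c_le: "c t w \<le> drift_bound T" for t w
    using drift_nonneg by (simp add: c_def sum_nonneg)
  have c_nonneg: "AE w in P. 0 \<le> c t w" if "t \<le> T" for t
    using AE_drift_sum_le[OF that T] by (simp add: c_def)
  have "P.expectation (\<lambda>w. c t w * pot t w) + (\<Sum>i<t. P.expectation (\<lambda>w. d (Suc i) w * pot i w))
      \<le> drift_bound T * (\<Sum>i<t. P.expectation (incr i))" if "t \<le> T" for t
    using that
  proof (induction t)
    case 0
    then show ?case by (simp add: pot_0)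
  next
    case (Suc t)
    have b: "bdd_rv (Suc t) (\<lambda>w. c (Suc t) w * (pot t w - decr t w + incr t w))"
      "bdd_rv (Suc t) (\<lambda>w. c t w * pot t w)" "bdd_rv (Suc t) (\<lambda>w. d (Suc t) w * pot t w)"
      by (intro bdd_rv_intros bc bdd_incr bdd_rv_mono[OF bdd_pot] bdd_decr_mono bdd_drift_mono; simp)+
    note int = b[THEN bdd_rv_integrable]
    have "P.expectation (\<lambda>w. c (Suc t) w * pot (Suc t) w)
        \<le> P.expectation (\<lambda>w. c (Suc t) w * (pot t w - decr t w + incr t w))"
      using Suc.prems by (intro expectation_pot_Suc_le bc c_nonneg) auto
    also have "\<dots> \<le> P.expectation (\<lambda>w. c t w * pot t w - d (Suc t) w * pot t w + drift_bound T * incr t w)"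
    proof (rule integral_mono_AE)
      show "AE w in P. c (Suc t) w * (pot t w - decr t w + incr t w)
          \<le> c t w * pot t w - d (Suc t) w * pot t w + drift_bound T * incr t w"
        using c_nonneg[OF Suc.prems]
      proof eventually_elim
        case (elim w)
        have "c (Suc t) w * (pot t w - decr t w + incr t w)
            = c (Suc t) w * pot t w - c (Suc t) w * decr t w + c (Suc t) w * incr t w"
          by (simp add: algebra_simps)
        also have "\<dots> \<le> c (Suc t) w * pot t w - 0 + drift_bound T * incr t w"
          using elim decr_nonneg incr_nonneg pot_nonneg c_le by (intro add_mono diff_mono mult_right_mono mult_nonneg_nonneg) auto
        \<comment> \<open>The budget spent in this step leaves exactly the summand to be
          bounded.\<close>
        also have "c (Suc t) w * pot t w = c t w * pot t w - d (Suc t) w * pot t w"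
          by (simp add: c_def algebra_simps)
        finally show ?case by simp
      qed
    qed (use int int_incr in auto)
    also have "\<dots> = P.expectation (\<lambda>w. c t w * pot t w) - P.expectation (\<lambda>w. d (Suc t) w * pot t w)
        + drift_bound T * P.expectation (incr t)"
      using int int_incr by simp
    finally show ?case
      using Suc by (simp add: distrib_left)
  qed
  from this[of T] have "P.expectation (\<lambda>w. c T w * pot T w) + (\<Sum>i<T. P.expectation (\<lambda>w. d (Suc i) w * pot i w))
      \<le> drift_bound T * (\<Sum>i<T. P.expectation (incr i))" by simp
  moreover have "0 \<le> P.expectation (\<lambda>w. c T w * pot T w)"
    using c_nonneg[of T] by (intro integral_nonneg_AE) (auto intro: mult_nonneg_nonneg pot_nonneg)
  ultimately show ?thesis by linarith
qed

section \<open>Second moment of the accumulated decrease\<close>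

lemma AE_norm_noise_le:
  assumes "Suc t \<le> T"
  shows "AE w in P. q (Suc t) w * (norm (noise t w (\<xi> (Suc t) w)))\<^sup>2 \<le> 4 * drift_bound T + 8 * G\<^sup>2"
proof -
  have "1 \<le> T" using assms by simp
  from AE_drift_sum_le[OF assms this] AE_sample_bounded AE_space
  show ?thesis
  proof eventually_elim
  case (elim w)
  define y where "y = \<xi> (Suc t) w"
  define c where "c = 1 - \<alpha> (Suc t) w"
  define Q where "Q = q (Suc t) w"
  define Y Z where "Y = X (Suc t) w" and "Z = X t w"
  have c: "0 \<le> c" "1 - c = 1 / Q\<^sup>2" and Q: "1 \<le> Q"
    using alpha_le_1[of F "s w" "x w" "Suc t"] weight_ge_1[of F "s w" "x w" "Suc t"]
    by (auto simp: c_def Q_def alpha_eq)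
  have y: "y \<in> space D" "norm (grad (F y) Y) \<le> G"
    using samples_in_space[of w "Suc t"] elim by (auto simp: y_def)
  define a where "a = norm (c *\<^sub>R ((grad (F y) Y - grad (F y) Z) - (grad f Y - grad f Z)))"
  define b where "b = norm ((1 - c) *\<^sub>R (grad (F y) Y - grad f Y))"
  \<comment> \<open>Sample and mean gradient differences are both Lipschitz, hence the factor 2.
    Unlike the estimate in the mean, this one holds almost surely; it will bound the square of the
    weighted noise linearly.\<close>
  have "a \<le> c * (2 * (L * norm (Y - Z)))"
    using norm_triangle_ineq4[of "grad (F y) Y - grad (F y) Z" "grad f Y - grad f Z"] lipschitz_F[OF y(1), of Y Z]
      grad_f_lipschitz[of Y Z] c by (auto simp: a_def intro!: mult_left_mono)
  then have "a\<^sup>2 \<le> (c * (2 * (L * norm (Y - Z))))\<^sup>2"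
    by (intro power_mono) (auto simp: a_def)
  then have a: "a\<^sup>2 \<le> 4 * (c\<^sup>2 * (L\<^sup>2 * (norm (Y - Z))\<^sup>2))"
    by (simp add: power_mult_distrib)
  have "norm (grad (F y) Y - grad f Y) \<le> 2 * G"
    using norm_triangle_ineq4[of "grad (F y) Y" "grad f Y"] y(2) grad_f_bounded[of Y] by linarith
  then have "(norm (grad (F y) Y - grad f Y))\<^sup>2 \<le> (2 * G)\<^sup>2"
    by (intro power_mono) auto
  then have b: "b\<^sup>2 \<le> (1 - c)\<^sup>2 * (4 * G\<^sup>2)"
    unfolding b_def norm_scaleR power_mult_distrib power2_abs by (intro mult_left_mono) auto
  have "noise t w y = c *\<^sub>R ((grad (F y) Y - grad (F y) Z) - (grad f Y - grad f Z)) + (1 - c) *\<^sub>R (grad (F y) Y - grad f Y)"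
    by (simp add: noise_def c_def Y_def Z_def algebra_simps)
  then have "(norm (noise t w y))\<^sup>2 \<le> (a + b)\<^sup>2"
    unfolding a_def b_def by (simp only:) (intro power_mono norm_triangle_ineq norm_ge_zero)
  also have "\<dots> \<le> 2 * a\<^sup>2 + 2 * b\<^sup>2"
    using zero_le_power2[of "a - b"] by (simp add: power2_diff power2_sum)
  also have "\<dots> \<le> 2 * (4 * (c\<^sup>2 * (L\<^sup>2 * (norm (Y - Z))\<^sup>2))) + 2 * ((1 - c)\<^sup>2 * (4 * G\<^sup>2))"
    using a b by simp
  finally have "Q * (norm (noise t w y))\<^sup>2 \<le> Q * (2 * (4 * (c\<^sup>2 * (L\<^sup>2 * (norm (Y - Z))\<^sup>2))) + 2 * ((1 - c)\<^sup>2 * (4 * G\<^sup>2)))"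
    using Q by (intro mult_left_mono) auto
  also have "\<dots> = 4 * d (Suc t) w + 8 * (G\<^sup>2 / Q^3)"
    using Q unfolding c(2)
    by (simp add: drift_def Q_def[symmetric] c_def[symmetric] Y_def[symmetric] Z_def[symmetric]
        field_simps power2_eq_square power3_eq_cube)
  also have "\<dots> \<le> 4 * drift_bound T + 8 * G\<^sup>2"
  proof -
    have "d (Suc t) w \<le> (\<Sum>i<Suc t. d (Suc i) w)"
      using drift_nonneg by (intro member_le_sum) auto
    moreover have "G\<^sup>2 / Q^3 \<le> G\<^sup>2 / 1"
      using Q one_le_power[OF Q, of 3] by (intro divide_left_mono) auto
    ultimately show ?thesis
      using elim(1) assms by auto
  qed
  finally show ?case by (simp add: Q_def y_def)
  qed
qed

text \<open>Potential plus what it has lost: its mean grows by at most that of \<open>incr\<close>,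
  and it dominates half of the weighted error sum. The second moment is taken of this quantity
  rather than of the potential.\<close>

definition total :: "nat \<Rightarrow> 'w \<Rightarrow> real"
  where "total t w = (\<Sum>i<t. decr i w) + pot t w"

lemma total_nonneg: "0 \<le> total t w"
  using decr_nonneg pot_nonneg by (simp add: total_def sum_nonneg)

lemma bdd_total: "bdd_rv t (total t)"
  unfolding total_def[abs_def] by (intro bdd_rv_intros bdd_decr_mono bdd_pot) auto

lemma expectation_total_le:
  assumes "1 \<le> T"
  shows "P.expectation (total T) \<le> incr_bound T"
proof -
  have "P.expectation (total T) = (\<Sum>i<T. P.expectation (decr i)) + P.expectation (pot T)"
    unfolding total_def[abs_def] by (simp add: int_decr int_pot)
  then show ?thesis
    using expectation_decr_sum_le[of T] expectation_incr_sum_le[OF assms] by linarith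
qed

text \<open>The coefficient of the weighted squared noise after expanding the square of
  \<open>total (Suc t)\<close>: 2 times the predictable part, which contains \<open>contr\<close>
  once, then 8 more on \<open>contr\<close> from the squared inner product, and twice the almost
  sure noise bound.\<close>

definition sq_factor :: "nat \<Rightarrow> nat \<Rightarrow> 'w \<Rightarrow> real"
  where "sq_factor T t w = 2 * (\<Sum>i<Suc t. decr i w) + 10 * contr t w + 2 * (4 * drift_bound T + 8 * G\<^sup>2)"

lemma drift_bound_nonneg: "0 \<le> drift_bound T"
proof -
  have "0 \<le> ln (exp 1 + real T)"
    by (intro ln_ge_zero) (simp add: add_increasing2)
  moreover have "0 \<le> kappa CARD('n) L \<theta> G * (1 + G\<^sup>2)"
    using kappa_lam_ge[of "CARD('n)" L \<theta> G] by (simp add: lam_def)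
  then have "0 \<le> ln (exp 1 + kappa CARD('n) L \<theta> G * (1 + G\<^sup>2))"
    by (intro ln_ge_zero) (simp add: add_increasing2)
  ultimately show ?thesis
    by (simp add: drift_bound_def C_J_def)
qed

lemma bdd_sq_factor: "bdd_rv t (sq_factor T t)"
  unfolding sq_factor_def[abs_def] by (intro bdd_rv_intros bdd_decr_mono bdd_contr) auto

lemma sq_factor_nonneg: "0 \<le> sq_factor T t w"
  using decr_nonneg contr_nonneg drift_bound_nonneg
  by (auto simp: sq_factor_def intro!: add_nonneg_nonneg sum_nonneg)

text \<open>The new total is \<open>B\<close>, known at time t and at most the old total, plus a
  centered term, plus the weighted squared noise \<open>N\<close>. All that is not centered is
  bounded linearly in \<open>N\<close> with predictable coefficient, so the conditional noise
  estimate applies with \<open>U = sq_factor\<close>.\<close>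

lemma expectation_total_sq_Suc_le:
  assumes T: "Suc t \<le> T"
  shows "P.expectation (\<lambda>w. (total (Suc t) w)\<^sup>2) \<le> P.expectation (\<lambda>w. (total t w)\<^sup>2)
    + P.expectation (\<lambda>w. sq_factor T t w * incr t w)"
proof -
  let ?in = "\<lambda>w. inner (E t w) (noise t w (\<xi> (Suc t) w))"
  let ?N = "\<lambda>w. q (Suc t) w * (norm (noise t w (\<xi> (Suc t) w)))\<^sup>2"
  define V where "V w = 2 * (q (Suc t) w * (1 - \<alpha> (Suc t) w))" for w
  define B where "B w = (\<Sum>i<Suc t. decr i w) + contr t w" for w
  have b: "bdd_rv t V" "bdd_rv t B"
    unfolding V_def[abs_def] B_def[abs_def]
    by (intro bdd_rv_intros bdd_weight bdd_alpha bdd_contr bdd_decr_mono; simp)+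
  have b2: "bdd_rv t (\<lambda>w. 2 * B w * V w)"
    by (intro bdd_rv_intros b)
  have int: "integrable P (\<lambda>w. (2 * B w * V w) * ?in w)" "integrable P (\<lambda>w. sq_factor T t w * ?N w)"
    "integrable P (\<lambda>w. (total t w)\<^sup>2)" "integrable P (\<lambda>w. (total (Suc t) w)\<^sup>2)"
    by (rule bdd_rv_integrable[of "Suc t"],
        intro bdd_rv_mult bdd_rv_power bdd_rv_mono[OF b2] bdd_rv_mono[OF bdd_sq_factor] bdd_rv_mono[OF bdd_weight]
          bdd_inner_noise bdd_norm_noise bdd_total bdd_rv_mono[OF bdd_total] le_SucI order_refl)+
  have "P.expectation (\<lambda>w. (total (Suc t) w)\<^sup>2)
      \<le> P.expectation (\<lambda>w. (total t w)\<^sup>2 + (2 * B w * V w) * ?in w + sq_factor T t w * ?N w)"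
  proof (rule integral_mono_AE)
    show "AE w in P. (total (Suc t) w)\<^sup>2 \<le> (total t w)\<^sup>2 + (2 * B w * V w) * ?in w + sq_factor T t w * ?N w"
      using AE_norm_noise_le[OF T]
    proof eventually_elim
      case (elim w)
      define N where "N = ?N w"
      define i where "i = ?in w"
      define W where "W = 4 * drift_bound T + 8 * G\<^sup>2"
      have N: "0 \<le> N" "N \<le> W"
        using elim weight_pos[of F "s w" "x w" "Suc t"] by (auto simp: N_def W_def)
      have B: "0 \<le> B w" "B w \<le> total t w"
        using contr_nonneg decr_nonneg contr_le[of t w] by (auto simp: B_def total_def intro!: add_nonneg_nonneg sum_nonneg)
      have tot: "total (Suc t) w = B w + (V w * i + N)"
        by (simp add: total_def pot_Suc B_def V_def i_def N_def)
      have "i\<^sup>2 \<le> (norm (E t w) * norm (noise t w (\<xi> (Suc t) w)))\<^sup>2"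
        unfolding i_def using Cauchy_Schwarz_ineq2[of "E t w"] by (rule power2_le_iff_abs_le[THEN iffD2, rotated]) auto
      then have "(V w)\<^sup>2 * i\<^sup>2 \<le> (V w)\<^sup>2 * (norm (E t w) * norm (noise t w (\<xi> (Suc t) w)))\<^sup>2"
        by (intro mult_left_mono) auto
      \<comment> \<open>After Cauchy-Schwarz, one factor q and \<open>(1 - \<alpha>)^2\<close> join
        \<open>|E|^2\<close> to form \<open>contr\<close>, and the other q joins the noise to form
        \<open>N\<close>.\<close>
      also have "\<dots> = 4 * contr t w * N"
        by (simp add: V_def contr_def N_def power_mult_distrib power2_eq_square mult_ac)
      finally have Vi: "(V w * i)\<^sup>2 \<le> 4 * contr t w * N"
        by (simp add: power_mult_distrib)
      have NN: "N\<^sup>2 \<le> W * N"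
        using N by (simp add: power2_eq_square mult_right_mono)
      have "(V w * i + N)\<^sup>2 \<le> 2 * (V w * i)\<^sup>2 + 2 * N\<^sup>2"
        using zero_le_power2[of "V w * i - N"] by (simp add: power2_diff power2_sum)
      also have "\<dots> \<le> 2 * (4 * contr t w * N) + 2 * (W * N)"
        using Vi NN by (intro add_mono mult_left_mono) auto
      finally have sq: "(V w * i + N)\<^sup>2 \<le> 2 * (4 * contr t w * N) + 2 * (W * N)" .
      have "(B w)\<^sup>2 \<le> (total t w)\<^sup>2"
        using B by (intro power_mono)
      then have "(total (Suc t) w)\<^sup>2 \<le> (total t w)\<^sup>2 + 2 * B w * (V w * i + N) + (2 * (4 * contr t w * N) + 2 * (W * N))"
        unfolding tot power2_sum[of "B w"] using sq by linarith
      also have "\<dots> = (total t w)\<^sup>2 + (2 * B w * V w) * i + sq_factor T t w * N"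
        by (simp add: sq_factor_def B_def W_def algebra_simps)
      finally show ?case by (simp add: N_def i_def)
    qed
  qed (use int in auto)
  also have "\<dots> = P.expectation (\<lambda>w. (total t w)\<^sup>2) + P.expectation (\<lambda>w. sq_factor T t w * ?N w)"
    using int expectation_inner_noise[OF b2] by simp
  also have "P.expectation (\<lambda>w. sq_factor T t w * ?N w) \<le> P.expectation (\<lambda>w. sq_factor T t w * incr t w)"
    by (intro expectation_norm_noise_le bdd_sq_factor) (simp add: sq_factor_nonneg)
  finally show ?thesis by simp
qed

text \<open>No pathwise bound of logarithmic size is at hand for \<open>contr\<close>. Its product
  with the drift is left to the budget argument; its product with the gradient part is at most
  \<open>2 G^2 |E|^2 / q\<close>, a multiple of \<open>decr\<close>.\<close>

lemma AE_contr_incr_le: "AE w in P. contr t w * incr t w \<le> d (Suc t) w * pot t w + 3 * G\<^sup>2 * decr t w"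
  using AE_sample_bounded
proof eventually_elim
  case (elim w)
  define Q where "Q = q (Suc t) w"
  define c where "c = 1 - \<alpha> (Suc t) w"
  define e where "e = (norm (E t w))\<^sup>2"
  have Q: "1 \<le> Q" by (simp add: Q_def weight_ge_1)
  have e: "0 \<le> e" by (simp add: e_def)
  have "c\<^sup>2 \<le> 1"
    using alpha_pos[of F "s w" "x w" "Suc t"] alpha_le_1[of F "s w" "x w" "Suc t"]
    by (auto simp: c_def abs_square_le_1)
  then have contr: "contr t w \<le> Q * e"
    using Q e mult_left_mono[of "c\<^sup>2" 1 "Q * e"] by (simp add: contr_def Q_def c_def e_def mult_ac)
  have g: "(norm (g (Suc t) w))\<^sup>2 \<le> G\<^sup>2"
    using elim by (intro power_mono) (auto simp: stoch_grad_def)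
  have "contr t w * (2 * (norm (g (Suc t) w))\<^sup>2 * (1 / Q)^3) \<le> (Q * e) * (2 * G\<^sup>2 * (1 / Q)^3)"
    using contr g Q e by (intro mult_mono mult_right_mono) auto
  also have "\<dots> = 2 * G\<^sup>2 * (e * (1 / Q)) * (1 / Q)"
    using Q by (simp add: power3_eq_cube)
  also have "\<dots> \<le> 2 * G\<^sup>2 * (e * (1 / Q)) * 1"
    using Q e by (intro mult_left_mono) auto
  also have "\<dots> = 3 * G\<^sup>2 * decr t w"
    by (simp add: decr_def Q_def e_def)
  finally have 1: "contr t w * (2 * (norm (g (Suc t) w))\<^sup>2 * (1 / Q)^3) \<le> 3 * G\<^sup>2 * decr t w" .
  have "contr t w \<le> pot t w"
    using contr_le[of t w] decr_nonneg[of t w] by linarith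
  then have "contr t w * d (Suc t) w \<le> pot t w * d (Suc t) w"
    using drift_nonneg by (intro mult_right_mono) auto
  then show ?case
    using 1 by (simp add: incr_def Q_def distrib_left mult_ac)
qed

text \<open>Since the increments sum to at most \<open>K\<close> on almost every path, the
  accumulated decrease times this sum has mean at most \<open>K\<close> times the mean of
  \<open>total\<close>. The coefficients are 18 = 10 + 2 * 4 and 46 = 30 + 2 * 8, from
  \<open>10 * contr\<close> and the noise bound \<open>W\<close>.\<close>

lemma expectation_total_sq_le:
  assumes T: "1 \<le> T"
  shows "P.expectation (\<lambda>w. (total T w)\<^sup>2) \<le>
    2 * (incr_bound T)\<^sup>2 + 18 * drift_bound T * incr_bound T + 46 * G\<^sup>2 * incr_bound T"
proof -
  define K where "K = incr_bound T"
  define W where "W = 4 * drift_bound T + 8 * G\<^sup>2"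
  have W: "0 \<le> W" using drift_bound_nonneg by (simp add: W_def)
  have bsi: "bdd_rv (Suc t) (\<lambda>w. sq_factor T t w * incr t w)" for t
    by (intro bdd_rv_mult bdd_rv_mono[OF bdd_sq_factor] bdd_incr) simp
  note isi = bdd_rv_integrable[OF bsi]
  have idp: "integrable P (\<lambda>w. d (Suc t) w * pot t w)" for t
    by (rule bdd_rv_integrable[OF bdd_drift_pot])
  have itot: "integrable P (total T)"
    by (rule bdd_rv_integrable[OF bdd_total])
  have "P.expectation (\<lambda>w. (total t w)\<^sup>2) \<le> (\<Sum>i<t. P.expectation (\<lambda>w. sq_factor T i w * incr i w))" if "t \<le> T" for t
    using that
  proof (induction t)
    case 0
    then show ?case by (simp add: total_def pot_0)
  next
    case (Suc t)
    then show ?case using expectation_total_sq_Suc_le[of t T] by simp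
  qed
  from this[of T] have "P.expectation (\<lambda>w. (total T w)\<^sup>2) \<le> P.expectation (\<lambda>w. \<Sum>i<T. sq_factor T i w * incr i w)"
    using isi by simp
  also have "\<dots> \<le> P.expectation (\<lambda>w. (2 * K + 30 * G\<^sup>2) * total T w + 10 * (\<Sum>i<T. d (Suc i) w * pot i w) + 2 * W * K)"
  proof (rule integral_mono_AE)
    have "AE w in P. \<forall>t. contr t w * incr t w \<le> d (Suc t) w * pot t w + 3 * G\<^sup>2 * decr t w"
      unfolding AE_all_countable using AE_contr_incr_le by blast
    with AE_incr_sum_le[OF T]
    show "AE w in P. (\<Sum>i<T. sq_factor T i w * incr i w)
        \<le> (2 * K + 30 * G\<^sup>2) * total T w + 10 * (\<Sum>i<T. d (Suc i) w * pot i w) + 2 * W * K"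
    proof eventually_elim
      case (elim w)
      define A where "A = (\<Sum>i<T. decr i w)"
      have A: "0 \<le> A" "A \<le> total T w"
        using decr_nonneg pot_nonneg by (auto simp: A_def total_def sum_nonneg)
      have K: "0 \<le> (\<Sum>i<T. incr i w)" "(\<Sum>i<T. incr i w) \<le> K"
        using elim incr_nonneg by (auto simp: K_def sum_nonneg)
      have "(\<Sum>i<T. sq_factor T i w * incr i w)
          \<le> (\<Sum>i<T. 2 * A * incr i w + 10 * (d (Suc i) w * pot i w + 3 * G\<^sup>2 * decr i w) + 2 * W * incr i w)"
      proof (rule sum_mono)
        fix i assume "i \<in> {..<T}"
        then have "(\<Sum>j<Suc i. decr j w) \<le> A"
          unfolding A_def using decr_nonneg by (intro sum_mono2) auto
        then have "(\<Sum>j<Suc i. decr j w) * incr i w \<le> A * incr i w"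
          using incr_nonneg by (intro mult_right_mono) auto
        moreover have "contr i w * incr i w \<le> d (Suc i) w * pot i w + 3 * G\<^sup>2 * decr i w"
          using elim by blast
        moreover have "sq_factor T i w * incr i w = 2 * ((\<Sum>j<Suc i. decr j w) * incr i w)
            + 10 * (contr i w * incr i w) + 2 * W * incr i w"
          unfolding sq_factor_def W_def[symmetric] by (simp only: distrib_right mult.assoc)
        ultimately have "sq_factor T i w * incr i w
            \<le> 2 * (A * incr i w) + 10 * (d (Suc i) w * pot i w + 3 * G\<^sup>2 * decr i w) + 2 * W * incr i w"
          by (simp only:) (intro add_mono mult_left_mono order_refl; simp)
        then show "sq_factor T i w * incr i w
            \<le> 2 * A * incr i w + 10 * (d (Suc i) w * pot i w + 3 * G\<^sup>2 * decr i w) + 2 * W * incr i w"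
          by (simp only: mult.assoc)
      qed
      also have "\<dots> = (2 * A + 2 * W) * (\<Sum>i<T. incr i w) + 30 * G\<^sup>2 * A + 10 * (\<Sum>i<T. d (Suc i) w * pot i w)"
        by (simp add: A_def sum.distrib sum_distrib_left[symmetric] distrib_left distrib_right)
      also have "\<dots> \<le> (2 * A + 2 * W) * K + 30 * G\<^sup>2 * A + 10 * (\<Sum>i<T. d (Suc i) w * pot i w)"
        using K A W by (intro add_right_mono mult_left_mono) auto
      also have "\<dots> = (2 * K + 30 * G\<^sup>2) * A + 10 * (\<Sum>i<T. d (Suc i) w * pot i w) + 2 * W * K"
        by (simp add: algebra_simps)
      also have "\<dots> \<le> (2 * K + 30 * G\<^sup>2) * total T w + 10 * (\<Sum>i<T. d (Suc i) w * pot i w) + 2 * W * K"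
        using K A by (intro add_right_mono mult_left_mono) auto
      finally show ?case .
    qed
  qed (use isi idp itot in auto)
  also have "\<dots> = (2 * K + 30 * G\<^sup>2) * P.expectation (total T)
      + 10 * (\<Sum>i<T. P.expectation (\<lambda>w. d (Suc i) w * pot i w)) + 2 * W * K"
    using idp itot by (simp add: P.prob_space)
  also have "\<dots> \<le> (2 * K + 30 * G\<^sup>2) * K + 10 * (drift_bound T * K) + 2 * W * K"
  proof -
    have "0 \<le> P.expectation (total T)"
      by (intro integral_nonneg_AE) (simp add: total_nonneg)
    then have "0 \<le> K"
      using expectation_total_le[OF T] by (simp add: K_def)
    moreover have "(\<Sum>i<T. P.expectation (\<lambda>w. d (Suc i) w * pot i w)) \<le> drift_bound T * K"
      using expectation_drift_pot_sum_le[OF T] mult_left_mono[OF expectation_incr_sum_le[OF T] drift_bound_nonneg[of T]]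
      by (simp add: K_def)
    ultimately show ?thesis
      using expectation_total_le[OF T] W by (intro add_mono mult_left_mono) (auto simp: K_def)
  qed
  also have "\<dots> = 2 * K\<^sup>2 + 18 * drift_bound T * K + 46 * G\<^sup>2 * K"
    by (simp add: W_def power2_eq_square algebra_simps)
  finally show ?thesis by (simp add: K_def)
qed

section \<open>Moments of the weighted error sum in terms of the named constants\<close>

definition err_sum :: "nat \<Rightarrow> 'w \<Rightarrow> real"
  where "err_sum T w = (\<Sum>t=1..T. (norm (E t w))\<^sup>2 / q t w)"

lemma err_sum_nonneg: "0 \<le> err_sum T w"
  using weight_pos[of F "s w" "x w"] by (auto simp: err_sum_def intro!: sum_nonneg divide_nonneg_pos)

text \<open>\<open>decr\<close> carries the weight of the next index, which costs 4/3, and its own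
  2/3 makes the factor 2. The summand at T has no counterpart in the accumulated decrease and is
  paid by \<open>pot T\<close>.\<close>

lemma err_sum_le: "1 \<le> T \<Longrightarrow> err_sum T w \<le> 2 * total T w"
proof -
  assume T: "1 \<le> T"
  have decr: "(norm (E t w))\<^sup>2 / q t w \<le> 2 * decr t w" for t
  proof -
    have "1 / q t w \<le> 4/3 * (1 / q (Suc t) w)"
      using weight_Suc_le[of F "s w" "x w" t] weight_pos[of F "s w" "x w" t] weight_pos[of F "s w" "x w" "Suc t"]
      by (simp add: field_simps)
    from mult_left_mono[OF this, of "(norm (E t w))\<^sup>2"] show ?thesis
      by (simp add: decr_def)
  qed
  have "(norm (E T w))\<^sup>2 * (1 / q T w) \<le> (norm (E T w))\<^sup>2 * q T w"
    using weight_ge_1[of F "s w" "x w" T] mult_mono[OF weight_ge_1[of F "s w" "x w" T] weight_ge_1[of F "s w" "x w" T]]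
    by (intro mult_left_mono) (auto simp: divide_le_eq)
  then have last: "(norm (E T w))\<^sup>2 / q T w \<le> 2 * pot T w"
    using pot_nonneg[of T w] by (simp add: pot_def mult_ac)
  have "{1..T} = insert T {1..<T}" using T by auto
  then have "err_sum T w = (norm (E T w))\<^sup>2 / q T w + (\<Sum>t\<in>{1..<T}. (norm (E t w))\<^sup>2 / q t w)"
    by (simp add: err_sum_def)
  also have "\<dots> \<le> 2 * pot T w + (\<Sum>t\<in>{1..<T}. 2 * decr t w)"
    using last decr by (intro add_mono sum_mono) auto
  also have "\<dots> \<le> 2 * pot T w + (\<Sum>t<T. 2 * decr t w)"
    using decr_nonneg by (intro add_left_mono sum_mono2) auto
  finally show ?thesis
    by (simp add: total_def sum_distrib_left)
qed

lemma bdd_err_sum: "bdd_rv T (err_sum T)"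
proof -
  have "bdd_rv T (\<lambda>w. (norm (E t w))\<^sup>2 * (1 / q t w))" if t: "t \<in> {1..T}" for t
  proof -
    obtain u where u: "t = Suc u" using t by (cases t) auto
    show ?thesis
      unfolding u using t u by (intro bdd_rv_mult bdd_rv_mono[OF bdd_err] bdd_rv_mono[OF bdd_inverse_weight]) auto
  qed
  then show ?thesis
    unfolding err_sum_def[abs_def] using bdd_rv_sum[of "{1..T}" T "\<lambda>t w. (norm (E t w))\<^sup>2 * (1 / q t w)"] by simp
qed

lemma Lam_ge_1: "1 \<le> ln (exp 1 + real T)"
  by (subst ln_ge_iff) (auto simp: add_pos_nonneg)

lemma expectation_err_sum_le:
  assumes T: "1 \<le> T"
  shows "P.expectation (err_sum T) \<le> C_c CARD('n) L \<theta> G * ln (exp 1 + real T)"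
proof -
  define \<Lambda> where "\<Lambda> = ln (exp 1 + real T)"
  define l where "l = ln (exp 1 + kappa CARD('n) L \<theta> G * (1 + G\<^sup>2))"
  define \<delta> where "\<delta> = real CARD('n) * L\<^sup>2 * \<theta>\<^sup>2"
  have pos: "0 \<le> \<Lambda>" "0 \<le> \<delta>"
    using Lam_ge_1[of T] by (auto simp: \<Lambda>_def \<delta>_def)
  have kap: "24 \<le> kappa CARD('n) L \<theta> G"
    by (simp add: kappa_def)
  have "1 * G\<^sup>2 \<le> kappa CARD('n) L \<theta> G * G\<^sup>2"
    using kap by (intro mult_right_mono) auto
  then have "G\<^sup>2 \<le> kappa CARD('n) L \<theta> G * (1 + G\<^sup>2)"
    using kap unfolding distrib_left by linarith
  then have l: "ln (exp 1 + G\<^sup>2) \<le> l"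
    unfolding l_def by (subst ln_le_cancel_iff) (auto simp: add_pos_nonneg intro!: add_pos_nonneg order_trans[OF zero_le_power2])
  have l0: "0 \<le> l"
    by (rule order_trans[OF ln_ge_zero l]) (simp add: add_increasing2)
  have "P.expectation (err_sum T) \<le> P.expectation (\<lambda>w. 2 * total T w)"
    using err_sum_le[OF T] by (intro integral_mono bdd_rv_integrable[OF bdd_err_sum] integrable_mult_right bdd_rv_integrable[OF bdd_total])
  also have "\<dots> \<le> 2 * incr_bound T"
    using expectation_total_le[OF T] by simp
  also have "\<dots> = (32/3 * (\<delta> * l) + 8 * ((1 + G\<^sup>2)\<^sup>2 * ln (exp 1 + G\<^sup>2))) * \<Lambda>"
    by (simp add: incr_bound_def drift_bound_def C_J_def C_I_def \<Lambda>_def \<delta>_def l_def algebra_simps)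
  also have "\<dots> \<le> (12 * (G\<^sup>2 + (64 * (1 + G\<^sup>2)\<^sup>2 + 64 * \<delta>) * l)) * \<Lambda>"
  proof (rule mult_right_mono[OF _ pos(1)])
    have "(1 + G\<^sup>2)\<^sup>2 * ln (exp 1 + G\<^sup>2) \<le> (1 + G\<^sup>2)\<^sup>2 * l"
      using l by (intro mult_left_mono) auto
    moreover have "0 \<le> \<delta> * l" "0 \<le> (1 + G\<^sup>2)\<^sup>2 * l"
      using pos l0 by auto
    ultimately have "32/3 * (\<delta> * l) + 8 * ((1 + G\<^sup>2)\<^sup>2 * ln (exp 1 + G\<^sup>2)) \<le> 768 * (\<delta> * l) + 768 * ((1 + G\<^sup>2)\<^sup>2 * l)"
      by linarith
    also have "\<dots> \<le> 12 * (G\<^sup>2 + (64 * (1 + G\<^sup>2)\<^sup>2 + 64 * \<delta>) * l)"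
      by (simp add: algebra_simps)
    finally show "32/3 * (\<delta> * l) + 8 * ((1 + G\<^sup>2)\<^sup>2 * ln (exp 1 + G\<^sup>2)) \<le> 12 * (G\<^sup>2 + (64 * (1 + G\<^sup>2)\<^sup>2 + 64 * \<delta>) * l)" .
  qed
  also have "\<dots> = C_c CARD('n) L \<theta> G * \<Lambda>"
    by (simp add: C_c_def C_b_def \<delta>_def l_def distrib_left mult.assoc add.assoc)
  finally show ?thesis by (simp add: \<Lambda>_def)
qed

lemma expectation_err_sum_sq_le:
  assumes T: "1 \<le> T"
  shows "P.expectation (\<lambda>w. (err_sum T w)\<^sup>2) \<le> C_u CARD('n) L \<theta> G * (ln (exp 1 + real T))\<^sup>2"
proof -
  define \<Lambda> where "\<Lambda> = ln (exp 1 + real T)"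
  define i j where "i = C_I G * \<Lambda>" and "j = C_J CARD('n) L \<theta> G * \<Lambda>"
  have \<Lambda>: "1 \<le> \<Lambda>" using Lam_ge_1 by (simp add: \<Lambda>_def)
  have j: "0 \<le> j" using drift_bound_nonneg[of T] by (simp add: drift_bound_def j_def \<Lambda>_def)
  have "1 \<le> ln (exp 1 + G\<^sup>2)"
    by (subst ln_ge_iff) (auto simp: add_pos_nonneg)
  moreover have "G\<^sup>2 \<le> (1 + G\<^sup>2)\<^sup>2"
    by (simp add: power2_sum add_increasing)
  ultimately have "90 * G\<^sup>2 * 1 * 1 \<le> 90 * (1 + G\<^sup>2)\<^sup>2 * ln (exp 1 + G\<^sup>2) * \<Lambda>"
    using \<Lambda> by (intro mult_mono) auto
  then have G: "90 * G\<^sup>2 \<le> i"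
    by (simp add: i_def C_I_def)
  then have i: "0 \<le> i"
    by (rule order_trans[rotated]) simp
  have K: "incr_bound T = j / 12 + 2/45 * i" "drift_bound T = j / 12"
    by (simp_all add: incr_bound_def drift_bound_def i_def j_def \<Lambda>_def)
  define r where "r = i + j"
  have r: "0 \<le> r" "incr_bound T \<le> r / 12" "drift_bound T \<le> r / 12" "G\<^sup>2 \<le> r / 90" "0 \<le> incr_bound T"
    using i j G by (auto simp: r_def K)
  have p: "incr_bound T * incr_bound T \<le> (r / 12) * (r / 12)" "drift_bound T * incr_bound T \<le> (r / 12) * (r / 12)"
    "G\<^sup>2 * incr_bound T \<le> (r / 90) * (r / 12)"
    using r by (intro mult_mono; simp)+
  have sq: "(err_sum T w)\<^sup>2 \<le> 4 * (total T w)\<^sup>2" for w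
    using power_mono[OF err_sum_le[OF T, of w] err_sum_nonneg, of 2] by (simp add: power_mult_distrib)
  have "P.expectation (\<lambda>w. (err_sum T w)\<^sup>2) \<le> P.expectation (\<lambda>w. 4 * (total T w)\<^sup>2)"
    using sq by (intro integral_mono bdd_rv_integrable[of T] bdd_rv_intros bdd_err_sum bdd_total)
  also have "\<dots> \<le> 4 * (2 * (incr_bound T)\<^sup>2 + 18 * drift_bound T * incr_bound T + 46 * G\<^sup>2 * incr_bound T)"
    using expectation_total_sq_le[OF T] by simp
  \<comment> \<open>By the three products above, the total factor is
    \<open>4 * (20/144 + 46/1080) < 1\<close>.\<close>
  also have "\<dots> \<le> r * r"
    using p by (simp add: power2_eq_square mult.assoc) (use mult_nonneg_nonneg[OF r(1) r(1)] in linarith)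
  also have "\<dots> \<le> 2 * (i\<^sup>2 + j\<^sup>2)"
    using zero_le_power2[of "i - j"] by (simp add: r_def power2_eq_square algebra_simps)
  also have "\<dots> \<le> 288 * (i\<^sup>2 + j\<^sup>2)"
    by simp
  also have "\<dots> = 288 * ((C_I G)\<^sup>2 + (C_J CARD('n) L \<theta> G)\<^sup>2) * \<Lambda>\<^sup>2"
    by (simp add: i_def j_def power_mult_distrib algebra_simps)
  also have "\<dots> \<le> C_u CARD('n) L \<theta> G * \<Lambda>\<^sup>2"
  proof (rule mult_right_mono)
    have "0 \<le> C_w_tilde CARD('n) L \<theta> G"
    proof -
      have k: "0 \<le> kappa CARD('n) L \<theta> G" by (simp add: kappa_def)
      have l: "0 \<le> ln (exp 1 + y)" if "0 \<le> y" for y :: real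
        using that by (intro ln_ge_zero) (simp add: add_increasing2)
      have "0 \<le> C_b CARD('n) L \<theta> G"
        using l[of "kappa CARD('n) L \<theta> G + kappa CARD('n) L \<theta> G * G\<^sup>2"] k by (simp add: C_b_def add.assoc)
      then have "0 \<le> C_c CARD('n) L \<theta> G" by (simp add: C_c_def)
      moreover have "0 \<le> C_R CARD('n) L \<theta> G" "0 \<le> C_J CARD('n) L \<theta> G" "0 \<le> C_I G"
        using l k by (simp_all add: C_R_def C_J_def C_I_def varpi_def)
      ultimately show ?thesis
        unfolding C_w_tilde_def by (intro add_nonneg_nonneg mult_nonneg_nonneg delta_nonneg) (auto simp: varpi_def)
    qed
    then have "0 \<le> C_K CARD('n) L \<theta> G" by (simp add: C_K_def)
    then show "288 * ((C_I G)\<^sup>2 + (C_J CARD('n) L \<theta> G)\<^sup>2) \<le> C_u CARD('n) L \<theta> G"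
      by (simp add: C_u_def)
  qed simp
  finally show ?thesis by (simp add: \<Lambda>_def)
qed

end

section \<open>The convergence rate\<close>

text \<open>Concavity in polynomial form: with \<open>x = p^3\<close> and \<open>c = r^3\<close> it
  is \<open>(p - r)^2 (p + 2 r) \<ge> 0\<close>. Being linear in x, it does the work of Jensen's
  inequality.\<close>

lemma cube_root_tangent:
  fixes x c :: real
  assumes "0 \<le> x" "0 < c"
  shows "x powr (1/3) \<le> c powr (1/3) + (x - c) / (3 * (c powr (1/3))\<^sup>2)"
proof -
  define p r where "p = x powr (1/3)" and "r = c powr (1/3)"
  have p: "0 \<le> p" and r: "0 < r" using assms by (auto simp: p_def r_def)
  have x: "x = p^3"
  proof (cases "x = 0")
    case False
    then show ?thesis using assms by (simp add: p_def powr_power)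
  qed (simp add: p_def)
  have c: "c = r^3"
    using assms by (simp add: r_def powr_power)
  have "0 \<le> (p - r)\<^sup>2 * (p + 2 * r)"
    using p r by simp
  then have "3 * p * r\<^sup>2 \<le> p^3 + 2 * r^3"
    by (simp add: power2_eq_square power3_eq_cube algebra_simps)
  then have "p * (3 * r\<^sup>2) \<le> r * (3 * r\<^sup>2) + (p^3 - r^3)"
    by (simp add: power2_eq_square power3_eq_cube algebra_simps)
  then have "p \<le> r + (p^3 - r^3) / (3 * r\<^sup>2)"
    using r by (simp add: field_simps)
  then show ?thesis
    unfolding p_def[symmetric] r_def[symmetric] x[symmetric] c[symmetric] .
qed

lemma rate_arith:
  fixes z \<Lambda> \<sigma> T :: real
  assumes z: "1 \<le> z" and \<Lambda>: "1 \<le> \<Lambda>" and \<sigma>: "0 \<le> \<sigma>" and T: "1 \<le> T"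
  shows "z * \<Lambda> * sqrt ((1 + \<sigma>\<^sup>2 * T) powr (1/3) + z * \<Lambda>) / sqrt T
    \<le> 4 * z\<^sup>2 * (\<Lambda> powr (3/2) / T powr (1/2)) + 2 * z * (\<sigma> powr (1/3) * \<Lambda> / T powr (1/3))"
proof -
  \<comment> \<open>Chosen so that \<open>w^6 = \<sigma>^2 T\<close>, whereupon
    \<open>1 + w^6 \<le> (1 + w^2)^3\<close> removes the cube root, and so that
    \<open>w / sqrt T\<close> is the rate of the second summand.\<close>
  define w where "w = \<sigma> powr (1/3) * T powr (1/6)"
  have w: "0 \<le> w" by (simp add: w_def)
  have "w^6 = \<sigma>\<^sup>2 * T"
    using \<sigma> T by (cases "\<sigma> = 0") (simp_all add: w_def power_mult_distrib powr_power)
  then have "1 + \<sigma>\<^sup>2 * T \<le> (1 + w\<^sup>2)^3"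
    using w by (simp add: power3_eq_cube power2_eq_square algebra_simps power_numeral_reduce)
  then have "(1 + \<sigma>\<^sup>2 * T) powr (1/3) \<le> ((1 + w\<^sup>2)^3) powr (1/3)"
    using \<sigma> T by (intro powr_mono2) (auto simp: add_nonneg_nonneg)
  also have "\<dots> = 1 + w\<^sup>2"
  proof -
    have "0 < 1 + w\<^sup>2" by (simp add: add_pos_nonneg)
    then have "(1 + w\<^sup>2)^3 = (1 + w\<^sup>2) powr 3" by simp
    then show ?thesis using \<open>0 < 1 + w\<^sup>2\<close> by (simp only: powr_powr) simp
  qed
  finally have r: "(1 + \<sigma>\<^sup>2 * T) powr (1/3) \<le> 1 + w\<^sup>2" .
  have zl: "1 \<le> z * \<Lambda>" using mult_mono[OF z \<Lambda>] z by simp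
  have "sqrt ((1 + \<sigma>\<^sup>2 * T) powr (1/3) + z * \<Lambda>) \<le> sqrt ((1 + w + sqrt (z * \<Lambda>))\<^sup>2)"
  proof (rule real_sqrt_le_mono)
    have "0 \<le> 2 * w + 2 * sqrt (z * \<Lambda>) + 2 * w * sqrt (z * \<Lambda>)"
      using w zl by (intro add_nonneg_nonneg mult_nonneg_nonneg) auto
    moreover have "(1 + w + sqrt (z * \<Lambda>))\<^sup>2 = 1 + w\<^sup>2 + z * \<Lambda> + (2 * w + 2 * sqrt (z * \<Lambda>) + 2 * w * sqrt (z * \<Lambda>))"
      using zl by (simp add: power2_sum algebra_simps)
    ultimately show "(1 + \<sigma>\<^sup>2 * T) powr (1/3) + z * \<Lambda> \<le> (1 + w + sqrt (z * \<Lambda>))\<^sup>2"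
      using r by linarith
  qed
  also have "\<dots> = 1 + w + sqrt (z * \<Lambda>)"
    using w zl by (intro real_sqrt_unique) (auto intro!: add_nonneg_nonneg)
  finally have root: "sqrt ((1 + \<sigma>\<^sup>2 * T) powr (1/3) + z * \<Lambda>) \<le> 1 + w + sqrt (z * \<Lambda>)" .
  have \<Lambda>32: "\<Lambda> powr (3/2) = \<Lambda> * sqrt \<Lambda>"
  proof -
    have "\<Lambda> powr (3/2) = \<Lambda> powr (1 + 1/2)" by simp
    also have "\<dots> = \<Lambda> * sqrt \<Lambda>" using \<Lambda> by (simp only: powr_add powr_half_sqrt) simp
    finally show ?thesis .
  qed
  have "z * \<Lambda> * (1 + w + sqrt (z * \<Lambda>)) = z * \<Lambda> + z * \<Lambda> * w + (z * sqrt z) * (\<Lambda> * sqrt \<Lambda>)"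
    by (simp add: real_sqrt_mult algebra_simps)
  also have "\<dots> \<le> z\<^sup>2 * (\<Lambda> * sqrt \<Lambda>) + z * \<Lambda> * w + z\<^sup>2 * (\<Lambda> * sqrt \<Lambda>)"
  proof -
    have "z * 1 \<le> z * z" using z by (intro mult_left_mono) auto
    moreover have "\<Lambda> * 1 \<le> \<Lambda> * sqrt \<Lambda>" using \<Lambda> by (intro mult_left_mono) auto
    moreover have "z * sqrt z \<le> z * z"
    proof (rule mult_left_mono)
      have "z * 1 \<le> z * z" using z by (intro mult_left_mono) auto
      then show "sqrt z \<le> z" using z by (intro real_le_lsqrt) (auto simp: power2_eq_square)
    qed (use z in simp)
    ultimately show ?thesis
      unfolding power2_eq_square using z \<Lambda> by (intro add_mono mult_mono order_refl) auto
  qed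
  finally have num: "z * \<Lambda> * (1 + w + sqrt (z * \<Lambda>)) \<le> 2 * (z\<^sup>2 * (\<Lambda> * sqrt \<Lambda>)) + z * \<Lambda> * w"
    by (simp add: mult_ac)
  have wT: "w / sqrt T = \<sigma> powr (1/3) / T powr (1/3)"
  proof -
    have "T powr (1/6) / T powr (1/2) = 1 / T powr (1/3)"
      using T by (simp flip: powr_diff powr_minus_divide)
    moreover have "w / sqrt T = \<sigma> powr (1/3) * (T powr (1/6) / T powr (1/2))"
      using T by (simp add: w_def powr_half_sqrt)
    ultimately show ?thesis by simp
  qed
  have "z * \<Lambda> * sqrt ((1 + \<sigma>\<^sup>2 * T) powr (1/3) + z * \<Lambda>) / sqrt T \<le> (2 * (z\<^sup>2 * (\<Lambda> * sqrt \<Lambda>)) + z * \<Lambda> * w) / sqrt T"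
    using order_trans[OF mult_left_mono[OF root, of "z * \<Lambda>"] num] zl T by (intro divide_right_mono) auto
  also have "\<dots> = 2 * (z\<^sup>2 * ((\<Lambda> * sqrt \<Lambda>) / sqrt T)) + z * \<Lambda> * (w / sqrt T)"
    by (simp add: add_divide_distrib)
  also have "\<dots> = 2 * (z\<^sup>2 * (\<Lambda> powr (3/2) / T powr (1/2))) + z * (\<sigma> powr (1/3) * \<Lambda> / T powr (1/3))"
    unfolding wT \<Lambda>32 using T by (simp add: powr_half_sqrt mult_ac)
  also have "\<dots> \<le> 4 * z\<^sup>2 * (\<Lambda> powr (3/2) / T powr (1/2)) + 2 * z * (\<sigma> powr (1/3) * \<Lambda> / T powr (1/3))"
  proof -
    have "0 \<le> z\<^sup>2 * (\<Lambda> powr (3/2) / T powr (1/2))" "0 \<le> z * (\<sigma> powr (1/3) * \<Lambda> / T powr (1/3))"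
      using z \<Lambda> by (intro mult_nonneg_nonneg divide_nonneg_nonneg; simp)+
    moreover have "2 * a + b \<le> 4 * a + 2 * b" if "0 \<le> a" "0 \<le> b" for a b :: real
      using that by simp
    ultimately show ?thesis by (simp only: mult.assoc)
  qed
  finally show ?thesis .
qed

lemma power2_sum3_le:
  fixes a b c :: real
  shows "(a + b + c)\<^sup>2 \<le> 3 * (a\<^sup>2 + b\<^sup>2 + c\<^sup>2)"
proof -
  have "0 \<le> (a - b)\<^sup>2 + (b - c)\<^sup>2 + (a - c)\<^sup>2" by simp
  also have "\<dots> = 3 * (a\<^sup>2 + b\<^sup>2 + c\<^sup>2) - (a + b + c)\<^sup>2"
    by (simp add: power2_eq_square algebra_simps)
  finally show ?thesis by simp
qed

context optmuon_process
begin

abbreviation "F1 \<equiv> f X1 - fstar"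

lemma F1_nonneg: "0 \<le> F1"
  using lower_bound[of X1] by simp

text \<open>\<open>momentum_bound\<close> as a random variable defined on every outcome; the path
  locale is available only almost everywhere.\<close>

definition mbound :: "nat \<Rightarrow> 'w \<Rightarrow> real"
  where "mbound T w = 1 / c_0 \<theta> * (F1 + c_1 CARD('n) \<theta> * err_sum T w
    + c_2 CARD('n) L \<theta> * (C_d CARD('n) L \<theta> G * ln (exp 1 + real T)))"

lemma constants_nonneg: "0 < c_0 \<theta>" "0 \<le> c_1 CARD('n) \<theta>" "0 \<le> c_2 CARD('n) L \<theta>" "0 \<le> C_d CARD('n) L \<theta> G"
proof -
  have k: "0 \<le> kappa CARD('n) L \<theta> G" by (simp add: kappa_def)
  have "0 \<le> ln (exp 1 + kappa CARD('n) L \<theta> G * (1 + G\<^sup>2))"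
    using k by (intro ln_ge_zero) (simp add: add_increasing2)
  then show "0 \<le> C_d CARD('n) L \<theta> G" by (simp add: C_d_def)
qed (use params in \<open>auto simp: c_0_def c_1_def c_2_def\<close>)

lemma mbound_nonneg: "0 \<le> mbound T w"
  unfolding mbound_def
  using F1_nonneg constants_nonneg err_sum_nonneg Lam_ge_1[of T]
  by (intro mult_nonneg_nonneg add_nonneg_nonneg) auto

lemma bdd_mbound: "bdd_rv T (mbound T)"
  unfolding mbound_def[abs_def] by (intro bdd_rv_intros bdd_err_sum)

lemma expectation_mbound_le:
  assumes T: "1 \<le> T"
  shows "P.expectation (mbound T) \<le> C_w CARD('n) L \<theta> G F1 * ln (exp 1 + real T)"
proof -
  define \<Lambda> where "\<Lambda> = ln (exp 1 + real T)"
  have \<Lambda>: "1 \<le> \<Lambda>" using Lam_ge_1 by (simp add: \<Lambda>_def)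
  have "P.expectation (mbound T) = 1 / c_0 \<theta> * (F1 + c_1 CARD('n) \<theta> * P.expectation (err_sum T)
    + c_2 CARD('n) L \<theta> * (C_d CARD('n) L \<theta> G * \<Lambda>))"
    unfolding mbound_def[abs_def] using bdd_rv_integrable[OF bdd_err_sum] by (simp add: P.prob_space \<Lambda>_def)
  also have "\<dots> \<le> 1 / c_0 \<theta> * (F1 * \<Lambda> + c_1 CARD('n) \<theta> * (C_c CARD('n) L \<theta> G * \<Lambda>)
    + c_2 CARD('n) L \<theta> * (C_d CARD('n) L \<theta> G * \<Lambda>))"
    using expectation_err_sum_le[OF T] constants_nonneg F1_nonneg \<Lambda> mult_left_mono[OF \<Lambda> F1_nonneg]
    by (intro mult_left_mono add_mono order_refl) (auto simp: \<Lambda>_def)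
  also have "\<dots> = C_w CARD('n) L \<theta> G F1 * \<Lambda>"
    unfolding C_w_def by (simp add: algebra_simps)
  finally show ?thesis by (simp add: \<Lambda>_def)
qed

lemma expectation_mbound_sq_le:
  assumes T: "1 \<le> T"
  shows "P.expectation (\<lambda>w. (mbound T w)\<^sup>2) \<le> C_x CARD('n) L \<theta> G F1 * (ln (exp 1 + real T))\<^sup>2"
proof -
  define \<Lambda> where "\<Lambda> = ln (exp 1 + real T)"
  have \<Lambda>: "1 \<le> \<Lambda>\<^sup>2" using Lam_ge_1[of T] by (simp add: \<Lambda>_def)
  define e where "e = c_2 CARD('n) L \<theta> * (C_d CARD('n) L \<theta> G * \<Lambda>)"
  have ie: "integrable P (\<lambda>w. (err_sum T w)\<^sup>2)" "integrable P (\<lambda>w. (mbound T w)\<^sup>2)"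
    by (intro bdd_rv_integrable[of T] bdd_rv_power bdd_err_sum bdd_mbound)+
  have "P.expectation (\<lambda>w. (mbound T w)\<^sup>2)
      \<le> P.expectation (\<lambda>w. 3 / (c_0 \<theta>)\<^sup>2 * (F1\<^sup>2 + (c_1 CARD('n) \<theta>)\<^sup>2 * (err_sum T w)\<^sup>2 + e\<^sup>2))"
  proof (rule integral_mono)
    fix w
    have "(mbound T w)\<^sup>2 = 1 / (c_0 \<theta>)\<^sup>2 * (F1 + c_1 CARD('n) \<theta> * err_sum T w + e)\<^sup>2"
      by (simp add: mbound_def e_def \<Lambda>_def power_divide)
    also have "\<dots> \<le> 1 / (c_0 \<theta>)\<^sup>2 * (3 * (F1\<^sup>2 + (c_1 CARD('n) \<theta> * err_sum T w)\<^sup>2 + e\<^sup>2))"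
      by (intro mult_left_mono power2_sum3_le) auto
    finally show "(mbound T w)\<^sup>2 \<le> 3 / (c_0 \<theta>)\<^sup>2 * (F1\<^sup>2 + (c_1 CARD('n) \<theta>)\<^sup>2 * (err_sum T w)\<^sup>2 + e\<^sup>2)"
      by (simp add: power_mult_distrib)
  qed (use ie in auto)
  also have "\<dots> = 3 / (c_0 \<theta>)\<^sup>2 * (F1\<^sup>2 + (c_1 CARD('n) \<theta>)\<^sup>2 * P.expectation (\<lambda>w. (err_sum T w)\<^sup>2) + e\<^sup>2)"
    using ie by (simp add: P.prob_space)
  also have "\<dots> \<le> 3 / (c_0 \<theta>)\<^sup>2 * (F1\<^sup>2 * \<Lambda>\<^sup>2 + (c_1 CARD('n) \<theta>)\<^sup>2 * (C_u CARD('n) L \<theta> G * \<Lambda>\<^sup>2) + e\<^sup>2)"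
    using expectation_err_sum_sq_le[OF T] mult_left_mono[OF \<Lambda>, of "F1\<^sup>2"]
    by (intro mult_left_mono add_mono order_refl) (auto simp: \<Lambda>_def)
  also have "\<dots> = C_x CARD('n) L \<theta> G F1 * \<Lambda>\<^sup>2"
    unfolding C_x_def e_def power_mult_distrib by (simp add: algebra_simps)
  finally show ?thesis by (simp add: \<Lambda>_def)
qed

section \<open>Gradient noise and the expected gradient norms\<close>

definition noise_sum :: "nat \<Rightarrow> 'w \<Rightarrow> real"
  where "noise_sum T w = (\<Sum>t<T. (norm (g (Suc t) w - grad f (X (Suc t) w)))\<^sup>2)"

lemma bdd_noise_term: "bdd_rv (Suc t) (\<lambda>w. (norm (g (Suc t) w - grad f (X (Suc t) w)))\<^sup>2)"
proof (rule bdd_rv_power, rule bdd_rvI)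
  have [measurable]: "X (Suc t) \<in> borel_measurable (Fil (Suc t))" "g (Suc t) \<in> borel_measurable (Fil (Suc t))"
    using X_measurable[of "Suc t" "Suc t"] stoch_grad_measurable by auto
  show "(\<lambda>w. norm (g (Suc t) w - grad f (X (Suc t) w))) \<in> borel_measurable (Fil (Suc t))"
    by measurable
  show "AE w in P. \<bar>norm (g (Suc t) w - grad f (X (Suc t) w))\<bar> \<le> G + G"
    using AE_sample_bounded
  proof eventually_elim
    case (elim w)
    then show ?case
      using grad_f_bounded[of "X (Suc t) w"] unfolding abs_norm_cancel
      by (intro norm_triangle_le_diff add_mono) (auto simp: stoch_grad_def)
  qed
qed

text \<open>The iterate at \<open>Suc t\<close> is known at time t, so the variance bound is applied
  at a frozen point. This is where \<sigma> enters.\<close>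

lemma expectation_noise_term_le:
  "P.expectation (\<lambda>w. (norm (g (Suc t) w - grad f (X (Suc t) w)))\<^sup>2) \<le> \<sigma>\<^sup>2"
proof -
  define H where "H z = (norm (grad (F (snd z)) (X (Suc t) (fst z)) - grad f (X (Suc t) (fst z))))\<^sup>2" for z
  have X [measurable]: "X (Suc t) \<in> borel_measurable (Fil t)"
    by (rule X_measurable) simp
  have [measurable]: "(\<lambda>z. grad (F (snd z)) (X (Suc t) (fst z))) \<in> borel_measurable (Fil t \<Otimes>\<^sub>M D)"
    by (rule grad_F_snd_measurable[OF X])
  have H: "H \<in> borel_measurable (Fil t \<Otimes>\<^sub>M D)"
    unfolding H_def[abs_def] by measurable
  have eq: "H (w, \<xi> (Suc t) w) = (norm (g (Suc t) w - grad f (X (Suc t) w)))\<^sup>2" for w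
    by (simp add: H_def stoch_grad_def)
  have int: "integrable P (\<lambda>w. H (w, \<xi> (Suc t) w))"
    unfolding eq by (rule bdd_rv_integrable[OF bdd_noise_term])
  have "P.expectation (\<lambda>w. H (w, \<xi> (Suc t) w)) = P.expectation (\<lambda>w. D.expectation (\<lambda>y. H (w, y)))"
    by (rule expectation_condition[OF H int])
  also have "\<dots> \<le> P.expectation (\<lambda>w. \<sigma>\<^sup>2)"
    by (intro integral_mono integrable_condition[OF H int]) (auto simp: H_def variance)
  finally show ?thesis unfolding eq by (simp add: P.prob_space)
qed

lemma int_noise_sum: "integrable P (noise_sum T)"
  and expectation_noise_sum_le: "P.expectation (noise_sum T) \<le> \<sigma>\<^sup>2 * real T"
proof -
  note int = bdd_rv_integrable[OF bdd_noise_term]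
  show "integrable P (noise_sum T)"
    unfolding noise_sum_def[abs_def] using int by simp
  have "P.expectation (noise_sum T) = (\<Sum>t<T. P.expectation (\<lambda>w. (norm (g (Suc t) w - grad f (X (Suc t) w)))\<^sup>2))"
    unfolding noise_sum_def[abs_def] using int by simp
  also have "\<dots> \<le> (\<Sum>t<T. \<sigma>\<^sup>2)"
    by (intro sum_mono expectation_noise_term_le)
  finally show "P.expectation (noise_sum T) \<le> \<sigma>\<^sup>2 * real T"
    by (simp add: mult.commute)
qed

text \<open>Dominates \<open>k^2\<close> by \<open>(a + b)^2 \<le> 2 a^2 + 2 b^2\<close>; it has no
  roots, so its mean follows from moments of \<open>mbound\<close> and
  \<open>err_sum\<close>.\<close>

definition ksq :: "nat \<Rightarrow> 'w \<Rightarrow> real"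
  where "ksq T w = 2 * (2 * mbound T w + 2 * (mbound T w)\<^sup>2) + 2 * err_sum T w"

lemma int_ksq: "integrable P (ksq T)"
  unfolding ksq_def[abs_def]
  by (rule bdd_rv_integrable[of T]) (intro bdd_rv_intros bdd_mbound bdd_err_sum)

lemma C_z_ge: "1 \<le> C_z CARD('n) L \<theta> G F1"
  and C_z_sq_ge: "8 * (C_w CARD('n) L \<theta> G F1 + C_x CARD('n) L \<theta> G F1) + 2 * C_c CARD('n) L \<theta> G \<le> (C_z CARD('n) L \<theta> G F1)\<^sup>2"
proof -
  define l where "l = ln (exp 1 + kappa CARD('n) L \<theta> G + kappa CARD('n) L \<theta> G * G\<^sup>2)"
  define v where "v = varpi G"
  define cw cx cc where "cw = C_w CARD('n) L \<theta> G F1" and "cx = C_x CARD('n) L \<theta> G F1" and "cc = C_c CARD('n) L \<theta> G"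
  have k: "0 \<le> kappa CARD('n) L \<theta> G" by (simp add: kappa_def)
  have v: "1 \<le> v"
    unfolding v_def varpi_def using lam_ge_1 by (intro ge_one_powr_ge_zero) auto
  have l: "1 \<le> l"
    unfolding l_def using k by (subst ln_ge_iff) (auto simp: add_pos_nonneg add.assoc intro!: add_pos_nonneg)
  have "64 * 1 * 1 \<le> (64 * (1 + G\<^sup>2)\<^sup>2 + 64 * real CARD('n) * L\<^sup>2 * \<theta>\<^sup>2) * l"
  proof (rule mult_mono)
    have "1 \<le> (1 + G\<^sup>2)\<^sup>2" by (simp add: power2_sum)
    moreover have "0 \<le> real CARD('n) * L\<^sup>2 * \<theta>\<^sup>2" by simp
    ultimately show "64 * 1 \<le> 64 * (1 + G\<^sup>2)\<^sup>2 + 64 * real CARD('n) * L\<^sup>2 * \<theta>\<^sup>2" by linarith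
  qed (use l in auto)
  then have cc: "1 \<le> cc"
    by (simp add: cc_def C_c_def C_b_def l_def add_increasing)
  \<comment> \<open>Nonnegativity of \<open>C_w\<close> and \<open>C_x\<close> is read off from the
    moment bounds at \<open>T = 1\<close>, whose left sides are nonnegative.\<close>
  have "0 \<le> cw * ln (exp 1 + real 1)"
    unfolding cw_def by (rule order_trans[OF _ expectation_mbound_le]) (auto intro!: integral_nonneg_AE simp: mbound_nonneg)
  moreover have "0 \<le> cx * (ln (exp 1 + real 1))\<^sup>2"
    unfolding cx_def by (rule order_trans[OF _ expectation_mbound_sq_le]) (auto intro!: integral_nonneg_AE)
  ultimately have cw: "0 \<le> cw" and cx: "0 \<le> cx"
    using Lam_ge_1[of 1] by (auto simp: zero_le_mult_iff)
  have v4: "1 \<le> v powr (1/4)"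
    using v by (intro ge_one_powr_ge_zero) auto
  have zdef: "C_z CARD('n) L \<theta> G F1 = sqrt (2 * (4 * v\<^sup>2 * (cw + cx))) + sqrt (2 * cc) * v powr (1/4)"
    by (simp add: C_z_def C_v_def v_def cw_def cx_def cc_def)
  have "8 * (cw + cx) \<le> 2 * (4 * v\<^sup>2 * (cw + cx))"
    using cw cx v mult_right_mono[of 1 "v\<^sup>2" "cw + cx"] by simp
  then have "sqrt (8 * (cw + cx)) \<le> sqrt (2 * (4 * v\<^sup>2 * (cw + cx)))"
    by (rule real_sqrt_le_mono)
  moreover have "sqrt (2 * cc) * 1 \<le> sqrt (2 * cc) * v powr (1/4)"
    using v4 cc by (intro mult_left_mono) auto
  ultimately have z: "sqrt (8 * (cw + cx)) + sqrt (2 * cc) \<le> C_z CARD('n) L \<theta> G F1"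
    unfolding zdef by (simp only: mult_1_right add_mono)
  have "1 \<le> sqrt (2 * cc)" using cc by simp
  moreover have "0 \<le> sqrt (8 * (cw + cx))" using cw cx by simp
  ultimately show "1 \<le> C_z CARD('n) L \<theta> G F1" using z by linarith
  have "8 * (cw + cx) + 2 * cc \<le> (sqrt (8 * (cw + cx)) + sqrt (2 * cc))\<^sup>2"
    using cw cx cc by (simp add: power2_sum)
  also have "\<dots> \<le> (C_z CARD('n) L \<theta> G F1)\<^sup>2"
    using z cw cx cc by (intro power_mono) auto
  finally show "8 * (C_w CARD('n) L \<theta> G F1 + C_x CARD('n) L \<theta> G F1) + 2 * C_c CARD('n) L \<theta> G \<le> (C_z CARD('n) L \<theta> G F1)\<^sup>2"
    unfolding cw_def cx_def cc_def
    by (rule order_trans[rotated]) (use cw[unfolded cw_def] cx[unfolded cx_def] in \<open>simp add: cw_def\<close>)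
qed

lemma expectation_ksq_le:
  assumes T: "1 \<le> T"
  shows "P.expectation (ksq T) \<le> (C_z CARD('n) L \<theta> G F1 * ln (exp 1 + real T))\<^sup>2"
proof -
  define \<Lambda> where "\<Lambda> = ln (exp 1 + real T)"
  define cw cx cc where "cw = C_w CARD('n) L \<theta> G F1" and "cx = C_x CARD('n) L \<theta> G F1" and "cc = C_c CARD('n) L \<theta> G"
  have \<Lambda>: "1 \<le> \<Lambda>" using Lam_ge_1 by (simp add: \<Lambda>_def)
  have \<Lambda>2: "\<Lambda> \<le> \<Lambda>\<^sup>2" using \<Lambda> by (simp add: power2_eq_square)
  have int: "integrable P (mbound T)" "integrable P (\<lambda>w. (mbound T w)\<^sup>2)" "integrable P (err_sum T)"
    by (intro bdd_rv_integrable[of T] bdd_rv_power bdd_mbound bdd_err_sum)+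
  have m1: "P.expectation (mbound T) \<le> cw * \<Lambda>" and m2: "P.expectation (\<lambda>w. (mbound T w)\<^sup>2) \<le> cx * \<Lambda>\<^sup>2"
    and m3: "P.expectation (err_sum T) \<le> cc * \<Lambda>"
    using expectation_mbound_le[OF T] expectation_mbound_sq_le[OF T] expectation_err_sum_le[OF T]
    by (auto simp: cw_def cx_def cc_def \<Lambda>_def)
  have "0 \<le> P.expectation (mbound T)" "0 \<le> P.expectation (err_sum T)"
    using mbound_nonneg err_sum_nonneg by (auto intro!: integral_nonneg_AE)
  then have "0 \<le> cw * \<Lambda>" "0 \<le> cc * \<Lambda>" using m1 m3 by auto
  then have "0 \<le> cw" "0 \<le> cc" using \<Lambda> by (auto simp: zero_le_mult_iff)
  then have le: "cw * \<Lambda> \<le> cw * \<Lambda>\<^sup>2" "cc * \<Lambda> \<le> cc * \<Lambda>\<^sup>2"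
    using \<Lambda>2 by (auto intro: mult_left_mono)
  have "P.expectation (ksq T) = 2 * (2 * P.expectation (mbound T) + 2 * P.expectation (\<lambda>w. (mbound T w)\<^sup>2)) + 2 * P.expectation (err_sum T)"
    unfolding ksq_def[abs_def] using int by simp
  also have "\<dots> \<le> 2 * (2 * (cw * \<Lambda>\<^sup>2) + 2 * (cx * \<Lambda>\<^sup>2)) + 2 * (cc * \<Lambda>\<^sup>2)"
    using m1 m2 m3 le by (intro add_mono mult_left_mono) auto
  also have "\<dots> = (4 * (cw + cx) + 2 * cc) * \<Lambda>\<^sup>2"
    by (simp add: algebra_simps)
  also have "\<dots> \<le> (C_z CARD('n) L \<theta> G F1)\<^sup>2 * \<Lambda>\<^sup>2"
  proof (rule mult_right_mono)
    have "0 \<le> P.expectation (\<lambda>w. (mbound T w)\<^sup>2)"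
      by (auto intro!: integral_nonneg_AE)
    then have "0 \<le> cx * \<Lambda>\<^sup>2" using m2 by linarith
    then have "0 \<le> cx" using \<Lambda> by (auto simp: zero_le_mult_iff)
    then show "4 * (cw + cx) + 2 * cc \<le> (C_z CARD('n) L \<theta> G F1)\<^sup>2"
      using C_z_sq_ge \<open>0 \<le> cw\<close> unfolding cw_def[symmetric] cx_def[symmetric] cc_def[symmetric] by simp
  qed simp
  finally show ?thesis by (simp add: power_mult_distrib \<Lambda>_def)
qed

text \<open>Young's inequality is used with \<open>\<mu>\<close> for \<open>y k\<close> and with
  \<open>Z\<close> for \<open>k\<close> itself, and the cube root is replaced by its tangent at
  \<open>c\<close>. The right side is then linear in \<open>noise_sum\<close> and
  \<open>ksq\<close>, so their means suffice.\<close>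

lemma AE_sum_grad_le:
  assumes T: "1 \<le> T" and \<mu>: "0 < \<mu>" and Z: "0 < Z" and c: "0 < c"
  shows "AE w in P. (\<Sum>t=1..T. norm (grad f (X t w))) \<le> sqrt (real T) / 2 *
    (\<mu> * (c powr (1/3) + (1 + noise_sum T w - c) / (3 * (c powr (1/3))\<^sup>2) + (ksq T w / Z + Z) / 2) + ksq T w / \<mu>)"
  using AE_path
proof eventually_elim
  case (elim w)
  then interpret path: optmuon_objective_path F "s w" "x w" Orth \<theta> L G X1 f fstar .
  define y where "y = (1 + grad_sq_sum F (s w) (x w) T) powr (1/6)"
  define k where "k = sqrt (2 * mbound T w + 2 * (mbound T w)\<^sup>2) + sqrt (err_sum T w)"
  have mb: "path.momentum_bound T = mbound T w"
    by (simp add: path.momentum_bound_def mbound_def err_sum_def)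
  have ns: "noise_sum T w = (\<Sum>t=1..T. (norm (g t w - grad f (X t w)))\<^sup>2)"
    unfolding noise_sum_def by (rule sum.reindex_bij_witness[of _ "\<lambda>t. t - 1" Suc]) auto
  have ns0: "0 \<le> noise_sum T w"
    by (simp add: noise_sum_def sum_nonneg)
  note b = path.sum_grad_bounds[OF T, unfolded mb, folded y_def err_sum_def, folded k_def, folded ns]
  have k: "k\<^sup>2 \<le> ksq T w"
  proof -
    define a b where "a = sqrt (2 * mbound T w + 2 * (mbound T w)\<^sup>2)" and "b = sqrt (err_sum T w)"
    have "k\<^sup>2 \<le> 2 * a\<^sup>2 + 2 * b\<^sup>2"
      using zero_le_power2[of "a - b"] by (simp add: k_def a_def[symmetric] b_def[symmetric] power2_diff power2_sum)
    also have "\<dots> = ksq T w"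
      using mbound_nonneg[of T w] err_sum_nonneg[of T w] by (simp add: a_def b_def ksq_def)
    finally show ?thesis .
  qed
  have young: "2 * (u * v) \<le> m * u\<^sup>2 + v\<^sup>2 / m" if "0 < m" for m u v :: real
  proof -
    have "0 \<le> (m * u - v)\<^sup>2 / m" using that by simp
    also have "\<dots> = m * u\<^sup>2 + v\<^sup>2 / m - 2 * (u * v)"
      using that by (simp add: power2_diff power2_eq_square field_simps)
    finally show ?thesis by simp
  qed
  have "2 * (1 * k) \<le> Z * 1\<^sup>2 + k\<^sup>2 / Z"
    by (rule young[OF Z])
  also have "k\<^sup>2 / Z \<le> ksq T w / Z"
    using k Z by (intro divide_right_mono) auto
  finally have k1: "k \<le> (ksq T w / Z + Z) / 2" by simp
  have "2 * (y * k) \<le> \<mu> * y\<^sup>2 + k\<^sup>2 / \<mu>"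
    by (rule young[OF \<mu>])
  also have "\<dots> \<le> \<mu> * (c powr (1/3) + (1 + noise_sum T w - c) / (3 * (c powr (1/3))\<^sup>2) + (ksq T w / Z + Z) / 2) + ksq T w / \<mu>"
  proof (intro add_mono mult_left_mono divide_right_mono)
    have "y\<^sup>2 \<le> (1 + noise_sum T w) powr (1/3) + k" by (rule b(2))
    also have "\<dots> \<le> (c powr (1/3) + (1 + noise_sum T w - c) / (3 * (c powr (1/3))\<^sup>2)) + (ksq T w / Z + Z) / 2"
      using ns0 k1 c by (intro add_mono cube_root_tangent) auto
    finally show "y\<^sup>2 \<le> c powr (1/3) + (1 + noise_sum T w - c) / (3 * (c powr (1/3))\<^sup>2) + (ksq T w / Z + Z) / 2" .
  qed (use \<mu> k in auto)
  finally have yk: "y * k \<le> (\<mu> * (c powr (1/3) + (1 + noise_sum T w - c) / (3 * (c powr (1/3))\<^sup>2) + (ksq T w / Z + Z) / 2) + ksq T w / \<mu>) / 2"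
    by simp
  have "(\<Sum>t=1..T. norm (grad f (X t w))) \<le> sqrt (real T) * (y * k)"
    by (rule b(1))
  also have "\<dots> \<le> sqrt (real T) * ((\<mu> * (c powr (1/3) + (1 + noise_sum T w - c) / (3 * (c powr (1/3))\<^sup>2) + (ksq T w / Z + Z) / 2) + ksq T w / \<mu>) / 2)"
    using yk by (rule mult_left_mono) simp
  finally show ?case by simp
qed


lemma bdd_norm_grad: "bdd_rv (t - 1) (\<lambda>w. norm (grad f (X t w)))"
proof (rule bdd_rvI)
  have "(\<lambda>w. grad f (X t w)) \<in> borel_measurable (Fil (t - 1))"
    by (rule measurable_compose[OF X_measurable_Fil grad_f_measurable])
  then show "(\<lambda>w. norm (grad f (X t w))) \<in> borel_measurable (Fil (t - 1))"
    by (rule borel_measurable_norm[THEN measurable_compose[rotated]])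
  show "AE w in P. \<bar>norm (grad f (X t w))\<bar> \<le> G"
    by (simp add: grad_f_bounded)
qed

lemma int_norm_grad: "integrable P (\<lambda>w. norm (grad f (X t w)))"
  using bdd_norm_grad by (rule bdd_rv_integrable)

lemma expectation_sum_grad_le:
  assumes T: "1 \<le> T"
  defines "Z \<equiv> C_z CARD('n) L \<theta> G F1 * ln (exp 1 + real T)"
  shows "(\<Sum>t=1..T. P.expectation (\<lambda>w. norm (grad f (X t w))))
    \<le> sqrt (real T) * (Z * sqrt ((1 + \<sigma>\<^sup>2 * real T) powr (1/3) + Z))"
proof -
  define c where "c = 1 + \<sigma>\<^sup>2 * real T"
  define r where "r = c powr (1/3)"
  define S where "S = sqrt (r + Z)"
  \<comment> \<open>Balances the two terms: \<open>\<mu> S^2 = Z^2 / \<mu> = Z S\<close>. As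
    \<open>c\<close> bounds the mean of \<open>1 + noise_sum\<close>, the tangent correction is at
    most 0 on average.\<close>
  define \<mu> where "\<mu> = Z / S"
  have Z: "1 \<le> Z"
    using mult_mono[OF C_z_ge Lam_ge_1[of T]] C_z_ge by (simp add: Z_def)
  have c: "0 < c" by (simp add: c_def add_pos_nonneg)
  have r: "0 < r" using c by (simp add: r_def)
  have S: "0 < S" "S\<^sup>2 = r + Z" using r Z by (auto simp: S_def)
  have \<mu>: "0 < \<mu>" using S Z by (simp add: \<mu>_def)
  have Z0: "0 < Z" using Z by simp
  note int = int_noise_sum[of T] int_ksq[of T]
  have "(\<Sum>t=1..T. P.expectation (\<lambda>w. norm (grad f (X t w)))) = P.expectation (\<lambda>w. \<Sum>t=1..T. norm (grad f (X t w)))"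
    using int_norm_grad by simp
  also have "\<dots> \<le> P.expectation (\<lambda>w. sqrt (real T) / 2 *
    (\<mu> * (r + (1 + noise_sum T w - c) / (3 * r\<^sup>2) + (ksq T w / Z + Z) / 2) + ksq T w / \<mu>))"
    using AE_sum_grad_le[OF T \<mu> Z0 c, folded r_def] int int_norm_grad by (intro integral_mono_AE) auto
  also have "\<dots> = sqrt (real T) / 2 * (\<mu> * (r + (1 + P.expectation (noise_sum T) - c) / (3 * r\<^sup>2) + (P.expectation (ksq T) / Z + Z) / 2) + P.expectation (ksq T) / \<mu>)"
    using int by (simp add: P.prob_space)
  also have "\<dots> \<le> sqrt (real T) / 2 * (\<mu> * (r + 0 + (Z\<^sup>2 / Z + Z) / 2) + Z\<^sup>2 / \<mu>)"
    using expectation_noise_sum_le[of T] expectation_ksq_le[OF T, folded Z_def] \<mu> Z0 r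
    by (intro mult_left_mono add_mono divide_right_mono order_refl) (auto simp: c_def divide_nonpos_pos)
  also have "\<dots> = sqrt (real T) / 2 * (\<mu> * S\<^sup>2 + Z\<^sup>2 / \<mu>)"
    unfolding S(2) using Z0 by (simp add: power2_eq_square)
  also have "\<dots> = sqrt (real T) * (Z * S)"
    using S(1) Z0 by (simp add: \<mu>_def power2_eq_square)
  finally show ?thesis by (simp add: S_def r_def c_def)
qed

lemma average_grad_le:
  assumes T: "1 \<le> T"
  shows "1 / real T * (\<Sum>t=1..T. P.expectation (\<lambda>w. norm (grad f (X t w))))
    \<le> C_A1 CARD('n) L \<theta> G F1 * (ln (exp 1 + real T) powr (3/2) / real T powr (1/2))
      + C_A2 CARD('n) L \<theta> G F1 * (\<sigma> powr (1/3) * ln (exp 1 + real T) / real T powr (1/3))"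
proof -
  define z where "z = C_z CARD('n) L \<theta> G F1"
  define \<Lambda> where "\<Lambda> = ln (exp 1 + real T)"
  have "1 / real T * (\<Sum>t=1..T. P.expectation (\<lambda>w. norm (grad f (X t w))))
      \<le> 1 / real T * (sqrt (real T) * (z * \<Lambda> * sqrt ((1 + \<sigma>\<^sup>2 * real T) powr (1/3) + z * \<Lambda>)))"
    using expectation_sum_grad_le[OF T] by (intro mult_left_mono) (auto simp: z_def \<Lambda>_def)
  also have "\<dots> = z * \<Lambda> * sqrt ((1 + \<sigma>\<^sup>2 * real T) powr (1/3) + z * \<Lambda>) / sqrt (real T)"
  proof -
    have "1 / real T * sqrt (real T) = 1 / sqrt (real T)"
      using T by (simp add: field_simps)
    then have "1 / real T * (sqrt (real T) * u) = 1 / sqrt (real T) * u" for u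
      by (simp only: mult.assoc[symmetric])
    then show ?thesis by simp
  qed
  also have "\<dots> \<le> 4 * z\<^sup>2 * (\<Lambda> powr (3/2) / real T powr (1/2)) + 2 * z * (\<sigma> powr (1/3) * \<Lambda> / real T powr (1/3))"
    using C_z_ge Lam_ge_1[of T] params T by (intro rate_arith) (auto simp: z_def \<Lambda>_def)
  finally show ?thesis
    by (simp only: C_A1_def C_A2_def z_def \<Lambda>_def)
qed

section \<open>Output at an independent uniform index\<close>

lemma expectation_indicator_mult:
  assumes ind: "P.indep_set (sets (vimage_algebra (space P) R (count_space UNIV))) (sets N)"
    and R: "R \<in> measurable P (count_space UNIV)"
    and N: "space N = space P" "Y \<in> borel_measurable N" "Y \<in> borel_measurable P"
    and int: "integrable P Y"
  shows "P.expectation (\<lambda>w. indicator {w. R w = t} w * Y w) = P.prob {w \<in> space P. R w = t} * P.expectation Y"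
proof -
  let ?I = "\<lambda>w. indicator {w. R w = t} w :: real"
  let ?V = "vimage_algebra (space P) R (count_space UNIV)"
  have R': "R \<in> measurable ?V (count_space UNIV)"
    by (rule measurable_vimage_algebra1) simp
  have I: "?I = (\<lambda>w. indicator {t} (R w))"
    by (auto simp: indicator_def)
  have It: "indicator {t} \<in> borel_measurable (count_space UNIV)"
    by simp
  have IV: "?I \<in> borel_measurable ?V" and IP: "?I \<in> borel_measurable P"
    unfolding I by (rule measurable_compose[OF R' It], rule measurable_compose[OF R It])
  have "P.indep_var borel ?I borel Y"
    unfolding P.indep_var_eq
  proof (intro conjI IP N(3))
    \<comment> \<open>Independence is given for two sigma-algebras and passes to the smaller ones
      generated by the indicator and by \<open>Y\<close>.\<close>
    have "sigma_sets (space P) {?I -` A \<inter> space P |A. A \<in> sets borel} \<subseteq> sets ?V"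
      using sets.sigma_sets_subset[of "{?I -` A \<inter> space P |A. A \<in> sets borel}" ?V] measurable_sets[OF IV] by auto
    moreover have "sigma_sets (space P) {Y -` A \<inter> space P |A. A \<in> sets borel} \<subseteq> sets N"
      using sets.sigma_sets_subset[of "{Y -` A \<inter> space P |A. A \<in> sets borel}" N] measurable_sets[OF N(2)] by (auto simp: N(1))
    ultimately show "P.indep_set (sigma_sets (space P) {?I -` A \<inter> space P |A. A \<in> sets borel})
        (sigma_sets (space P) {Y -` A \<inter> space P |A. A \<in> sets borel})"
      using ind unfolding P.indep_sets2_eq by blast
  qed
  moreover have "integrable P ?I"
    using IP by (intro P.integrable_const_bound[of _ 1]) (auto simp: indicator_def)
  ultimately have "P.expectation (\<lambda>w. ?I w * Y w) = P.expectation ?I * P.expectation Y"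
    using int by (intro P.indep_var_lebesgue_integral)
  moreover have "P.expectation ?I = P.prob {w \<in> space P. R w = t}"
  proof -
    have "{w \<in> space P. R w = t} = R -` {t} \<inter> space P" by auto
    then have "{w \<in> space P. R w = t} \<in> sets P" using measurable_sets[OF R, of "{t}"] by simp
    moreover have "P.expectation ?I = P.expectation (indicator {w \<in> space P. R w = t})"
      by (intro Bochner_Integration.integral_cong) (auto simp: indicator_def)
    ultimately show ?thesis by simp
  qed
  ultimately show ?thesis by simp
qed

text \<open>The values of \<open>R\<close> partition almost every outcome. Each fixed iterate is a
  function of the samples, which are independent of \<open>R\<close>, so each part factorizes with
  probability \<open>1 / T\<close>.\<close>

lemma random_iterate:
  assumes T: "1 \<le> T"
    and R: "R \<in> measurable P (count_space UNIV)"
    and uniform: "distr P (count_space UNIV) R = measure_pmf (pmf_of_set {1..T})"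
    and ind: "P.indep_set (sets (vimage_algebra (space P) R (count_space UNIV)))
      (sets (vimage_algebra (space P) (\<lambda>w. \<lambda>t\<in>{1..}. \<xi> t w) (Pi\<^sub>M {1..} (\<lambda>_. D))))"
  shows "integrable P (\<lambda>w. norm (grad f (X (R w) w)))"
    and "P.expectation (\<lambda>w. norm (grad f (X (R w) w))) = 1 / real T * (\<Sum>t=1..T. P.expectation (\<lambda>w. norm (grad f (X t w))))"
proof -
  let ?N = "vimage_algebra (space P) (\<lambda>w. \<lambda>t\<in>{1..}. \<xi> t w) (Pi\<^sub>M {1..} (\<lambda>_. D))"
  have meas: "(\<lambda>w. norm (grad f (X (R w) w))) \<in> borel_measurable P"
    using Fil_measurable_P[OF bdd_rv_measurable[OF bdd_norm_grad]] R by (rule measurable_compose_countable)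
  show "integrable P (\<lambda>w. norm (grad f (X (R w) w)))"
    by (rule P.integrable_const_bound[OF AE_I2 meas, of G]) (simp add: grad_f_bounded)
  have prob: "P.prob {w \<in> space P. R w = t} = 1 / real T" if "t \<in> {1..T}" for t
  proof -
    have "{w \<in> space P. R w = t} = R -` {t} \<inter> space P" by auto
    then have "P.prob {w \<in> space P. R w = t} = measure (distr P (count_space UNIV) R) {t}"
      using R by (simp add: measure_distr)
    also have "\<dots> = 1 / real T"
      using that T unfolding uniform by (subst measure_pmf_of_set) (auto simp: Int_insert_right)
    finally show ?thesis .
  qed
  have "AE r in distr P (count_space UNIV) R. r \<in> {1..T}"
    using T unfolding uniform AE_measure_pmf_iff by (simp add: set_pmf_of_set)
  then have range: "AE w in P. R w \<in> {1..T}"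
    by (rule AE_distrD[OF R])
  have int: "integrable P (\<lambda>w. indicator {w. R w = t} w * norm (grad f (X t w)))" for t
  proof (rule P.integrable_const_bound[of _ G])
    have I: "(\<lambda>w. indicator {w. R w = t} w :: real) = (\<lambda>w. indicator {t} (R w))"
      by (auto simp: indicator_def)
    have It: "(indicator {t} :: nat \<Rightarrow> real) \<in> borel_measurable (count_space UNIV)"
      by simp
    have "(\<lambda>w. indicator {w. R w = t} w :: real) \<in> borel_measurable P"
      unfolding I by (rule measurable_compose[OF R It])
    then show "(\<lambda>w. indicator {w. R w = t} w * norm (grad f (X t w))) \<in> borel_measurable P"
      by (rule borel_measurable_times[OF _ borel_measurable_integrable[OF int_norm_grad]])
    show "AE w in P. norm (indicator {w. R w = t} w * norm (grad f (X t w))) \<le> G"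
      by (intro AE_I2) (use params in \<open>simp add: indicator_def grad_f_bounded\<close>)
  qed
  have "P.expectation (\<lambda>w. norm (grad f (X (R w) w))) = P.expectation (\<lambda>w. \<Sum>t=1..T. indicator {w. R w = t} w * norm (grad f (X t w)))"
  proof (rule integral_cong_AE)
    show "AE w in P. norm (grad f (X (R w) w)) = (\<Sum>t=1..T. indicator {w. R w = t} w * norm (grad f (X t w)))"
      using range
    proof eventually_elim
      case (elim w)
      have "(\<Sum>t=1..T. indicator {w. R w = t} w * norm (grad f (X t w))) = (\<Sum>t=1..T. if t = R w then norm (grad f (X t w)) else 0)"
        by (intro sum.cong) (auto simp: indicator_def)
      then show ?case using elim by simp
    qed
    show "(\<lambda>w. \<Sum>t=1..T. indicator {w. R w = t} w * norm (grad f (X t w))) \<in> borel_measurable P"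
      using int by (intro borel_measurable_sum borel_measurable_integrable)
  qed (rule meas)
  also have "\<dots> = (\<Sum>t=1..T. P.expectation (\<lambda>w. indicator {w. R w = t} w * norm (grad f (X t w))))"
    by (rule Bochner_Integration.integral_sum) (rule int)
  also have "\<dots> = (\<Sum>t=1..T. 1 / real T * P.expectation (\<lambda>w. norm (grad f (X t w))))"
  proof (rule sum.cong[OF refl])
    fix t assume t: "t \<in> {1..T}"
    have id: "(\<lambda>w. w) \<in> measurable ?N (Fil (t - 1))"
      by (intro id_measurable_Fil sample_measurable_vimage) auto
    have N: "(\<lambda>w. norm (grad f (X t w))) \<in> borel_measurable ?N"
      using measurable_compose[OF id bdd_rv_measurable[OF bdd_norm_grad[of t]]] .
    show "P.expectation (\<lambda>w. indicator {w. R w = t} w * norm (grad f (X t w))) = 1 / real T * P.expectation (\<lambda>w. norm (grad f (X t w)))"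
      using expectation_indicator_mult[OF ind R _ N borel_measurable_integrable[OF int_norm_grad] int_norm_grad, of t] prob[OF t]
      by simp
  qed
  finally show "P.expectation (\<lambda>w. norm (grad f (X (R w) w))) = 1 / real T * (\<Sum>t=1..T. P.expectation (\<lambda>w. norm (grad f (X t w))))"
    by (simp add: sum_distrib_left)
qed

end

theorem theorem23:
  fixes D :: "'s measure"
    and F :: "'s \<Rightarrow> real^'n^'m \<Rightarrow> real"
    and f :: "real^'n^'m \<Rightarrow> real"
    and Orth :: "real^'n^'m \<Rightarrow> real^'n^'m"
    and P :: "'w measure"
    and \<xi> :: "nat \<Rightarrow> 'w \<Rightarrow> 's"
    and X1 :: "real^'n^'m"
    and X :: "nat \<Rightarrow> 'w \<Rightarrow> real^'n^'m"
    and \<theta> L \<sigma> G fstar :: real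
    and T :: nat
  assumes dims: "CARD('n) \<le> CARD('m)"
    and params: "\<theta> > 0" "L > 0" "\<sigma> \<ge> 0" "G > 0"
    and D: "prob_space D"
    and f_expectation: "\<And>Y. has_bochner_integral D (\<lambda>x. F x Y) (f Y)"
    and differentiable_F: "\<And>x Y. x \<in> space D \<Longrightarrow> F x differentiable at Y"
    and differentiable_f: "\<And>Y. f differentiable at Y"
    and lower_bound: "\<And>Y. f Y \<ge> fstar"
    and unbiased: "\<And>Y. has_bochner_integral D (\<lambda>x. grad (F x) Y) (grad f Y)"
    and variance_integrable:
      "\<And>Y. integrable D (\<lambda>x. (norm (grad (F x) Y - grad f Y))\<^sup>2)"
    and variance:
      "\<And>Y. prob_space.expectation D (\<lambda>x. (norm (grad (F x) Y - grad f Y))\<^sup>2) \<le> \<sigma>\<^sup>2"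
    and lipschitz:
      "\<And>x Y Z. x \<in> space D \<Longrightarrow> norm (grad (F x) Y - grad (F x) Z) \<le> L * norm (Y - Z)"
    and bounded_grad: "AE x in D. \<forall>Y. norm (grad (F x) Y) \<le> G"
    and Orth: "orthogonalization Orth"
    and P: "prob_space P"
    and samples_indep: "prob_space.indep_vars P (\<lambda>_. D) \<xi> {1..}"
    and samples_distr: "\<And>t. t \<ge> 1 \<Longrightarrow> distr P D (\<xi> t) = D"
    and run: "\<And>\<omega>. \<omega> \<in> space P \<Longrightarrow> OptMuon_I F Orth \<theta> X1 (\<lambda>t. \<xi> t \<omega>) (\<lambda>t. X t \<omega>)"
    and T: "T \<ge> 1"
  shows
    "(integrable P (\<lambda>\<omega>. 1 / real T * (\<Sum>t=1..T. norm (grad f (X t \<omega>)))) \<and>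
      prob_space.expectation P (\<lambda>\<omega>. 1 / real T * (\<Sum>t=1..T. norm (grad f (X t \<omega>))))
        \<le> C_A1 CARD('n) L \<theta> G (f X1 - fstar) * (ln (exp 1 + real T) powr (3/2) / real T powr (1/2))
          + C_A2 CARD('n) L \<theta> G (f X1 - fstar) *
            (\<sigma> powr (1/3) * ln (exp 1 + real T) / real T powr (1/3))) \<and>
     (\<forall>R :: 'w \<Rightarrow> nat.
        R \<in> measurable P (count_space UNIV) \<and>
        distr P (count_space UNIV) R = measure_pmf (pmf_of_set {1..T}) \<and>
        prob_space.indep_set P
          (sets (vimage_algebra (space P) R (count_space UNIV)))
          (sets (vimage_algebra (space P) (\<lambda>\<omega>. \<lambda>t\<in>{1..}. \<xi> t \<omega>) (Pi\<^sub>M {1..} (\<lambda>_. D))))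
        \<longrightarrow>
        integrable P (\<lambda>\<omega>. norm (grad f (X (R \<omega>) \<omega>))) \<and>
        prob_space.expectation P (\<lambda>\<omega>. norm (grad f (X (R \<omega>) \<omega>)))
          \<le> C_A1 CARD('n) L \<theta> G (f X1 - fstar) * (ln (exp 1 + real T) powr (3/2) / real T powr (1/2))
            + C_A2 CARD('n) L \<theta> G (f X1 - fstar) *
              (\<sigma> powr (1/3) * ln (exp 1 + real T) / real T powr (1/3)))"
proof -
  interpret optmuon_process P D F f Orth \<xi> X1 X \<theta> L \<sigma> G fstar
    using assms by (intro optmuon_process.intro optmuon_process_axioms.intro)
  let ?bound = "C_A1 CARD('n) L \<theta> G (f X1 - fstar) * (ln (exp 1 + real T) powr (3/2) / real T powr (1/2))
    + C_A2 CARD('n) L \<theta> G (f X1 - fstar) * (\<sigma> powr (1/3) * ln (exp 1 + real T) / real T powr (1/3))"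
  have average: "1 / real T * (\<Sum>t=1..T. prob_space.expectation P (\<lambda>\<omega>. norm (grad f (X t \<omega>)))) \<le> ?bound"
    by (rule average_grad_le[OF T])
  have expectation: "prob_space.expectation P (\<lambda>\<omega>. 1 / real T * (\<Sum>t=1..T. norm (grad f (X t \<omega>))))
      = 1 / real T * (\<Sum>t=1..T. prob_space.expectation P (\<lambda>\<omega>. norm (grad f (X t \<omega>))))"
    by (simp only: integral_mult_right_zero Bochner_Integration.integral_sum[OF int_norm_grad])
  have int: "integrable P (\<lambda>\<omega>. 1 / real T * (\<Sum>t=1..T. norm (grad f (X t \<omega>))))"
    by (intro integrable_mult_right Bochner_Integration.integrable_sum int_norm_grad)
  have random: "integrable P (\<lambda>\<omega>. norm (grad f (X (R \<omega>) \<omega>))) \<and>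
      prob_space.expectation P (\<lambda>\<omega>. norm (grad f (X (R \<omega>) \<omega>))) \<le> ?bound"
    if "R \<in> measurable P (count_space UNIV) \<and>
        distr P (count_space UNIV) R = measure_pmf (pmf_of_set {1..T}) \<and>
        prob_space.indep_set P
          (sets (vimage_algebra (space P) R (count_space UNIV)))
          (sets (vimage_algebra (space P) (\<lambda>\<omega>. \<lambda>t\<in>{1..}. \<xi> t \<omega>) (Pi\<^sub>M {1..} (\<lambda>_. D))))"
    for R :: "'w \<Rightarrow> nat"
  proof -
    note R = that[THEN conjunct1] that[THEN conjunct2, THEN conjunct1] that[THEN conjunct2, THEN conjunct2]
    show ?thesis
      unfolding random_iterate(2)[OF T R] using random_iterate(1)[OF T R] average by (rule conjI)
  qed
  show ?thesis
    by (intro conjI[OF conjI[OF int average[folded expectation]]] allI impI) (rule random)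
qed

end
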